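(* Let $k$ be a number field, $\mathcal C: y^2=f(x)$ a genus $2$ curve over $k$ ($f$ square-free of degree $6$) with Jacobian $\mathcal J$, and let $\varepsilon,\eta\in S^{(2)}(\mathcal J/k)$. Let $Q\in\mathcal J_\eta$ and let $\phi=\mu(-,Q):\mathcal J_\varepsilon\to\mathcal J_{\varepsilon+\eta}$, where $\mu:\mathcal J_\varepsilon\times\mathcal J_\eta\to\mathcal J_{\varepsilon+\eta}$ is the twisted group law. Let $(c_1:c_2:c_3:c_4)\in(\mathbb P^3)^\vee$, and let $H_\varepsilon$ and $H_{\varepsilon+\eta}$ be the divisors on $\mathcal J_\varepsilon$ and $\mathcal J_{\varepsilon+\eta}$ obtained by pulling back the hyperplane sections $\{x_1=0\}$ and $\{c_1x_1+\dots+c_4x_4=0\}$ along $\mathcal J_\varepsilon\to\mathcal K_\varepsilon\subset\mathbb P^3$ and $\mathcal J_{\varepsilon+\eta}\to\mathcal K_{\varepsilon+\eta}\subset\mathbb P^3$. Then $$g=\Phi_{\varepsilon,\eta}(x_1,\dots,x_4;\,x_1(Q),\dots,x_4(Q);\,c_1,c_2,c_3,c_4)/x_1^2$$ is a rational function on $\mathcal J_\varepsilon$ with divisor $$\operatorname{div}(g)=\phi^*H_{\varepsilon+\eta}+\iota_\varepsilon^*(\phi^*H_{\varepsilon+\eta})-2H_\varepsilon .$$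
   Context: Kummer surface. Write $f=f_6x^6+\dots+f_0$. Let $\Theta$ be the theta divisor on $\mathcal J$. The Kummer surface $\mathcal K=\mathcal J/[-1]\subset\mathbb P^3$ (embedded by $|2\Theta|$) is the quartic $F=0$, $F=P_2x_4^2-P_3x_4+P_4$, where $P_2=x_2^2-4x_1x_3$, $P_3=2(2f_0x_1^3+f_1x_1^2x_2+2f_2x_1^2x_3+f_3x_1x_2x_3+2f_4x_1x_3^2+f_5x_2x_3^2+2f_6x_3^3)$, and $P_4$ is defined by $P_3^2-4P_2P_4=16\operatorname{Res}_t(x_1t^2-x_2t+x_3,f(t))$. A general point $[(x,y)+(x',y')-\kappa]$ of $\mathcal J$ ($\kappa$ the canonical divisor) maps to $(1:x+x':xx':x_4)$ with $x_4=\big(\tfrac12P_3(1,x+x',xx')-2yy'\big)/(x-x')^2$. 2-coverings. The $2$-Selmer group is $S^{(2)}(\mathcal J/k)=\ker(H^1(k,\mathcal J[2])\to\prod_vH^1(k_v,\mathcal J))$. A class $\varepsilon\in H^1(k,\mathcal J[2])$ is represented by a $2$-covering $(\mathcal J_\varepsilon,\pi_\varepsilon)$ over $k$, with an isomorphism $\phi_\varepsilon:\mathcal J_\varepsilon\to\mathcal J$ over $\bar k$ such that $\pi_\varepsilon=[2]\circ\phi_\varepsilon$ and $\sigma(\phi_\varepsilon)\phi_\varepsilon^{-1}$ is translation by $\varepsilon_\sigma$, for a cocycle $(\varepsilon_\sigma)$ representing $\varepsilon$. Put $\iota_\varepsilon=\phi_\varepsilon^{-1}\circ[-1]\circ\phi_\varepsilon$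 (an involution defined over $k$). For $\varepsilon$ in the Selmer group the twisted Kummer surface $\mathcal K_\varepsilon=\mathcal J_\varepsilon/\iota_\varepsilon$ is embedded in $\mathbb P^3$ over $k$ with $\psi_\varepsilon\in\mathrm{GL}_4(\bar k)$ mapping $\mathcal K_\varepsilon$ to $\mathcal K$ compatibly with $\phi_\varepsilon$. For a point $Q$ of $\mathcal J_\varepsilon$ (resp. $\mathcal J_\eta$, etc.), $x_1(Q),\dots,x_4(Q)$ are homogeneous coordinates of its image in $\mathbb P^3$. Twisted group law. $\mu:\mathcal J_\varepsilon\times\mathcal J_\eta\to\mathcal J_{\varepsilon+\eta}$ is the morphism defined over $k$ with $\phi_{\varepsilon+\eta}(\mu(P,Q))=\phi_\varepsilon(P)+\phi_\eta(Q)$, where $\phi_{\varepsilon+\eta}$ has been chosen (up to translation by a $2$-torsion point) so that $\mu$ is defined over $k$. $(2,2,2)$-forms. Flynn's biquadratic forms $\Phi_{ij}(\mathbf x,\mathbf y)=\Phi_{ji}(\mathbf x,\mathbf y)$ ($1\le i,j\le4$, coefficients in $\mathbb Z[f_0,\dots,f_6]$, bihomogeneous of degree $(2,2)$) satisfy, for all $P,Q\in\mathcal J$, $\Phi_{ij}(x(P),x(Q))\propto x_i(P+Q)x_j(P-Q)+x_i(P-Q)x_j(P+Q)$ with constant of proportionality independent of $i,j$. Put $\Phi(\mathbf x,\mathbf y,\mathbf z)=\sum_{i,j=1}^4\Phi_{ij}(\mathbf x,\mathbf y)z_iz_j$. The twisted $(2,2,2)$-form $\Phi_{\varepsilon,\eta}$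 (well defined up to multiplication by $k^\times$) is the scalar multiple with coefficients in $k$ of $\Phi(\psi_\varepsilon\mathbf x,\psi_\eta\mathbf y,\psi_{\varepsilon+\eta}^{-T}\mathbf z)$; it satisfies, for $P\in\mathcal J_\varepsilon$, $Q\in\mathcal J_\eta$, $$\Phi_{\varepsilon,\eta}(x(P);x(Q);c_1,\dots,c_4)\propto\Big(\sum_ic_ix_i(\mu(P,Q))\Big)\Big(\sum_jc_jx_j(\mu(P,\iota_\eta(Q)))\Big)$$ with constant of proportionality independent of $c_1,\dots,c_4$. *)

theory Defs
  imports
    "HOL-Analysis.Analysis"
    "HOL-Algebra.Coset"
    "HOL-Computational_Algebra.Computational_Algebra"
    "Subresultants.Resultant_Prelim"
begin

(* The index operator of HOL-Analysis vectors is the only one used here. *)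
no_notation Matrix.vec_index (infixl "$" 100)

section \<open>Projective varieties over an algebraically closed field\<close>

text \<open>
  The algebraically closed field of characteristic 0 is a whole type; its subfields are sets.
  A point of projective space is the set of its homogeneous coordinate vectors, so
  \<open>v \<in> P\<close> reads: \<open>v\<close> is a vector of homogeneous coordinates of \<open>P\<close>.
  The field being infinite, forms are identified with the functions that they define.
\<close>

definition pt :: "'f::field ^ 'n \<Rightarrow> ('f ^ 'n) set" where
  "pt v = {c *s v | c. c \<noteq> 0}"

definition proj_space :: "('f::field ^ 'n) set set" where
  "proj_space = pt ` (UNIV - {0})"

definition exponents :: "nat \<Rightarrow> ('n::finite \<Rightarrow> nat) set" where
  "exponents d = {a. sum a UNIV = d}"

definition monomial :: "('n::finite \<Rightarrow> nat) \<Rightarrow> 'f::field ^ 'n \<Rightarrow> 'f" where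
  "monomial a v = (\<Prod>i\<in>UNIV. v $ i ^ a i)"

definition forms :: "'f::field set \<Rightarrow> nat \<Rightarrow> ('f ^ 'n::finite \<Rightarrow> 'f) set" where
  "forms S d = {\<lambda>v. \<Sum>a\<in>exponents d. c a * monomial a v | c. \<forall>a. c a \<in> S}"

definition biforms ::
  "'f::field set \<Rightarrow> nat \<Rightarrow> nat \<Rightarrow> ('f ^ 'n::finite \<Rightarrow> 'f ^ 'm::finite \<Rightarrow> 'f) set" where
  "biforms S d e =
     {\<lambda>v w. \<Sum>a\<in>exponents d. \<Sum>b\<in>exponents e. c a b * monomial a v * monomial b w
        | c. \<forall>a b. c a b \<in> S}"

definition triforms ::
  "'f::field set \<Rightarrow> nat \<Rightarrow> nat \<Rightarrow> nat \<Rightarrow>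
     ('f ^ 'n::finite \<Rightarrow> 'f ^ 'm::finite \<Rightarrow> 'f ^ 'l::finite \<Rightarrow> 'f) set" where
  "triforms S d e r =
     {\<lambda>v w z. \<Sum>a\<in>exponents d. \<Sum>b\<in>exponents e. \<Sum>g\<in>exponents r.
          c a b g * monomial a v * monomial b w * monomial g z
        | c. \<forall>a b g. c a b g \<in> S}"

definition vanishes_on :: "('f::field ^ 'n \<Rightarrow> 'f) \<Rightarrow> ('f ^ 'n) set set \<Rightarrow> bool" where
  "vanishes_on F X \<longleftrightarrow> (\<forall>P\<in>X. \<forall>v\<in>P. F v = 0)"

text \<open>The parameter \<open>S\<close> is the field of definition.\<close>

definition zariski_closed :: "'f::field set \<Rightarrow> ('f ^ 'n::finite) set set \<Rightarrow> bool" where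
  "zariski_closed S X \<longleftrightarrow>
     (\<exists>A \<subseteq> (\<Union>d. forms S d). X = {P \<in> proj_space. \<forall>F\<in>A. vanishes_on F {P}})"

definition irreducible_set :: "('f::field ^ 'n::finite) set set \<Rightarrow> bool" where
  "irreducible_set X \<longleftrightarrow> X \<noteq> {} \<and>
     (\<forall>A B. zariski_closed UNIV A \<longrightarrow> zariski_closed UNIV B \<longrightarrow> X \<subseteq> A \<union> B \<longrightarrow> X \<subseteq> A \<or> X \<subseteq> B)"

definition proj_variety :: "'f::field set \<Rightarrow> ('f ^ 'n::finite) set set \<Rightarrow> bool" where
  "proj_variety S X \<longleftrightarrow> zariski_closed S X \<and> irreducible_set X"

definition morphism ::
  "'f::field set \<Rightarrow> ('f ^ 'n::finite) set set \<Rightarrow> ('f ^ 'm::finite) set set \<Rightarrow>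
     (('f ^ 'n) set \<Rightarrow> ('f ^ 'm) set) \<Rightarrow> bool" where
  "morphism S X Z h \<longleftrightarrow> h ` X \<subseteq> Z \<and>
     (\<forall>P\<in>X. \<exists>d G. (\<forall>j. (\<lambda>v. G v $ j) \<in> forms S d) \<and> (\<exists>v\<in>P. G v \<noteq> 0) \<and>
        (\<forall>R\<in>X. \<forall>v\<in>R. G v \<noteq> 0 \<longrightarrow> h R = pt (G v)))"

text \<open>Morphisms from a product of two projective varieties, which are locally given by
  bihomogeneous forms.\<close>

definition morphism2 ::
  "'f::field set \<Rightarrow> ('f ^ 'n::finite) set set \<Rightarrow> ('f ^ 'm::finite) set set \<Rightarrow>
     ('f ^ 'l::finite) set set \<Rightarrow> (('f ^ 'n) set \<Rightarrow> ('f ^ 'm) set \<Rightarrow> ('f ^ 'l) set) \<Rightarrow> bool" where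
  "morphism2 S X Y Z h \<longleftrightarrow> (\<forall>P\<in>X. \<forall>Q\<in>Y. h P Q \<in> Z) \<and>
     (\<forall>P\<in>X. \<forall>Q\<in>Y. \<exists>d e G. (\<forall>j. (\<lambda>v w. G v w $ j) \<in> biforms S d e) \<and>
        (\<exists>v\<in>P. \<exists>w\<in>Q. G v w \<noteq> 0) \<and>
        (\<forall>R\<in>X. \<forall>T\<in>Y. \<forall>v\<in>R. \<forall>w\<in>T. G v w \<noteq> 0 \<longrightarrow> h R T = pt (G v w)))"

definition isomorphism ::
  "'f::field set \<Rightarrow> ('f ^ 'n::finite) set set \<Rightarrow> ('f ^ 'm::finite) set set \<Rightarrow>
     (('f ^ 'n) set \<Rightarrow> ('f ^ 'm) set) \<Rightarrow> bool" where
  "isomorphism S X Z h \<longleftrightarrow>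
     morphism S X Z h \<and> bij_betw h X Z \<and> morphism S Z X (inv_into X h)"


section \<open>Rational functions and divisors\<close>

text \<open>
  A rational function is represented by any function on points that agrees with a quotient of two
  forms of equal degree on a nonempty open subset; equality in the function field is
  \<open>generically_eq\<close>. Values outside the domain of definition are irrelevant.
\<close>

definition quotient_fun ::
  "('f::field ^ 'n \<Rightarrow> 'f) \<Rightarrow> ('f ^ 'n \<Rightarrow> 'f) \<Rightarrow> ('f ^ 'n) set \<Rightarrow> 'f" where
  "quotient_fun A B P = (let v = (SOME v. v \<in> P) in A v / B v)"

definition generically_eq ::
  "('f::field ^ 'n::finite) set set \<Rightarrow> (('f ^ 'n) set \<Rightarrow> 'f) \<Rightarrow> (('f ^ 'n) set \<Rightarrow> 'f) \<Rightarrow> bool" where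
  "generically_eq X g h \<longleftrightarrow>
     (\<exists>d. \<exists>B\<in>forms UNIV d. \<not> vanishes_on B X \<and>
        (\<forall>P\<in>X. \<not> vanishes_on B {P} \<longrightarrow> g P = h P))"

definition rational_functions :: "('f::field ^ 'n::finite) set set \<Rightarrow> (('f ^ 'n) set \<Rightarrow> 'f) set" where
  "rational_functions X = {g. \<exists>d. \<exists>A\<in>forms UNIV d. \<exists>B\<in>forms UNIV d.
     \<not> vanishes_on B X \<and> generically_eq X g (quotient_fun A B)}"

text \<open>Maximal irreducible closed proper subsets are the ones of codimension 1.\<close>

definition prime_divisor :: "('f::field ^ 'n::finite) set set \<Rightarrow> ('f ^ 'n) set set \<Rightarrow> bool" where
  "prime_divisor X Y \<longleftrightarrow> proj_variety UNIV Y \<and> Y \<subset> X \<and>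
     (\<forall>Z. proj_variety UNIV Z \<longrightarrow> Y \<subseteq> Z \<longrightarrow> Z \<subset> X \<longrightarrow> Z = Y)"

definition local_ring ::
  "('f::field ^ 'n::finite) set set \<Rightarrow> ('f ^ 'n) set set \<Rightarrow> (('f ^ 'n) set \<Rightarrow> 'f) set" where
  "local_ring X Y = {g. \<exists>d. \<exists>A\<in>forms UNIV d. \<exists>B\<in>forms UNIV d.
     \<not> vanishes_on B Y \<and> generically_eq X g (quotient_fun A B)}"

definition local_max_ideal ::
  "('f::field ^ 'n::finite) set set \<Rightarrow> ('f ^ 'n) set set \<Rightarrow> (('f ^ 'n) set \<Rightarrow> 'f) set" where
  "local_max_ideal X Y = {g. \<exists>d. \<exists>A\<in>forms UNIV d. \<exists>B\<in>forms UNIV d.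
     vanishes_on A Y \<and> \<not> vanishes_on B Y \<and> generically_eq X g (quotient_fun A B)}"

definition uniformizer ::
  "('f::field ^ 'n::finite) set set \<Rightarrow> ('f ^ 'n) set set \<Rightarrow> (('f ^ 'n) set \<Rightarrow> 'f) \<Rightarrow> bool" where
  "uniformizer X Y t \<longleftrightarrow> t \<in> local_max_ideal X Y \<and>
     (\<forall>s\<in>local_max_ideal X Y. \<exists>r\<in>local_ring X Y. generically_eq X s (\<lambda>P. r P * t P))"

definition has_order ::
  "('f::field ^ 'n::finite) set set \<Rightarrow> ('f ^ 'n) set set \<Rightarrow> (('f ^ 'n) set \<Rightarrow> 'f) \<Rightarrow> int \<Rightarrow> bool" where
  "has_order X Y g n \<longleftrightarrow>
     (\<exists>t u. uniformizer X Y t \<and> u \<in> local_ring X Y - local_max_ideal X Y \<and>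
        generically_eq X g (\<lambda>P. u P * t P powi n))"

definition order_along ::
  "('f::field ^ 'n::finite) set set \<Rightarrow> ('f ^ 'n) set set \<Rightarrow> (('f ^ 'n) set \<Rightarrow> 'f) \<Rightarrow> int" where
  "order_along X Y g = (THE n. has_order X Y g n)"

text \<open>The local rings at the prime divisors are discrete valuation rings. This part of
  nonsingularity is what the definition of the divisor of a function rests on.\<close>

definition regular_in_codim_one :: "('f::field ^ 'n::finite) set set \<Rightarrow> bool" where
  "regular_in_codim_one X \<longleftrightarrow>
     (\<forall>Y g. prime_divisor X Y \<longrightarrow> g \<in> rational_functions X \<longrightarrow>
        \<not> generically_eq X g (\<lambda>P. 0) \<longrightarrow> (\<exists>n. has_order X Y g n))"

text \<open>A divisor is a function giving the multiplicity of each prime divisor (and 0 on all other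
  sets).\<close>

definition div_of ::
  "('f::field ^ 'n::finite) set set \<Rightarrow> (('f ^ 'n) set \<Rightarrow> 'f) \<Rightarrow> ('f ^ 'n) set set \<Rightarrow> int" where
  "div_of X g Y = (if prime_divisor X Y then order_along X Y g else 0)"

definition linear_form :: "'f::field ^ 'n::finite \<Rightarrow> 'f ^ 'n \<Rightarrow> 'f" where
  "linear_form c v = (\<Sum>i\<in>UNIV. c $ i * v $ i)"

text \<open>The pullback along \<open>h : X \<rightarrow> \<P>\<close> of the hyperplane section \<open>c = 0\<close>. Near
  the generic point of \<open>Y\<close> it has the local equation \<open>c / m\<close>, for any linear form \<open>m\<close> that does
  not vanish identically on \<open>h(Y)\<close>.\<close>

definition hyperplane_pullback ::
  "('f::field ^ 'n::finite) set set \<Rightarrow> (('f ^ 'n) set \<Rightarrow> ('f ^ 'm::finite) set) \<Rightarrow> 'f ^ 'm \<Rightarrow>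
     ('f ^ 'n) set set \<Rightarrow> int" where
  "hyperplane_pullback X h c Y =
     (if prime_divisor X Y
      then THE n. \<forall>m. \<not> vanishes_on (linear_form m) (h ` Y) \<longrightarrow>
             n = order_along X Y (\<lambda>P. quotient_fun (linear_form c) (linear_form m) (h P))
      else 0)"

text \<open>Pullback of divisors along an isomorphism \<open>h\<close> with source \<open>X\<close>: the pullback of the prime
  divisor \<open>Z\<close> is the preimage of \<open>Z\<close>.\<close>

definition iso_pullback ::
  "('f::field ^ 'n::finite) set set \<Rightarrow> (('f ^ 'n) set \<Rightarrow> ('f ^ 'm::finite) set) \<Rightarrow>
     (('f ^ 'm) set set \<Rightarrow> int) \<Rightarrow> ('f ^ 'n) set set \<Rightarrow> int" where
  "iso_pullback X h D Y = (if prime_divisor X Y then D (h ` Y) else 0)"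


section \<open>Fields\<close>

definition is_subfield :: "'f::field set \<Rightarrow> bool" where
  "is_subfield k \<longleftrightarrow> 0 \<in> k \<and> 1 \<in> k \<and>
     (\<forall>x\<in>k. \<forall>y\<in>k. x + y \<in> k \<and> x * y \<in> k) \<and> (\<forall>x\<in>k. - x \<in> k \<and> inverse x \<in> k)"

definition number_field :: "'f::field_char_0 set \<Rightarrow> bool" where
  "number_field k \<longleftrightarrow> is_subfield k \<and>
     (\<exists>B \<subseteq> k. finite B \<and> (\<forall>x\<in>k. \<exists>q. x = (\<Sum>b\<in>B. of_rat (q b) * b)))"

definition algebraic_closure_of :: "'f::alg_closed_field set \<Rightarrow> 'f itself \<Rightarrow> bool" where
  "algebraic_closure_of k T \<longleftrightarrow> is_subfield k \<and>
     (\<forall>x::'f. \<exists>p. p \<noteq> 0 \<and> (\<forall>i. coeff p i \<in> k) \<and> poly p x = 0)"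

definition field_embedding :: "('f::field \<Rightarrow> 'g::field) \<Rightarrow> bool" where
  "field_embedding i \<longleftrightarrow> i 1 = 1 \<and> (\<forall>x y. i (x + y) = i x + i y \<and> i (x * y) = i x * i y)"

definition Gal :: "'f::field set \<Rightarrow> ('f \<Rightarrow> 'f) set" where
  "Gal k = {\<sigma>. field_embedding \<sigma> \<and> bij \<sigma> \<and> (\<forall>x\<in>k. \<sigma> x = x)}"

definition point_map :: "('f::field \<Rightarrow> 'g::field) \<Rightarrow> ('f ^ 'n) set \<Rightarrow> ('g ^ 'n) set" where
  "point_map i P = (\<Union>v\<in>P. pt (\<chi> j. i (v $ j)))"

text \<open>
  \<open>is_completion k i K a\<close>: the field \<open>K\<close> with the absolute value \<open>a\<close> is a completion of \<open>k\<close> at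
  a place, and the embedding \<open>i\<close> sends the algebraic closure \<open>'f\<close> of \<open>k\<close> to an algebraic closure
  of \<open>K\<close>. That algebraic closure is the type \<^typ>\<open>complex\<close>, used merely as an abstract field
  (its topology plays no role): as an algebraically closed field of characteristic 0 with the
  cardinality of the continuum, the algebraic closure of every archimedean or non-archimedean
  completion of a number field is isomorphic to it, so that all places do occur.
\<close>

definition is_completion ::
  "'f::field set \<Rightarrow> ('f \<Rightarrow> complex) \<Rightarrow> complex set \<Rightarrow> (complex \<Rightarrow> real) \<Rightarrow> bool" where
  "is_completion k i K a \<longleftrightarrow>
     field_embedding i \<and> i ` k \<subseteq> K \<and> algebraic_closure_of K TYPE(complex) \<and>
     (\<forall>x\<in>K. 0 \<le> a x \<and> (a x = 0 \<longleftrightarrow> x = 0)) \<and>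
     (\<forall>x\<in>K. \<forall>y\<in>K. a (x * y) = a x * a y \<and> a (x + y) \<le> a x + a y) \<and>
     (\<exists>x\<in>i ` k. x \<noteq> 0 \<and> a x \<noteq> 1) \<and>
     (\<forall>x\<in>K. \<forall>e>0. \<exists>y\<in>i ` k. a (x - y) < e) \<and>
     (\<forall>X. range X \<subseteq> K \<longrightarrow> (\<forall>e>0. \<exists>N::nat. \<forall>m\<ge>N. \<forall>n\<ge>N. a (X m - X n) < e) \<longrightarrow>
        (\<exists>L\<in>K. \<forall>e>0. \<exists>N. \<forall>n\<ge>N. a (X n - L) < e))"


section \<open>The curve and its divisor class group\<close>

text \<open>The smooth projective model of \<open>y\<^sup>2 = f(x)\<close>, with \<open>f\<close> of degree 6, is the closure of the
  image of \<open>(1 : x : x\<^sup>2 : x\<^sup>3 : y)\<close>. It has two points at infinity, at which \<open>y / x\<^sup>3\<close> takes the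
  values \<open>s\<close> with \<open>s\<^sup>2 = f\<^sub>6\<close>.\<close>

type_synonym 'f cdivisor = "('f ^ 5) set \<Rightarrow> int"

definition affine_point :: "'f::field \<Rightarrow> 'f \<Rightarrow> ('f ^ 5) set" where
  "affine_point x y = pt (vector [1, x, x^2, x^3, y])"

definition points_at_infinity :: "'f::field poly \<Rightarrow> ('f ^ 5) set set" where
  "points_at_infinity f = {pt (vector [0, 0, 0, 1, s]) | s. s^2 = coeff f 6}"

definition curve :: "'f::field poly \<Rightarrow> ('f ^ 5) set set" where
  "curve f = {affine_point x y | x y. y^2 = poly f x} \<union> points_at_infinity f"

definition Div0 :: "'f::field poly \<Rightarrow> 'f cdivisor monoid" where
  "Div0 f = \<lparr>carrier = {D. finite {P. D P \<noteq> 0} \<and> {P. D P \<noteq> 0} \<subseteq> curve f \<and> (\<Sum>P | D P \<noteq> 0. D P) = 0},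
     mult = (\<lambda>D E P. D P + E P), one = (\<lambda>P. 0)\<rparr>"

definition Princ :: "'f::field poly \<Rightarrow> 'f cdivisor set" where
  "Princ f = {D \<in> carrier (Div0 f). \<exists>g\<in>rational_functions (curve f).
     \<not> generically_eq (curve f) g (\<lambda>P. 0) \<and> (\<forall>P\<in>curve f. D P = order_along (curve f) {P} g)}"

text \<open>The group of points of the Jacobian over the algebraically closed field \<open>'f\<close>.\<close>

definition Pic0 :: "'f::field poly \<Rightarrow> 'f cdivisor set monoid" where
  "Pic0 f = Div0 f Mod Princ f"

definition divisor_class :: "'f::field poly \<Rightarrow> 'f cdivisor \<Rightarrow> 'f cdivisor set" where
  "divisor_class f D = Princ f #>\<^bsub>Div0 f\<^esub> D"

text \<open>The divisor of the differential \<open>dx / y\<close>.\<close>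

definition canonical_divisor :: "'f::field poly \<Rightarrow> 'f cdivisor" where
  "canonical_divisor f P = of_bool (P \<in> points_at_infinity f)"

definition cdivisor_map :: "('f::field \<Rightarrow> 'g::field) \<Rightarrow> 'f poly \<Rightarrow> 'f cdivisor \<Rightarrow> 'g cdivisor" where
  "cdivisor_map i f D P = (\<Sum>R | R \<in> curve f \<and> D R \<noteq> 0 \<and> point_map i R = P. D R)"

text \<open>The map on divisor classes induced by a field embedding; for \<open>\<sigma> \<in> Gal k\<close> and \<open>f\<close> with
  coefficients in \<open>k\<close> it is the Galois action on \<open>Pic0 f\<close>.\<close>

definition pic_map :: "('f::field \<Rightarrow> 'g::field) \<Rightarrow> 'f poly \<Rightarrow> 'f cdivisor set \<Rightarrow> 'g cdivisor set" where
  "pic_map i f A = (\<Union>D\<in>A. divisor_class (map_poly i f) (cdivisor_map i f D))"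


section \<open>Galois cohomology and the 2-Selmer group\<close>

text \<open>Continuous cochain cohomology: a map from the profinite group \<open>\<Gamma>\<close> to a discrete module is
  continuous iff its values only depend on the restriction to some finite set of elements.\<close>

definition Z1 :: "('f \<Rightarrow> 'f) set \<Rightarrow> 'a monoid \<Rightarrow> (('f \<Rightarrow> 'f) \<Rightarrow> 'a \<Rightarrow> 'a) \<Rightarrow> (('f \<Rightarrow> 'f) \<Rightarrow> 'a) monoid" where
  "Z1 \<Gamma> A act = \<lparr>carrier = {\<xi> \<in> \<Gamma> \<rightarrow>\<^sub>E carrier A.
       (\<forall>\<sigma>\<in>\<Gamma>. \<forall>\<tau>\<in>\<Gamma>. \<xi> (\<sigma> \<circ> \<tau>) = \<xi> \<sigma> \<otimes>\<^bsub>A\<^esub> act \<sigma> (\<xi> \<tau>)) \<and>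
       (\<exists>S. finite S \<and> (\<forall>\<sigma>\<in>\<Gamma>. \<forall>\<tau>\<in>\<Gamma>. (\<forall>x\<in>S. \<sigma> x = \<tau> x) \<longrightarrow> \<xi> \<sigma> = \<xi> \<tau>))},
     mult = (\<lambda>\<xi> \<zeta>. \<lambda>\<sigma>\<in>\<Gamma>. \<xi> \<sigma> \<otimes>\<^bsub>A\<^esub> \<zeta> \<sigma>), one = (\<lambda>\<sigma>\<in>\<Gamma>. \<one>\<^bsub>A\<^esub>)\<rparr>"

definition B1 :: "('f \<Rightarrow> 'f) set \<Rightarrow> 'a monoid \<Rightarrow> (('f \<Rightarrow> 'f) \<Rightarrow> 'a \<Rightarrow> 'a) \<Rightarrow> (('f \<Rightarrow> 'f) \<Rightarrow> 'a) set" where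
  "B1 \<Gamma> A act = {\<lambda>\<sigma>\<in>\<Gamma>. act \<sigma> T \<otimes>\<^bsub>A\<^esub> inv\<^bsub>A\<^esub> T | T. T \<in> carrier A}"

definition H1 :: "('f \<Rightarrow> 'f) set \<Rightarrow> 'a monoid \<Rightarrow> (('f \<Rightarrow> 'f) \<Rightarrow> 'a \<Rightarrow> 'a) \<Rightarrow> (('f \<Rightarrow> 'f) \<Rightarrow> 'a) set monoid" where
  "H1 \<Gamma> A act = Z1 \<Gamma> A act Mod B1 \<Gamma> A act"

definition two_torsion :: "'a monoid \<Rightarrow> 'a monoid" where
  "two_torsion A = A\<lparr>carrier := {x \<in> carrier A. x \<otimes>\<^bsub>A\<^esub> x = \<one>\<^bsub>A\<^esub>}\<rparr>"

definition H1_J2 :: "'f::field set \<Rightarrow> 'f poly \<Rightarrow> (('f \<Rightarrow> 'f) \<Rightarrow> 'f cdivisor set) set monoid" where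
  "H1_J2 k f = H1 (Gal k) (two_torsion (Pic0 f)) (\<lambda>\<sigma>. pic_map \<sigma> f)"

definition H1_J :: "'f::field set \<Rightarrow> 'f poly \<Rightarrow> (('f \<Rightarrow> 'f) \<Rightarrow> 'f cdivisor set) set monoid" where
  "H1_J k f = H1 (Gal k) (Pic0 f) (\<lambda>\<sigma>. pic_map \<sigma> f)"

text \<open>The local map \<open>H\<^sup>1(k, J[2]) \<rightarrow> H\<^sup>1(K, J)\<close>, where \<open>inv_into UNIV i \<circ> \<tau> \<circ> i\<close> is the restriction of
  \<open>\<tau> \<in> Gal K\<close> to the algebraic closure of \<open>k\<close>.\<close>

definition localize ::
  "('f::field \<Rightarrow> complex) \<Rightarrow> complex set \<Rightarrow> 'f poly \<Rightarrow> (('f \<Rightarrow> 'f) \<Rightarrow> 'f cdivisor set) set \<Rightarrow>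
     ((complex \<Rightarrow> complex) \<Rightarrow> complex cdivisor set) set" where
  "localize i K f E =
     (let F = map_poly i f; act = (\<lambda>\<tau>. pic_map \<tau> F)
      in \<Union>\<xi>\<in>E. B1 (Gal K) (Pic0 F) act #>\<^bsub>Z1 (Gal K) (Pic0 F) act\<^esub>
                 (\<lambda>\<tau>\<in>Gal K. pic_map i f (\<xi> (inv_into UNIV i \<circ> \<tau> \<circ> i))))"

definition Selmer2 :: "'f::field set \<Rightarrow> 'f poly \<Rightarrow> (('f \<Rightarrow> 'f) \<Rightarrow> 'f cdivisor set) set set" where
  "Selmer2 k f = {E \<in> carrier (H1_J2 k f).
     \<forall>i K a. is_completion k i K a \<longrightarrow> localize i K f E = \<one>\<^bsub>H1_J K (map_poly i f)\<^esub>}"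


section \<open>Jacobian and Kummer surface\<close>

text \<open>Group varieties in characteristic 0 are nonsingular, so regularity in codimension 1 is implied by
  the other clauses. It is listed as part of the usual notion of a nonsingular projective group
  variety.\<close>

definition abelian_variety :: "'f::field set \<Rightarrow> ('f ^ 'n::finite) set monoid \<Rightarrow> bool" where
  "abelian_variety k G \<longleftrightarrow> comm_group G \<and> proj_variety k (carrier G) \<and>
     regular_in_codim_one (carrier G) \<and>
     morphism2 k (carrier G) (carrier G) (carrier G) (\<lambda>P Q. P \<otimes>\<^bsub>G\<^esub> Q) \<and>
     morphism k (carrier G) (carrier G) (\<lambda>P. inv\<^bsub>G\<^esub> P)"

text \<open>A projective model \<open>J\<close> over \<open>k\<close> of the Jacobian, with the Galois equivariant identification
  \<open>cl\<close> of \<open>Pic0\<close> with the points of \<open>J\<close>; the last clause (regularity of the Abel-Jacobi maps)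
  determines the structure of variety.\<close>

definition is_jacobian ::
  "'f::field set \<Rightarrow> 'f poly \<Rightarrow> ('f ^ 'n::finite) set monoid \<Rightarrow> ('f cdivisor set \<Rightarrow> ('f ^ 'n) set) \<Rightarrow> bool" where
  "is_jacobian k f J cl \<longleftrightarrow> abelian_variety k J \<and> cl \<in> iso (Pic0 f) J \<and>
     (\<forall>\<sigma>\<in>Gal k. \<forall>A\<in>carrier (Pic0 f). cl (pic_map \<sigma> f A) = point_map \<sigma> (cl A)) \<and>
     (\<forall>R\<in>curve f. morphism UNIV (curve f) (carrier J)
        (\<lambda>P. cl (divisor_class f (\<lambda>T. of_bool (T = P) - of_bool (T = R)))))"

definition P2 :: "'f::field ^ 4 \<Rightarrow> 'f" where
  "P2 x = (x$2)^2 - 4 * x$1 * x$3"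

definition P3 :: "'f::field poly \<Rightarrow> 'f ^ 4 \<Rightarrow> 'f" where
  "P3 f x = 2 * (2 * coeff f 0 * (x$1)^3 + coeff f 1 * (x$1)^2 * x$2 + 2 * coeff f 2 * (x$1)^2 * x$3
      + coeff f 3 * x$1 * x$2 * x$3 + 2 * coeff f 4 * x$1 * (x$3)^2 + coeff f 5 * x$2 * (x$3)^2
      + 2 * coeff f 6 * (x$3)^3)"

text \<open>The resultant of the library refers to actual degrees, so it is the resultant of a quadratic
  polynomial only if \<open>x\<^sub>1 \<noteq> 0\<close>. This suffices to determine the form \<open>P4\<close>.\<close>

definition P4 :: "'f::field poly \<Rightarrow> 'f ^ 4 \<Rightarrow> 'f" where
  "P4 f = (THE F. F \<in> forms UNIV 4 \<and>
     (\<forall>x. x$1 \<noteq> 0 \<longrightarrow> (P3 f x)^2 - 4 * P2 x * F x = 16 * resultant [: x$3, - (x$2), x$1 :] f))"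

definition kummer_surface :: "'f::field poly \<Rightarrow> ('f ^ 4) set set" where
  "kummer_surface f = {P \<in> proj_space. vanishes_on (\<lambda>x. P2 x * (x$4)^2 - P3 f x * x$4 + P4 f x) {P}}"

text \<open>The quotient map from \<open>J\<close> onto the Kummer surface. As a morphism it is determined by the
  formula in the last clause.\<close>

definition kummer_map ::
  "'f::field set \<Rightarrow> 'f poly \<Rightarrow> ('f ^ 'n::finite) set monoid \<Rightarrow> ('f cdivisor set \<Rightarrow> ('f ^ 'n) set) \<Rightarrow>
     (('f ^ 'n) set \<Rightarrow> ('f ^ 4) set) \<Rightarrow> bool" where
  "kummer_map k f J cl \<rho> \<longleftrightarrow>
     morphism k (carrier J) (kummer_surface f) \<rho> \<and> \<rho> ` carrier J = kummer_surface f \<and>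
     (\<forall>P\<in>carrier J. \<forall>Q\<in>carrier J. \<rho> P = \<rho> Q \<longleftrightarrow> Q = P \<or> Q = inv\<^bsub>J\<^esub> P) \<and>
     (\<forall>x y x' y'. y^2 = poly f x \<longrightarrow> y'^2 = poly f x' \<longrightarrow> x \<noteq> x' \<longrightarrow>
        \<rho> (cl (divisor_class f (\<lambda>T. of_bool (T = affine_point x y) + of_bool (T = affine_point x' y')
                                      - canonical_divisor f T)))
        = pt (vector [1, x + x', x * x',
                (P3 f (vector [1, x + x', x * x', 0]) / 2 - 2 * y * y') / (x - x')^2]))"


section \<open>2-coverings and twists\<close>

definition two_covering ::
  "'f::field set \<Rightarrow> ('f ^ 'n::finite) set monoid \<Rightarrow> ('f cdivisor set \<Rightarrow> ('f ^ 'n) set) \<Rightarrow>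
     (('f \<Rightarrow> 'f) \<Rightarrow> 'f cdivisor set) set \<Rightarrow> ('f ^ 'm::finite) set set \<Rightarrow>
     (('f ^ 'm) set \<Rightarrow> ('f ^ 'n) set) \<Rightarrow> (('f ^ 'm) set \<Rightarrow> ('f ^ 'n) set) \<Rightarrow> bool" where
  "two_covering k J cl E X \<pi> \<phi> \<longleftrightarrow>
     proj_variety k X \<and> morphism k X (carrier J) \<pi> \<and> isomorphism UNIV X (carrier J) \<phi> \<and>
     (\<forall>P\<in>X. \<pi> P = \<phi> P \<otimes>\<^bsub>J\<^esub> \<phi> P) \<and>
     (\<exists>\<xi>\<in>E. \<forall>\<sigma>\<in>Gal k. \<forall>P\<in>X. point_map \<sigma> (\<phi> (point_map (inv_into UNIV \<sigma>) P)) = \<phi> P \<otimes>\<^bsub>J\<^esub> cl (\<xi> \<sigma>))"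

definition twisted_neg ::
  "('f::field ^ 'n::finite) set monoid \<Rightarrow> ('f ^ 'm::finite) set set \<Rightarrow>
     (('f ^ 'm) set \<Rightarrow> ('f ^ 'n) set) \<Rightarrow> ('f ^ 'm) set \<Rightarrow> ('f ^ 'm) set" where
  "twisted_neg J X \<phi> P = inv_into X \<phi> (inv\<^bsub>J\<^esub> (\<phi> P))"

text \<open>\<open>h\<close> is the composite of the quotient map \<open>X \<rightarrow> X / \<iota>\<close> with an embedding of the twisted Kummer
  surface over \<open>k\<close>, and \<open>\<psi>\<close> maps the twisted Kummer surface \<open>h ` X\<close> to the Kummer surface
  compatibly with \<open>\<phi>\<close>.\<close>

definition twisted_kummer_map ::
  "'f::field set \<Rightarrow> (('f ^ 'n::finite) set \<Rightarrow> ('f ^ 4) set) \<Rightarrow> ('f ^ 'm::finite) set set \<Rightarrow>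
     (('f ^ 'm) set \<Rightarrow> ('f ^ 'n) set) \<Rightarrow> (('f ^ 'm) set \<Rightarrow> ('f ^ 4) set) \<Rightarrow> 'f ^ 4 ^ 4 \<Rightarrow> bool" where
  "twisted_kummer_map k \<rho> X \<phi> h \<psi> \<longleftrightarrow>
     morphism k X proj_space h \<and> invertible \<psi> \<and> (\<forall>P\<in>X. \<forall>v\<in>h P. \<psi> *v v \<in> \<rho> (\<phi> P))"

definition twisted_group_law ::
  "'f::field set \<Rightarrow> ('f ^ 'n::finite) set monoid \<Rightarrow>
     ('f ^ 'm::finite) set set \<Rightarrow> (('f ^ 'm) set \<Rightarrow> ('f ^ 'n) set) \<Rightarrow>
     ('f ^ 'l::finite) set set \<Rightarrow> (('f ^ 'l) set \<Rightarrow> ('f ^ 'n) set) \<Rightarrow>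
     ('f ^ 'p::finite) set set \<Rightarrow> (('f ^ 'p) set \<Rightarrow> ('f ^ 'n) set) \<Rightarrow>
     (('f ^ 'm) set \<Rightarrow> ('f ^ 'l) set \<Rightarrow> ('f ^ 'p) set) \<Rightarrow> bool" where
  "twisted_group_law k J X \<phi>\<^sub>X Y \<phi>\<^sub>Y Z \<phi>\<^sub>Z \<mu> \<longleftrightarrow> morphism2 k X Y Z \<mu> \<and>
     (\<forall>P\<in>X. \<forall>Q\<in>Y. \<phi>\<^sub>Z (\<mu> P Q) = \<phi>\<^sub>X P \<otimes>\<^bsub>J\<^esub> \<phi>\<^sub>Y Q)"


section \<open>The (2,2,2)-forms\<close>

text \<open>The subring \<open>\<int>[f\<^sub>0, \<dots>, f\<^sub>6]\<close> generated by the coefficients.\<close>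

definition coeff_ring :: "'f::field poly \<Rightarrow> 'f set" where
  "coeff_ring f = \<Inter>{R. 1 \<in> R \<and> range (coeff f) \<subseteq> R \<and> (\<forall>x\<in>R. \<forall>y\<in>R. x - y \<in> R \<and> x * y \<in> R)}"

text \<open>For a given \<open>f\<close> these conditions determine the forms up to a common nonzero factor.\<close>

definition flynn_forms ::
  "'f::field poly \<Rightarrow> ('f ^ 'n::finite) set monoid \<Rightarrow> (('f ^ 'n) set \<Rightarrow> ('f ^ 4) set) \<Rightarrow>
     (4 \<Rightarrow> 4 \<Rightarrow> 'f ^ 4 \<Rightarrow> 'f ^ 4 \<Rightarrow> 'f) \<Rightarrow> bool" where
  "flynn_forms f J \<rho> \<Phi> \<longleftrightarrow>
     (\<forall>i j. \<Phi> i j \<in> biforms (coeff_ring f) 2 2 \<and> \<Phi> i j = \<Phi> j i) \<and>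
     (\<forall>P\<in>carrier J. \<forall>Q\<in>carrier J. \<forall>x\<in>\<rho> P. \<forall>y\<in>\<rho> Q.
        \<forall>s\<in>\<rho> (P \<otimes>\<^bsub>J\<^esub> Q). \<forall>d\<in>\<rho> (P \<otimes>\<^bsub>J\<^esub> inv\<^bsub>J\<^esub> Q).
        \<exists>c. c \<noteq> 0 \<and> (\<forall>i j. \<Phi> i j x y = c * (s$i * d$j + d$i * s$j)))"

definition form222 ::
  "(4 \<Rightarrow> 4 \<Rightarrow> 'f::field ^ 4 \<Rightarrow> 'f ^ 4 \<Rightarrow> 'f) \<Rightarrow> 'f ^ 4 \<Rightarrow> 'f ^ 4 \<Rightarrow> 'f ^ 4 \<Rightarrow> 'f" where
  "form222 \<Phi> x y z = (\<Sum>i\<in>UNIV. \<Sum>j\<in>UNIV. \<Phi> i j x y * z$i * z$j)"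

definition twisted_form222 ::
  "'f::field set \<Rightarrow> (4 \<Rightarrow> 4 \<Rightarrow> 'f ^ 4 \<Rightarrow> 'f ^ 4 \<Rightarrow> 'f) \<Rightarrow> 'f ^ 4 ^ 4 \<Rightarrow> 'f ^ 4 ^ 4 \<Rightarrow> 'f ^ 4 ^ 4 \<Rightarrow>
     ('f ^ 4 \<Rightarrow> 'f ^ 4 \<Rightarrow> 'f ^ 4 \<Rightarrow> 'f) \<Rightarrow> bool" where
  "twisted_form222 k \<Phi> \<psi>\<^sub>1 \<psi>\<^sub>2 \<psi>\<^sub>3 \<Psi> \<longleftrightarrow> \<Psi> \<in> triforms k 2 2 2 \<and>
     (\<exists>c. c \<noteq> 0 \<and> (\<forall>x y z. \<Psi> x y z =
        c * form222 \<Phi> (\<psi>\<^sub>1 *v x) (\<psi>\<^sub>2 *v y) (transpose (matrix_inv \<psi>\<^sub>3) *v z)))"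

end

theory Submission
  imports Defs
begin

text \<open>
  At \<open>P\<close>, the form \<open>\<Phi>\<^sub>\<epsilon>\<^sub>\<eta>(x(P); x(Q); c)\<close> is a nonzero multiple, independent of \<open>c\<close>, of the product of
  the values of \<open>c\<close> at the images of \<open>\<mu>(P, Q)\<close> and \<open>\<mu>(\<iota>P, Q)\<close>. Near the generic point of a prime divisor \<open>Y\<close>
  choose linear forms \<open>m\<close> (nonzero at both images) and \<open>l\<close> (nonzero at the image of \<open>P\<close>). Then
  \<open>g = (\<Phi>(c) / \<Phi>(m)) (\<Phi>(m) / l\<^sup>2) (l / x\<^sub>1)\<^sup>2\<close>: the first factor is the product of the local equations of the
  two pullbacks of \<open>H\<^sub>\<epsilon>\<^sub>\<eta>\<close>, the second is a unit along \<open>Y\<close>, and \<open>x\<^sub>1 / l\<close> is a local equation of \<open>H\<^sub>\<epsilon>\<close>. All these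
  functions are nonzero because the Kummer surface does not lie in a plane.
\<close>

text \<open>Functions are given by their values at points, and Flynn's relation fixes those values
  only up to a scalar that varies with the point. This scalar is not given as a rational function,
  so it may enter only where it cancels, in a ratio of two values at the same point. That it is
  nonzero is used too: it keeps the form for \<open>m\<close> nonzero wherever \<open>m\<close> is
  nonzero at both images. The involution appears because Flynn's relation speaks of P + Q and P - Q,
  while \<mu>(\<iota>P, Q) lies over -P + Q, which has the same image as P - Q on the Kummer
  surface. A covering is given as a bare projective variety. Its isomorphism with the Jacobian over
  the algebraically closed field makes its local rings at prime divisors discrete valuation rings,
  and turns \<mu>(-, Q) into an ordinary translation, hence an isomorphism. This is why prime
  divisors, local rings and orders have to be transported along isomorphisms. Equality of rational
  functions is agreement on a nonempty open set. Read as \<open>eventually\<close> for a filter,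
  identities that hold off different hypersurfaces combine without tracking those
  hypersurfaces.\<close>

no_notation fps_nth (infixl "$" 75)

section \<open>Forms\<close>

lemma finite_exponents: "finite (exponents d :: ('n::finite \<Rightarrow> nat) set)"
proof (rule finite_subset)
  show "exponents d \<subseteq> (UNIV :: 'n set) \<rightarrow>\<^sub>E {..d}"
    by (auto simp: exponents_def intro: member_le_sum)
qed (simp add: finite_PiE)

lemma monomial_add: "monomial (\<lambda>i. a i + b i) v = monomial a v * monomial b v"
  by (simp add: monomial_def power_add prod.distrib)

lemma forms_mono: "S \<subseteq> T \<Longrightarrow> forms S d \<subseteq> forms T d"
  unfolding forms_def by blast

lemma formsE:
  assumes "F \<in> forms S d"
  obtains c where "F = (\<lambda>v. \<Sum>a\<in>exponents d. c a * monomial a v)"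
  using assms unfolding forms_def by blast

lemma formsI: "(\<lambda>v. \<Sum>a\<in>exponents d. c a * monomial a v) \<in> forms UNIV d"
  unfolding forms_def by blast

lemma forms_zero: "(\<lambda>v. 0) \<in> forms UNIV d"
  using formsI[where d = d and c = "\<lambda>a. 0"] by simp

lemma forms_add:
  assumes "F \<in> forms UNIV d" "G \<in> forms UNIV d"
  shows "(\<lambda>v. F v + G v) \<in> forms UNIV d"
proof -
  obtain c c' where "F = (\<lambda>v. \<Sum>a\<in>exponents d. c a * monomial a v)"
    "G = (\<lambda>v. \<Sum>a\<in>exponents d. c' a * monomial a v)"
    using assms by (elim formsE)
  then show ?thesis
    using formsI[where d = d and c = "\<lambda>a. c a + c' a"] by (simp add: sum.distrib algebra_simps)
qed

lemma forms_cmult: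
  assumes "F \<in> forms UNIV d"
  shows "(\<lambda>v. r * F v) \<in> forms UNIV d"
proof -
  obtain c where "F = (\<lambda>v. \<Sum>a\<in>exponents d. c a * monomial a v)"
    using assms by (elim formsE)
  then show ?thesis
    using formsI[where d = d and c = "\<lambda>a. r * c a"] by (simp add: sum_distrib_left algebra_simps)
qed

lemma forms_sum:
  assumes "\<And>i. i \<in> I \<Longrightarrow> F i \<in> forms UNIV d"
  shows "(\<lambda>v. \<Sum>i\<in>I. F i v) \<in> forms UNIV d"
  using assms by (induction I rule: infinite_finite_induct) (simp_all add: forms_zero forms_add)

lemma monomial_in_forms:
  fixes a :: "'n::finite \<Rightarrow> nat"
  assumes "sum a UNIV = d"
  shows "(monomial a :: 'f::field ^ 'n \<Rightarrow> 'f) \<in> forms UNIV d"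
proof -
  have "(\<Sum>b\<in>exponents d. of_bool (b = a) * monomial b v) = monomial a v" for v :: "'f ^ 'n"
    using assms by (subst sum.mono_neutral_right[where S = "{a}"])
      (use finite_exponents[of d] in \<open>auto simp: exponents_def\<close>)
  then show ?thesis
    using formsI[where d = d and c = "\<lambda>b. of_bool (b = a) :: 'f"] by (simp cong: sum.cong)
qed

lemma forms_mult:
  fixes F G :: "'f::field ^ 'n::finite \<Rightarrow> 'f"
  assumes "F \<in> forms UNIV d" "G \<in> forms UNIV e"
  shows "(\<lambda>v. F v * G v) \<in> forms UNIV (d + e)"
proof -
  obtain c c' where *: "F = (\<lambda>v. \<Sum>a\<in>exponents d. c a * monomial a v)"
    "G = (\<lambda>v. \<Sum>a\<in>exponents e. c' a * monomial a v)"
    using assms by (elim formsE)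
  have eq: "F v * G v = (\<Sum>a\<in>exponents d. \<Sum>b\<in>exponents e. c a * c' b * monomial (\<lambda>i. a i + b i) v)"
    for v
    unfolding * sum_product monomial_add by (intro sum.cong refl) (simp add: mult_ac)
  show ?thesis
    unfolding eq
    by (intro forms_sum forms_cmult monomial_in_forms) (auto simp: exponents_def sum.distrib)
qed

lemma forms_const: "(\<lambda>v :: 'f::field ^ 'n::finite. r) \<in> forms UNIV 0"
proof -
  have "monomial (\<lambda>i. 0) = (\<lambda>v :: 'f ^ 'n. 1)"
    by (auto simp: monomial_def)
  then show ?thesis
    using forms_cmult[OF monomial_in_forms[of "\<lambda>i :: 'n. 0" 0, where 'f = 'f], of r] by simp
qed

lemma forms_coord: "(\<lambda>v :: 'f::field ^ 'n::finite. v $ i) \<in> forms UNIV 1"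
proof -
  have "monomial (\<lambda>j. of_bool (j = i)) = (\<lambda>v :: 'f ^ 'n. v $ i)"
    by (auto simp: monomial_def if_distrib[of "power _"] of_bool_def cong: if_cong)
  then show ?thesis
    using monomial_in_forms[of "\<lambda>j :: 'n. of_bool (j = i)" 1, where 'f = 'f] by simp
qed

lemma forms_power:
  assumes "F \<in> forms UNIV d"
  shows "(\<lambda>v. F v ^ n) \<in> forms UNIV (n * d)"
proof (induction n)
  case 0
  show ?case using forms_const[of 1] by simp
next
  case (Suc n)
  then show ?case using forms_mult[OF assms Suc] by simp
qed

lemma forms_prod:
  assumes "\<And>i. i \<in> I \<Longrightarrow> F i \<in> forms UNIV (d i)"
  shows "(\<lambda>v. \<Prod>i\<in>I. F i v) \<in> forms UNIV (\<Sum>i\<in>I. d i)"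
  using assms
  by (induction I rule: infinite_finite_induct) (simp_all add: forms_const forms_mult)

text \<open>Each monomial turns into a product of powers of forms of degree \<open>e\<close>, with
  exponents adding up to \<open>d\<close>.\<close>

lemma forms_compose:
  fixes F :: "'f::field ^ 'n::finite \<Rightarrow> 'f" and G :: "'f ^ 'm::finite \<Rightarrow> 'f ^ 'n"
  assumes F: "F \<in> forms UNIV d" and G: "\<And>j. (\<lambda>v. G v $ j) \<in> forms UNIV e"
  shows "(\<lambda>v. F (G v)) \<in> forms UNIV (d * e)"
proof -
  obtain c where *: "F = (\<lambda>v. \<Sum>a\<in>exponents d. c a * monomial a v)"
    using F by (elim formsE)
  have "(\<lambda>v. monomial a (G v)) \<in> forms UNIV (d * e)" if "a \<in> exponents d" for a
    using forms_prod[of UNIV "\<lambda>j v. (G v $ j) ^ a j" "\<lambda>j. a j * e"] forms_power[OF G] that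
    by (simp add: monomial_def exponents_def flip: sum_distrib_right)
  then show ?thesis
    unfolding * by (intro forms_sum forms_cmult)
qed

lemma linear_form_in_forms: "linear_form c \<in> forms UNIV 1"
  unfolding linear_form_def[abs_def] by (intro forms_sum forms_cmult forms_coord)

lemma forms_homogeneous:
  fixes F :: "'f::field ^ 'n::finite \<Rightarrow> 'f"
  assumes "F \<in> forms S d"
  shows "F (r *s v) = r ^ d * F v"
proof -
  obtain c where *: "F = (\<lambda>v. \<Sum>a\<in>exponents d. c a * monomial a v)"
    using assms by (elim formsE)
  have "monomial a (r *s v) = r ^ d * monomial a v" if "a \<in> exponents d" for a
    using that by (auto simp: monomial_def exponents_def power_mult_distrib prod.distrib power_sum)
  then show ?thesis
    by (simp add: * sum_distrib_left mult_ac)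
qed

text \<open>Freezing \<open>w\<close> absorbs its monomials into the coefficients. The coordinates
  of \<open>w\<close> need not lie in \<open>S\<close>, hence the passage to
  \<open>UNIV\<close>.\<close>

lemma biforms_fix_right:
  fixes F :: "'f::field ^ 'n::finite \<Rightarrow> 'f ^ 'm::finite \<Rightarrow> 'f"
  assumes "F \<in> biforms S d e"
  shows "(\<lambda>v. F v w) \<in> forms UNIV d"
proof -
  obtain c where "F = (\<lambda>v w. \<Sum>a\<in>exponents d. \<Sum>b\<in>exponents e. c a b * monomial a v * monomial b w)"
    using assms unfolding biforms_def by blast
  then have "F v w = (\<Sum>a\<in>exponents d. (\<Sum>b\<in>exponents e. c a b * monomial b w) * monomial a v)" for v
    by (simp only: sum_distrib_right) (auto intro!: sum.cong simp: mult_ac)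
  then show ?thesis
    by (simp add: formsI)
qed

lemma triforms_fix_right:
  fixes F :: "'f::field ^ 'n::finite \<Rightarrow> 'f ^ 'm::finite \<Rightarrow> 'f ^ 'l::finite \<Rightarrow> 'f"
  assumes "F \<in> triforms S d e r"
  shows "(\<lambda>v. F v w z) \<in> forms UNIV d"
proof -
  obtain c where "F = (\<lambda>v w z. \<Sum>a\<in>exponents d. \<Sum>b\<in>exponents e. \<Sum>g\<in>exponents r.
      c a b g * monomial a v * monomial b w * monomial g z)"
    using assms unfolding triforms_def by blast
  then have "F v w z = (\<Sum>a\<in>exponents d. (\<Sum>b\<in>exponents e. \<Sum>g\<in>exponents r.
      c a b g * monomial b w * monomial g z) * monomial a v)" for v
    by (simp only: sum_distrib_right) (auto intro!: sum.cong simp: mult_ac)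
  then show ?thesis
    by (simp add: formsI)
qed

section \<open>Points and the generic filter\<close>

lemma pt_self: "v \<in> pt v"
  unfolding pt_def by (auto intro!: exI[of _ 1])

lemma pt_subset: "w \<in> pt v \<Longrightarrow> pt w \<subseteq> pt v"
  unfolding pt_def by (fastforce simp: vector_smult_assoc)

lemma pt_cong:
  assumes "w \<in> pt v"
  shows "pt w = pt v"
proof -
  obtain r where r: "r \<noteq> 0" "w = r *s v"
    using assms by (auto simp: pt_def)
  then have "v = (1 / r) *s w"
    by (simp add: vector_smult_assoc)
  with r(1) have "v \<in> pt w"
    unfolding pt_def by (intro CollectI exI[of _ "1 / r"]) simp
  then show ?thesis
    using assms pt_subset by blast
qed

lemma proj_spaceE:
  assumes "P \<in> proj_space" "v \<in> P"
  shows "P = pt v" "v \<noteq> 0"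
proof -
  obtain w where w: "P = pt w" "w \<noteq> 0"
    using assms by (auto simp: proj_space_def)
  then show "P = pt v" using pt_cong[of v w] assms(2) by simp
  obtain c where "c \<noteq> 0" "v = c *s w"
    using w(1) assms(2) unfolding pt_def by blast
  with w(2) show "v \<noteq> 0" by simp
qed

lemma proj_space_nonempty: "P \<in> proj_space \<Longrightarrow> \<exists>v. v \<in> P"
  using pt_self by (auto simp: proj_space_def)

lemma form_zero_iff:
  assumes "F \<in> forms S d" "P \<in> proj_space" "v \<in> P" "w \<in> P"
  shows "F v = 0 \<longleftrightarrow> F w = 0"
proof -
  have "w \<in> pt v" using proj_spaceE(1)[OF assms(2,3)] assms(4) by simp
  then obtain r where "r \<noteq> 0" "w = r *s v" by (auto simp: pt_def)
  then show ?thesis using forms_homogeneous[OF assms(1)] by simp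
qed

lemma vanishes_at_iff:
  assumes "F \<in> forms S d" "P \<in> proj_space" "v \<in> P"
  shows "vanishes_on F {P} \<longleftrightarrow> F v = 0"
proof -
  have "F w = 0 \<longleftrightarrow> F v = 0" if "w \<in> P" for w
    by (rule form_zero_iff[OF assms(1,2) that assms(3)])
  then show ?thesis using assms(3) unfolding vanishes_on_def by blast
qed

text \<open>Numerator and denominator scale by the same power of \<open>r\<close>, so the
  representative picked by \<open>SOME\<close> does not matter. Where the denominator is 0, both
  sides are 0 by convention.\<close>

lemma quotient_fun_eq:
  assumes "A \<in> forms UNIV d" "B \<in> forms UNIV d" "P \<in> proj_space" "v \<in> P"
  shows "quotient_fun A B P = A v / B v"
proof -
  define w where "w = (SOME v. v \<in> P)"
  have "w \<in> P" unfolding w_def using assms(4) by (rule someI)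
  then have "w \<in> pt v" using proj_spaceE(1)[OF assms(3,4)] by simp
  then obtain r where "r \<noteq> 0" "w = r *s v" unfolding pt_def by blast
  then show ?thesis
    by (simp add: quotient_fun_def forms_homogeneous[OF assms(1)] forms_homogeneous[OF assms(2)]
        flip: w_def)
qed

lemma zariski_closed_subset: "zariski_closed S X \<Longrightarrow> X \<subseteq> proj_space"
  by (auto simp: zariski_closed_def)

text \<open>One of the defining forms must fail at \<open>P\<close>. Closed sets are used through
  such separating forms, and \<open>zariski_closedI\<close> goes the other way.\<close>

lemma zariski_closedE:
  assumes "zariski_closed S X" "P \<in> proj_space" "P \<notin> X"
  obtains d F where "F \<in> forms UNIV d" "vanishes_on F X" "\<not> vanishes_on F {P}"
proof -
  obtain A where A: "A \<subseteq> (\<Union>d. forms S d)" "X = {P \<in> proj_space. \<forall>F\<in>A. vanishes_on F {P}}"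
    using assms by (auto simp: zariski_closed_def)
  then obtain F where F: "F \<in> A" "\<not> vanishes_on F {P}" using assms by blast
  then obtain d where "F \<in> forms S d" using A by blast
  then have "F \<in> forms UNIV d" using forms_mono[of S UNIV d] by blast
  moreover have "vanishes_on F X"
    unfolding vanishes_on_def
  proof (intro ballI)
    fix Q v assume "Q \<in> X" "v \<in> Q"
    then have "vanishes_on F {Q}" using A(2) F(1) by simp
    with \<open>v \<in> Q\<close> show "F v = 0" by (simp add: vanishes_on_def)
  qed
  ultimately show ?thesis using that F by blast
qed

lemma zariski_closed_UNIV:
  assumes "zariski_closed S X"
  shows "zariski_closed UNIV X"
proof -
  obtain A where A: "A \<subseteq> (\<Union>d. forms S d)" "X = {P \<in> proj_space. \<forall>F\<in>A. vanishes_on F {P}}"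
    using assms by (auto simp: zariski_closed_def)
  have "(\<Union>d. forms S d) \<subseteq> (\<Union>d. forms UNIV d)"
    by (intro UN_mono forms_mono subset_UNIV order_refl)
  with A(1) have "A \<subseteq> (\<Union>d. forms UNIV d)" by (rule order_trans)
  with A(2) show ?thesis
    unfolding zariski_closed_def by blast
qed

lemma zariski_closed_hypersurface:
  assumes "F \<in> forms UNIV d"
  shows "zariski_closed UNIV {P \<in> proj_space. vanishes_on F {P}}"
proof -
  have "{F} \<subseteq> (\<Union>d. forms UNIV d)" using assms by blast
  moreover have "{P \<in> proj_space. vanishes_on F {P}} =
      {P \<in> proj_space. \<forall>F\<in>{F}. vanishes_on F {P}}" by simp
  ultimately show ?thesis
    unfolding zariski_closed_def by blast
qed

lemma vanishes_on_subset_iff: "vanishes_on F X \<longleftrightarrow> (\<forall>P\<in>X. vanishes_on F {P})"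
  by (simp add: vanishes_on_def)

lemma irreducible_setD:
  assumes "irreducible_set X" "zariski_closed UNIV A" "zariski_closed UNIV B" "X \<subseteq> A \<union> B"
  shows "X \<subseteq> A \<or> X \<subseteq> B"
  using assms unfolding irreducible_set_def by iprover

text \<open>Otherwise the hypersurfaces of \<open>A\<close> and \<open>B\<close> would cover
  \<open>X\<close>, and one of them would contain it. This is the primality of the ideal of
  \<open>X\<close>.\<close>

lemma not_vanishes_on_mult:
  assumes X: "irreducible_set X" "X \<subseteq> proj_space"
    and "A \<in> forms UNIV d" "B \<in> forms UNIV e"
    and "\<not> vanishes_on A X" "\<not> vanishes_on B X"
  shows "\<not> vanishes_on (\<lambda>v. A v * B v) X"
proof
  assume *: "vanishes_on (\<lambda>v. A v * B v) X"
  let ?V = "\<lambda>F. {P \<in> proj_space. vanishes_on F {P}}"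
  have sub: "X \<subseteq> ?V A \<union> ?V B"
  proof
    fix P assume P: "P \<in> X"
    then obtain v where v: "v \<in> P" using X proj_space_nonempty by blast
    then have "A v * B v = 0" using * P by (auto simp: vanishes_on_def)
    moreover have "P \<in> proj_space" using P X(2) by (rule subsetD[rotated])
    ultimately show "P \<in> ?V A \<union> ?V B"
      using vanishes_at_iff[OF assms(3) _ v] vanishes_at_iff[OF assms(4) _ v] by simp
  qed
  have "X \<subseteq> ?V A \<or> X \<subseteq> ?V B"
    by (rule irreducible_setD[OF X(1) zariski_closed_hypersurface[OF assms(3)]
          zariski_closed_hypersurface[OF assms(4)] sub])
  then show False
  proof
    assume "X \<subseteq> ?V A"
    then have "vanishes_on A X" using vanishes_on_subset_iff[of A X] by (simp add: subset_iff)
    with assms(5) show False ..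
  next
    assume "X \<subseteq> ?V B"
    then have "vanishes_on B X" using vanishes_on_subset_iff[of B X] by (simp add: subset_iff)
    with assms(6) show False ..
  qed
qed

text \<open>The filter generated by the nonempty basic open subsets of \<open>X\<close>: a property
  holds eventually iff it holds on some nonempty open subset.\<close>

definition generic :: "('f::field ^ 'n::finite) set set \<Rightarrow> ('f ^ 'n) set filter" where
  "generic X = (INF B\<in>{B. (\<exists>d. B \<in> forms UNIV d) \<and> \<not> vanishes_on B X}.
      principal {P \<in> X. \<not> vanishes_on B {P}})"

locale variety =
  fixes X :: "('f::field ^ 'n::finite) set set"
  assumes variety: "proj_variety UNIV X"
begin

lemma closed: "zariski_closed UNIV X"
  and irreducible: "irreducible_set X"
  using variety by (auto simp: proj_variety_def)

lemma subset_proj_space: "X \<subseteq> proj_space"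
  using closed by (rule zariski_closed_subset)

lemma point_in_proj_space: "P \<in> X \<Longrightarrow> P \<in> proj_space"
  using subset_proj_space by blast

lemma not_vanishes_one: "\<not> vanishes_on (\<lambda>v. 1) X"
proof -
  obtain P where P: "P \<in> X" using irreducible by (auto simp: irreducible_set_def)
  then obtain v where "v \<in> P" using point_in_proj_space proj_space_nonempty by blast
  with P show ?thesis by (auto simp: vanishes_on_def)
qed

lemma eventually_generic_iff:
  "eventually p (generic X) \<longleftrightarrow>
     (\<exists>d. \<exists>B\<in>forms UNIV d. \<not> vanishes_on B X \<and> (\<forall>P\<in>X. \<not> vanishes_on B {P} \<longrightarrow> p P))"
proof -
  let ?S = "{B. (\<exists>d. B \<in> forms UNIV d) \<and> \<not> vanishes_on B X}"
  have "eventually p (generic X) \<longleftrightarrow> (\<exists>B\<in>?S. eventually p (principal {P \<in> X. \<not> vanishes_on B {P}}))"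
    unfolding generic_def
  proof (rule eventually_INF_base)
    show "?S \<noteq> {}" using not_vanishes_one forms_const[of 1] by blast
  next
    fix A B assume "A \<in> ?S" "B \<in> ?S"
    then obtain d e where "A \<in> forms UNIV d" "B \<in> forms UNIV e"
      "\<not> vanishes_on A X" "\<not> vanishes_on B X" by auto
    \<comment> \<open>The locus where \<open>A * B\<close> is nonzero lies in both basic open sets,
      and irreducibility keeps it nonempty.\<close>
    then have "(\<lambda>v. A v * B v) \<in> ?S"
      using forms_mult[of A d B e] not_vanishes_on_mult[OF irreducible subset_proj_space, of A d B e]
      by auto
    then show "\<exists>C\<in>?S. principal {P \<in> X. \<not> vanishes_on C {P}} \<le>
        inf (principal {P \<in> X. \<not> vanishes_on A {P}}) (principal {P \<in> X. \<not> vanishes_on B {P}})"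
      by (rule bexI[rotated]) (auto simp: vanishes_on_def)
  qed
  then show ?thesis by (auto simp: eventually_principal)
qed

text \<open>A form that does not vanish identically on \<open>X\<close> is nonzero at some point, so
  no basic open set is empty.\<close>

lemma generic_nontrivial: "generic X \<noteq> bot"
proof
  assume "generic X = bot"
  then have "eventually (\<lambda>P. False) (generic X)" by simp
  then show False by (auto simp: eventually_generic_iff vanishes_on_def)
qed

lemma generically_eq_iff: "generically_eq X g h \<longleftrightarrow> eventually (\<lambda>P. g P = h P) (generic X)"
  by (simp add: generically_eq_def eventually_generic_iff)

lemma eventually_in: "eventually (\<lambda>P. P \<in> X) (generic X)"
proof -
  show ?thesis unfolding eventually_generic_iff using not_vanishes_one forms_const[of 1] by blast
qed

lemma eventually_nonzero:
  assumes "B \<in> forms UNIV d" "\<not> vanishes_on B X"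
  shows "eventually (\<lambda>P. P \<in> X \<and> (\<forall>v\<in>P. B v \<noteq> 0)) (generic X)"
  unfolding eventually_generic_iff
  using assms vanishes_at_iff[OF assms(1) point_in_proj_space] by blast

text \<open>Density of nonempty open sets: were \<open>B\<close> nonzero somewhere on
  \<open>X\<close>, it would be nonzero eventually, which a proper filter forbids.\<close>

lemma vanishes_on_if_eventually:
  assumes "B \<in> forms UNIV d" "eventually (\<lambda>P. \<forall>v\<in>P. B v = 0) (generic X)"
  shows "vanishes_on B X"
proof (rule ccontr)
  assume "\<not> vanishes_on B X"
  from eventually_nonzero[OF assms(1) this] assms(2) have "eventually (\<lambda>P. False) (generic X)"
  proof eventually_elim
    case (elim P)
    then show ?case using point_in_proj_space proj_space_nonempty by blast
  qed
  then show False using generic_nontrivial by simp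
qed

end

section \<open>Local rings and orders along prime divisors\<close>

text \<open>The unit group of the local ring, given by fractions with both entries nonzero along
  \<open>Y\<close> so that products and inverses are visibly of the same kind.
  \<open>local_units_eq\<close> identifies it with the complement of the maximal ideal.\<close>

definition local_units ::
  "('f::field ^ 'n::finite) set set \<Rightarrow> ('f ^ 'n) set set \<Rightarrow> (('f ^ 'n) set \<Rightarrow> 'f) set" where
  "local_units X Y = {g. \<exists>d. \<exists>A\<in>forms UNIV d. \<exists>B\<in>forms UNIV d.
     \<not> vanishes_on A Y \<and> \<not> vanishes_on B Y \<and> generically_eq X g (quotient_fun A B)}"

lemma rational_functions_eq_local_ring: "rational_functions X = local_ring X X"
  by (simp add: rational_functions_def local_ring_def)

text \<open>Equality \<open>Y = X\<close> is allowed on purpose: the local ring along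
  \<open>X\<close> itself is the function field, so facts about rational functions are instances of
  facts about local rings.\<close>

locale subvariety = variety X for X :: "('f::field ^ 'n::finite) set set" +
  fixes Y :: "('f ^ 'n) set set"
  assumes subvariety: "proj_variety UNIV Y" and subset: "Y \<subseteq> X"
begin

sublocale Y: variety Y
  by unfold_locales (rule subvariety)

lemma not_vanishes_on_superset: "\<not> vanishes_on B Y \<Longrightarrow> \<not> vanishes_on B X"
  using subset by (auto simp: vanishes_on_def)

text \<open>Replaces the representative chosen inside \<open>quotient_fun\<close> by all
  representatives at once, the shape in which fractions are multiplied and inverted
  afterwards.\<close>

lemma generically_eq_quotient_iff:
  assumes "A \<in> forms UNIV d" "B \<in> forms UNIV d"
  shows "generically_eq X g (quotient_fun A B) \<longleftrightarrow>
    eventually (\<lambda>P. \<forall>v\<in>P. g P = A v / B v) (generic X)"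
  unfolding generically_eq_iff
proof (intro iffI)
  assume "eventually (\<lambda>P. g P = quotient_fun A B P) (generic X)"
  with eventually_in show "eventually (\<lambda>P. \<forall>v\<in>P. g P = A v / B v) (generic X)"
    by eventually_elim (use quotient_fun_eq[OF assms] point_in_proj_space in auto)
next
  assume "eventually (\<lambda>P. \<forall>v\<in>P. g P = A v / B v) (generic X)"
  with eventually_in show "eventually (\<lambda>P. g P = quotient_fun A B P) (generic X)"
  proof eventually_elim
    case (elim P)
    then obtain v where "v \<in> P" using point_in_proj_space proj_space_nonempty by blast
    with elim show ?case using quotient_fun_eq[OF assms] point_in_proj_space by simp
  qed
qed

lemma local_ringI:
  assumes "A \<in> forms UNIV d" "B \<in> forms UNIV d" "\<not> vanishes_on B Y"
    "eventually (\<lambda>P. \<forall>v\<in>P. g P = A v / B v) (generic X)"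
  shows "g \<in> local_ring X Y"
  using assms generically_eq_quotient_iff[OF assms(1,2)] unfolding local_ring_def by blast

lemma local_ringE:
  assumes "g \<in> local_ring X Y"
  obtains d A B where "A \<in> forms UNIV d" "B \<in> forms UNIV d" "\<not> vanishes_on B Y"
    "eventually (\<lambda>P. \<forall>v\<in>P. B v \<noteq> 0 \<and> g P = A v / B v) (generic X)"
proof -
  obtain d A B where *: "A \<in> forms UNIV d" "B \<in> forms UNIV d" "\<not> vanishes_on B Y"
    "generically_eq X g (quotient_fun A B)"
    using assms unfolding local_ring_def by blast
  moreover have "eventually (\<lambda>P. \<forall>v\<in>P. B v \<noteq> 0 \<and> g P = A v / B v) (generic X)"
    using eventually_nonzero[OF *(2) not_vanishes_on_superset[OF *(3)]]
      *(4)[unfolded generically_eq_quotient_iff[OF *(1,2)]]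
    by eventually_elim blast
  ultimately show ?thesis using that by blast
qed

lemma local_max_idealI:
  assumes "A \<in> forms UNIV d" "B \<in> forms UNIV d" "vanishes_on A Y" "\<not> vanishes_on B Y"
    "eventually (\<lambda>P. \<forall>v\<in>P. g P = A v / B v) (generic X)"
  shows "g \<in> local_max_ideal X Y"
  using assms generically_eq_quotient_iff[OF assms(1,2)] unfolding local_max_ideal_def by blast

lemma local_max_idealE:
  assumes "g \<in> local_max_ideal X Y"
  obtains d A B where "A \<in> forms UNIV d" "B \<in> forms UNIV d" "vanishes_on A Y" "\<not> vanishes_on B Y"
    "eventually (\<lambda>P. \<forall>v\<in>P. B v \<noteq> 0 \<and> g P = A v / B v) (generic X)"
proof -
  obtain d A B where *: "A \<in> forms UNIV d" "B \<in> forms UNIV d" "vanishes_on A Y" "\<not> vanishes_on B Y"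
    "generically_eq X g (quotient_fun A B)"
    using assms unfolding local_max_ideal_def by blast
  moreover have "eventually (\<lambda>P. \<forall>v\<in>P. B v \<noteq> 0 \<and> g P = A v / B v) (generic X)"
    using eventually_nonzero[OF *(2) not_vanishes_on_superset[OF *(4)]]
      *(5)[unfolded generically_eq_quotient_iff[OF *(1,2)]]
    by eventually_elim blast
  ultimately show ?thesis using that by blast
qed

lemma local_unitsI:
  assumes "A \<in> forms UNIV d" "B \<in> forms UNIV d" "\<not> vanishes_on A Y" "\<not> vanishes_on B Y"
    "eventually (\<lambda>P. \<forall>v\<in>P. g P = A v / B v) (generic X)"
  shows "g \<in> local_units X Y"
  using assms generically_eq_quotient_iff[OF assms(1,2)] unfolding local_units_def by blast

lemma local_unitsE:
  assumes "g \<in> local_units X Y"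
  obtains d A B where "A \<in> forms UNIV d" "B \<in> forms UNIV d" "\<not> vanishes_on A Y" "\<not> vanishes_on B Y"
    "eventually (\<lambda>P. \<forall>v\<in>P. A v \<noteq> 0 \<and> B v \<noteq> 0 \<and> g P = A v / B v) (generic X)"
proof -
  obtain d A B where *: "A \<in> forms UNIV d" "B \<in> forms UNIV d" "\<not> vanishes_on A Y" "\<not> vanishes_on B Y"
    "generically_eq X g (quotient_fun A B)"
    using assms unfolding local_units_def by blast
  moreover have "eventually (\<lambda>P. \<forall>v\<in>P. A v \<noteq> 0 \<and> B v \<noteq> 0 \<and> g P = A v / B v) (generic X)"
    using eventually_nonzero[OF *(1) not_vanishes_on_superset[OF *(3)]]
      eventually_nonzero[OF *(2) not_vanishes_on_superset[OF *(4)]]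
      *(5)[unfolded generically_eq_quotient_iff[OF *(1,2)]]
    by eventually_elim blast
  ultimately show ?thesis using that by blast
qed

lemma local_units_subset_local_ring: "local_units X Y \<subseteq> local_ring X Y"
  unfolding local_units_def local_ring_def by blast

lemma local_ring_mult:
  assumes "g \<in> local_ring X Y" "h \<in> local_ring X Y"
  shows "(\<lambda>P. g P * h P) \<in> local_ring X Y"
proof -
  obtain d A B where 1: "A \<in> forms UNIV d" "B \<in> forms UNIV d" "\<not> vanishes_on B Y"
    "eventually (\<lambda>P. \<forall>v\<in>P. B v \<noteq> 0 \<and> g P = A v / B v) (generic X)"
    using assms(1) by (rule local_ringE)
  obtain e A' B' where 2: "A' \<in> forms UNIV e" "B' \<in> forms UNIV e" "\<not> vanishes_on B' Y"
    "eventually (\<lambda>P. \<forall>v\<in>P. B' v \<noteq> 0 \<and> h P = A' v / B' v) (generic X)"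
    using assms(2) by (rule local_ringE)
  show ?thesis
  proof (rule local_ringI[OF forms_mult[OF 1(1) 2(1)] forms_mult[OF 1(2) 2(2)]])
    show "\<not> vanishes_on (\<lambda>v. B v * B' v) Y"
      by (rule not_vanishes_on_mult[OF Y.irreducible Y.subset_proj_space 1(2) 2(2) 1(3) 2(3)])
    show "eventually (\<lambda>P. \<forall>v\<in>P. g P * h P = A v * A' v / (B v * B' v)) (generic X)"
      using 1(4) 2(4) by eventually_elim simp
  qed
qed

lemma local_max_ideal_mult:
  assumes "g \<in> local_ring X Y" "h \<in> local_max_ideal X Y"
  shows "(\<lambda>P. g P * h P) \<in> local_max_ideal X Y"
proof -
  obtain d A B where 1: "A \<in> forms UNIV d" "B \<in> forms UNIV d" "\<not> vanishes_on B Y"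
    "eventually (\<lambda>P. \<forall>v\<in>P. B v \<noteq> 0 \<and> g P = A v / B v) (generic X)"
    using assms(1) by (rule local_ringE)
  obtain e A' B' where 2: "A' \<in> forms UNIV e" "B' \<in> forms UNIV e" "vanishes_on A' Y"
    "\<not> vanishes_on B' Y"
    "eventually (\<lambda>P. \<forall>v\<in>P. B' v \<noteq> 0 \<and> h P = A' v / B' v) (generic X)"
    using assms(2) by (rule local_max_idealE)
  show ?thesis
  proof (rule local_max_idealI[OF forms_mult[OF 1(1) 2(1)] forms_mult[OF 1(2) 2(2)]])
    show "vanishes_on (\<lambda>v. A v * A' v) Y"
      using 2(3) by (simp add: vanishes_on_def)
    show "\<not> vanishes_on (\<lambda>v. B v * B' v) Y"
      by (rule not_vanishes_on_mult[OF Y.irreducible Y.subset_proj_space 1(2) 2(2) 1(3) 2(4)])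
    show "eventually (\<lambda>P. \<forall>v\<in>P. g P * h P = A v * A' v / (B v * B' v)) (generic X)"
      using 1(4) 2(5) by eventually_elim simp
  qed
qed

lemma local_units_mult:
  assumes "g \<in> local_units X Y" "h \<in> local_units X Y"
  shows "(\<lambda>P. g P * h P) \<in> local_units X Y"
proof -
  obtain d A B where 1: "A \<in> forms UNIV d" "B \<in> forms UNIV d" "\<not> vanishes_on A Y" "\<not> vanishes_on B Y"
    "eventually (\<lambda>P. \<forall>v\<in>P. A v \<noteq> 0 \<and> B v \<noteq> 0 \<and> g P = A v / B v) (generic X)"
    using assms(1) by (rule local_unitsE)
  obtain e A' B' where 2: "A' \<in> forms UNIV e" "B' \<in> forms UNIV e" "\<not> vanishes_on A' Y" "\<not> vanishes_on B' Y"
    "eventually (\<lambda>P. \<forall>v\<in>P. A' v \<noteq> 0 \<and> B' v \<noteq> 0 \<and> h P = A' v / B' v) (generic X)"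
    using assms(2) by (rule local_unitsE)
  show ?thesis
  proof (rule local_unitsI[OF forms_mult[OF 1(1) 2(1)] forms_mult[OF 1(2) 2(2)]])
    show "\<not> vanishes_on (\<lambda>v. A v * A' v) Y"
      by (rule not_vanishes_on_mult[OF Y.irreducible Y.subset_proj_space 1(1) 2(1) 1(3) 2(3)])
    show "\<not> vanishes_on (\<lambda>v. B v * B' v) Y"
      by (rule not_vanishes_on_mult[OF Y.irreducible Y.subset_proj_space 1(2) 2(2) 1(4) 2(4)])
    show "eventually (\<lambda>P. \<forall>v\<in>P. g P * h P = A v * A' v / (B v * B' v)) (generic X)"
      using 1(5) 2(5) by eventually_elim simp
  qed
qed

lemma local_units_inverse:
  assumes "g \<in> local_units X Y"
  shows "(\<lambda>P. inverse (g P)) \<in> local_units X Y"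
proof -
  obtain d A B where 1: "A \<in> forms UNIV d" "B \<in> forms UNIV d" "\<not> vanishes_on A Y" "\<not> vanishes_on B Y"
    "eventually (\<lambda>P. \<forall>v\<in>P. A v \<noteq> 0 \<and> B v \<noteq> 0 \<and> g P = A v / B v) (generic X)"
    using assms(1) by (rule local_unitsE)
  have "eventually (\<lambda>P. \<forall>v\<in>P. inverse (g P) = B v / A v) (generic X)"
    using 1(5) by eventually_elim simp
  with 1 show ?thesis by (blast intro: local_unitsI)
qed

lemma one_in_local_units: "(\<lambda>P. 1) \<in> local_units X Y"
  by (rule local_unitsI[OF forms_const[of 1] forms_const[of 1]]) (simp_all add: Y.not_vanishes_one)

lemma local_units_power: "g \<in> local_units X Y \<Longrightarrow> (\<lambda>P. g P ^ n) \<in> local_units X Y"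
  by (induction n) (simp_all add: one_in_local_units local_units_mult)

lemma local_units_powi:
  assumes "g \<in> local_units X Y"
  shows "(\<lambda>P. g P powi n) \<in> local_units X Y"
proof (cases "0 \<le> n")
  case True
  then show ?thesis using local_units_power[OF assms, of "nat n"] by (simp add: power_int_def)
next
  case False
  then show ?thesis
    using local_units_power[OF local_units_inverse[OF assms], of "nat (- n)"]
    by (simp add: power_int_def)
qed

lemma local_units_cong:
  assumes "eventually (\<lambda>P. g P = h P) (generic X)" "g \<in> local_units X Y"
  shows "h \<in> local_units X Y"
proof -
  obtain d A B where 1: "A \<in> forms UNIV d" "B \<in> forms UNIV d" "\<not> vanishes_on A Y" "\<not> vanishes_on B Y"
    "eventually (\<lambda>P. \<forall>v\<in>P. A v \<noteq> 0 \<and> B v \<noteq> 0 \<and> g P = A v / B v) (generic X)"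
    using assms(2) by (rule local_unitsE)
  have "eventually (\<lambda>P. \<forall>v\<in>P. h P = A v / B v) (generic X)"
    using 1(5) assms(1) by eventually_elim simp
  with 1 show ?thesis by (blast intro: local_unitsI)
qed

lemma local_max_ideal_cong:
  assumes "eventually (\<lambda>P. g P = h P) (generic X)" "g \<in> local_max_ideal X Y"
  shows "h \<in> local_max_ideal X Y"
proof -
  obtain d A B where 1: "A \<in> forms UNIV d" "B \<in> forms UNIV d" "vanishes_on A Y" "\<not> vanishes_on B Y"
    "eventually (\<lambda>P. \<forall>v\<in>P. B v \<noteq> 0 \<and> g P = A v / B v) (generic X)"
    using assms(2) by (rule local_max_idealE)
  have "eventually (\<lambda>P. \<forall>v\<in>P. h P = A v / B v) (generic X)"
    using 1(5) assms(1) by eventually_elim simp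
  with 1 show ?thesis by (blast intro: local_max_idealI)
qed

lemma local_units_nonzero:
  assumes "g \<in> local_units X Y"
  shows "eventually (\<lambda>P. g P \<noteq> 0) (generic X)"
proof -
  obtain d A B where "eventually (\<lambda>P. \<forall>v\<in>P. A v \<noteq> 0 \<and> B v \<noteq> 0 \<and> g P = A v / B v) (generic X)"
    using assms by (rule local_unitsE)
  with eventually_in show ?thesis
  proof eventually_elim
    case (elim P)
    then obtain v where "v \<in> P" using point_in_proj_space proj_space_nonempty by blast
    with elim show ?case by simp
  qed
qed

text \<open>Otherwise 1 would equal a fraction \<open>A / B\<close> with \<open>A\<close> zero on
  \<open>Y\<close> and \<open>B\<close> not. Then \<open>A - B\<close> vanishes generically, hence
  on all of \<open>X\<close>, and restricting to \<open>Y\<close> makes \<open>B\<close> vanish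
  there.\<close>

lemma local_units_not_in_max_ideal:
  assumes "g \<in> local_units X Y"
  shows "g \<notin> local_max_ideal X Y"
proof
  assume "g \<in> local_max_ideal X Y"
  with assms have "(\<lambda>P. inverse (g P) * g P) \<in> local_max_ideal X Y"
    using local_max_ideal_mult local_units_inverse local_units_subset_local_ring by blast
  then obtain d A B where 1: "A \<in> forms UNIV d" "B \<in> forms UNIV d" "vanishes_on A Y" "\<not> vanishes_on B Y"
    "eventually (\<lambda>P. \<forall>v\<in>P. B v \<noteq> 0 \<and> inverse (g P) * g P = A v / B v) (generic X)"
    by (rule local_max_idealE)
  have "vanishes_on (\<lambda>v. A v + (- 1) * B v) X"
  proof (rule vanishes_on_if_eventually)
    show "(\<lambda>v. A v + (- 1) * B v) \<in> forms UNIV d"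
      by (intro forms_add forms_cmult 1)
    show "eventually (\<lambda>P. \<forall>v\<in>P. A v + (- 1) * B v = 0) (generic X)"
      using 1(5) local_units_nonzero[OF assms] by eventually_elim auto
  qed
  then have "vanishes_on B Y"
    using 1(3) subset by (fastforce simp: vanishes_on_def)
  with 1(4) show False by simp
qed

text \<open>If \<open>A / B\<close> lies in the local ring but not in the maximal ideal, this very
  \<open>A\<close> cannot vanish on \<open>Y\<close>.\<close>

lemma local_units_eq: "local_units X Y = local_ring X Y - local_max_ideal X Y"
proof -
  have "g \<in> local_units X Y" if "g \<in> local_ring X Y" "g \<notin> local_max_ideal X Y" for g
    using that unfolding local_ring_def local_max_ideal_def local_units_def by blast
  then show ?thesis
    using local_units_not_in_max_ideal local_units_subset_local_ring by blast
qed

text \<open>Recognizes a unit from an inverse inside the local ring, so that no fraction with a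
  nonvanishing numerator has to be exhibited.\<close>

lemma local_unitsI_inverse:
  assumes "g \<in> local_ring X Y" "h \<in> local_ring X Y" "eventually (\<lambda>P. h P * g P = 1) (generic X)"
  shows "g \<in> local_units X Y"
proof -
  have "g \<notin> local_max_ideal X Y"
  proof
    assume "g \<in> local_max_ideal X Y"
    then have "(\<lambda>P. h P * g P) \<in> local_max_ideal X Y"
      by (rule local_max_ideal_mult[OF assms(2)])
    then have "(\<lambda>P. 1) \<in> local_max_ideal X Y"
      by (rule local_max_ideal_cong[OF assms(3)])
    then show False using local_units_not_in_max_ideal one_in_local_units by blast
  qed
  with assms(1) show ?thesis using local_units_eq by blast
qed

end

context variety
begin

sublocale self: subvariety X X
  by unfold_locales (simp_all add: variety)

lemma local_max_ideal_self_eq_zero: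
  "g \<in> local_max_ideal X X \<Longrightarrow> eventually (\<lambda>P. g P = 0) (generic X)"
proof (erule self.local_max_idealE)
  fix d A B assume A: "vanishes_on A X"
    and *: "eventually (\<lambda>P. \<forall>v\<in>P. B v \<noteq> 0 \<and> g P = A v / B v) (generic X)"
  from eventually_in * show "eventually (\<lambda>P. g P = 0) (generic X)"
  proof eventually_elim
    case (elim P)
    then obtain v where "v \<in> P" using point_in_proj_space proj_space_nonempty by blast
    with elim A show ?case by (simp add: vanishes_on_def)
  qed
qed

text \<open>The maximal ideal of the function field is zero, as a numerator in it vanishes on all of
  \<open>X\<close>.\<close>

lemma local_units_self_iff:
  "g \<in> local_units X X \<longleftrightarrow> g \<in> rational_functions X \<and> \<not> generically_eq X g (\<lambda>P. 0)"
proof -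
  have "\<not> generically_eq X g (\<lambda>P. 0)" if "g \<in> local_units X X"
  proof
    assume "generically_eq X g (\<lambda>P. 0)"
    then have "eventually (\<lambda>P. g P = 0) (generic X)" by (simp add: generically_eq_iff)
    with self.local_units_nonzero[OF that] have "eventually (\<lambda>P. False) (generic X)"
      by eventually_elim simp
    then show False using generic_nontrivial by simp
  qed
  moreover have "generically_eq X g (\<lambda>P. 0)" if "g \<in> local_max_ideal X X"
    using local_max_ideal_self_eq_zero[OF that] by (simp add: generically_eq_iff)
  ultimately show ?thesis
    using self.local_units_eq rational_functions_eq_local_ring[of X] by blast
qed

end

section \<open>Uniformizers and orders along a prime divisor\<close>

lemma exists_form_nonzero:
  fixes v :: "'f::field ^ 'n::finite"
  assumes "v \<noteq> 0"
  shows "\<exists>F\<in>forms UNIV d. F v \<noteq> 0"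
proof -
  obtain i where "v $ i \<noteq> 0" using assms by (auto simp: Finite_Cartesian_Product.vec_eq_iff)
  moreover have "(\<lambda>w :: 'f ^ 'n. w $ i ^ d) \<in> forms UNIV d"
    using forms_power[OF forms_coord[of i], of d] by simp
  ultimately show ?thesis by (intro bexI[of _ "\<lambda>w. w $ i ^ d"]) simp_all
qed

locale prime_div = subvariety X Y for X Y :: "('f::field ^ 'n::finite) set set" +
  assumes prime_divisor: "prime_divisor X Y"
begin

text \<open>\<open>Y\<close> is closed and smaller than \<open>X\<close>, so some form vanishes on
  \<open>Y\<close> but not on \<open>X\<close>; dividing by a form of the same degree that is
  nonzero at a point of \<open>Y\<close> gives the element. It excludes the zero function as a
  uniformizer.\<close>

lemma local_max_ideal_nonzero: "\<exists>s\<in>local_max_ideal X Y. s \<in> local_units X X"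
proof -
  obtain P where P: "P \<in> X" "P \<notin> Y"
    using prime_divisor by (auto simp: prime_divisor_def)
  obtain d A where A: "A \<in> forms UNIV d" "vanishes_on A Y" "\<not> vanishes_on A {P}"
    using zariski_closedE[OF Y.closed point_in_proj_space[OF P(1)] P(2)] by blast
  then have AX: "\<not> vanishes_on A X" using P(1) by (auto simp: vanishes_on_def)
  obtain R where R: "R \<in> Y" using Y.irreducible by (auto simp: irreducible_set_def)
  then obtain v where v: "v \<in> R" using Y.point_in_proj_space proj_space_nonempty by blast
  then have "v \<noteq> 0" using R Y.point_in_proj_space proj_spaceE(2) by blast
  then obtain B where B: "B \<in> forms UNIV d" "B v \<noteq> 0"
    using exists_form_nonzero by blast
  then have BY: "\<not> vanishes_on B Y" using R v by (auto simp: vanishes_on_def)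
  have "generically_eq X (quotient_fun A B) (quotient_fun A B)"
    by (simp add: generically_eq_iff)
  then show ?thesis
    using A B AX BY not_vanishes_on_superset[OF BY]
    unfolding local_max_ideal_def local_units_def by blast
qed

lemma uniformizer_nonzero:
  assumes "uniformizer X Y t"
  shows "t \<in> local_units X X"
proof (rule ccontr)
  assume *: "t \<notin> local_units X X"
  have "t \<in> local_max_ideal X Y" using assms by (simp add: uniformizer_def)
  then have "t \<in> rational_functions X"
    using not_vanishes_on_superset unfolding local_max_ideal_def rational_functions_def by blast
  with * have t: "eventually (\<lambda>P. t P = 0) (generic X)"
    by (simp add: local_units_self_iff generically_eq_iff)
  obtain s where s: "s \<in> local_max_ideal X Y" "s \<in> local_units X X"
    using local_max_ideal_nonzero by blast
  then obtain r where "eventually (\<lambda>P. s P = r P * t P) (generic X)"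
    using assms unfolding uniformizer_def generically_eq_iff by blast
  with t self.local_units_nonzero[OF s(2)] have "eventually (\<lambda>P. False) (generic X)"
    by eventually_elim simp
  then show False using generic_nontrivial by simp
qed

text \<open>Each uniformizer divides the other, and cancelling the nonzero function \<open>t\<close>
  shows that the two quotients are inverse to each other.\<close>

lemma uniformizer_ratio:
  assumes "uniformizer X Y t" "uniformizer X Y t'"
  shows "\<exists>r\<in>local_units X Y. eventually (\<lambda>P. t' P = r P * t P) (generic X)"
proof -
  obtain r where r: "r \<in> local_ring X Y" "eventually (\<lambda>P. t' P = r P * t P) (generic X)"
    using assms unfolding uniformizer_def generically_eq_iff by blast
  obtain r' where r': "r' \<in> local_ring X Y" "eventually (\<lambda>P. t P = r' P * t' P) (generic X)"
    using assms unfolding uniformizer_def generically_eq_iff by blast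
  have "eventually (\<lambda>P. r' P * r P = 1) (generic X)"
    using r(2) r'(2) self.local_units_nonzero[OF uniformizer_nonzero[OF assms(1)]]
    by eventually_elim (simp add: mult.commute)
  from local_unitsI_inverse[OF r(1) r'(1) this] r(2) show ?thesis by (intro bexI[of _ r])
qed

text \<open>A change of uniformizer multiplies \<open>t powi n\<close> by the unit
  \<open>r powi n\<close>. Hence one \<open>t\<close> can be fixed and shared by all functions whose
  orders are compared.\<close>

lemma has_order_iff:
  assumes t: "uniformizer X Y t"
  shows "has_order X Y g n \<longleftrightarrow>
    (\<exists>u\<in>local_units X Y. eventually (\<lambda>P. g P = u P * t P powi n) (generic X))"
proof
  assume "has_order X Y g n"
  then obtain t' u where t': "uniformizer X Y t'" and u: "u \<in> local_units X Y"
    "eventually (\<lambda>P. g P = u P * t' P powi n) (generic X)"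
    unfolding has_order_def local_units_eq generically_eq_iff by blast
  obtain r where r: "r \<in> local_units X Y" "eventually (\<lambda>P. t' P = r P * t P) (generic X)"
    using uniformizer_ratio[OF t t'] by blast
  have "(\<lambda>P. u P * r P powi n) \<in> local_units X Y"
    by (intro local_units_mult local_units_powi u r)
  moreover have "eventually (\<lambda>P. g P = (u P * r P powi n) * t P powi n) (generic X)"
    using u(2) r(2) by eventually_elim (simp add: power_int_mult_distrib)
  ultimately show "\<exists>u\<in>local_units X Y. eventually (\<lambda>P. g P = u P * t P powi n) (generic X)"
    by (intro bexI[of _ "\<lambda>P. u P * r P powi n"])
next
  assume "\<exists>u\<in>local_units X Y. eventually (\<lambda>P. g P = u P * t P powi n) (generic X)"
  with t show "has_order X Y g n"
    unfolding has_order_def local_units_eq generically_eq_iff by blast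
qed

lemma has_orderI:
  assumes "uniformizer X Y t" "u \<in> local_units X Y"
    "eventually (\<lambda>P. g P = u P * t P powi n) (generic X)"
  shows "has_order X Y g n"
  unfolding has_order_iff[OF assms(1)] using assms(2,3) by (intro bexI[of _ u])

text \<open>Positive powers of \<open>t\<close> lie in the maximal ideal, and negative exponents
  reduce to positive ones by inversion.\<close>

lemma uniformizer_powi_not_unit:
  assumes t: "uniformizer X Y t" and unit: "(\<lambda>P. t P powi n) \<in> local_units X Y"
  shows "n = 0"
proof -
  have *: "m = 0" if "(\<lambda>P. t P ^ m) \<in> local_units X Y" for m
  proof (cases m)
    case (Suc l)
    have tm: "t \<in> local_max_ideal X Y" using t by (simp add: uniformizer_def)
    have "t \<in> local_ring X Y"
      using tm unfolding local_max_ideal_def local_ring_def by blast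
    then have "(\<lambda>P. t P ^ l) \<in> local_ring X Y"
    proof (induction l)
      case 0
      show ?case using one_in_local_units local_units_subset_local_ring by auto
    next
      case (Suc l)
      then show ?case using local_ring_mult[OF Suc.prems Suc.IH] by simp
    qed
    from local_max_ideal_mult[OF this tm] have "(\<lambda>P. t P ^ m) \<in> local_max_ideal X Y"
      by (simp add: Suc mult.commute)
    with that show ?thesis using local_units_not_in_max_ideal by blast
  qed simp
  show ?thesis
  proof (cases "0 \<le> n")
    case True
    then show ?thesis using *[of "nat n"] unit by (simp add: power_int_def)
  next
    case False
    have "(\<lambda>P. inverse (t P powi n)) \<in> local_units X Y"
      by (rule local_units_inverse[OF unit])
    then show ?thesis using *[of "nat (- n)"] False by (simp add: power_int_def flip: power_inverse)
  qed
qed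

text \<open>Dividing the two representations exhibits \<open>t powi (m - n)\<close> as a
  unit.\<close>

lemma has_order_unique:
  assumes "has_order X Y g m" "has_order X Y g n"
  shows "m = n"
proof -
  obtain t where t: "uniformizer X Y t" using assms(1) by (auto simp: has_order_def)
  obtain u where u: "u \<in> local_units X Y" "eventually (\<lambda>P. g P = u P * t P powi m) (generic X)"
    using assms(1) has_order_iff[OF t] by blast
  obtain w where w: "w \<in> local_units X Y" "eventually (\<lambda>P. g P = w P * t P powi n) (generic X)"
    using assms(2) has_order_iff[OF t] by blast
  have "eventually (\<lambda>P. w P * inverse (u P) = t P powi (m - n)) (generic X)"
    using u(2) w(2) local_units_nonzero[OF u(1)]
      self.local_units_nonzero[OF uniformizer_nonzero[OF t]]
    by eventually_elim (simp add: power_int_diff field_simps)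
  then have "(\<lambda>P. t P powi (m - n)) \<in> local_units X Y"
    by (rule local_units_cong) (intro local_units_mult local_units_inverse u w)
  then show ?thesis using uniformizer_powi_not_unit[OF t] by fastforce
qed

lemma order_along_eq:
  assumes "has_order X Y g n"
  shows "order_along X Y g = n"
  unfolding order_along_def
  using assms by (rule the_equality) (rule has_order_unique[OF _ assms])

lemma has_order_cong:
  assumes "eventually (\<lambda>P. g P = h P) (generic X)" "has_order X Y g n"
  shows "has_order X Y h n"
proof -
  obtain t where t: "uniformizer X Y t" using assms(2) by (auto simp: has_order_def)
  then obtain u where u: "u \<in> local_units X Y" "eventually (\<lambda>P. g P = u P * t P powi n) (generic X)"
    using assms(2) has_order_iff[OF t] by blast
  have "eventually (\<lambda>P. h P = u P * t P powi n) (generic X)"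
    using u(2) assms(1) by eventually_elim simp
  then show ?thesis by (rule has_orderI[OF t u(1)])
qed

lemma has_order_mult:
  assumes "has_order X Y g m" "has_order X Y h n"
  shows "has_order X Y (\<lambda>P. g P * h P) (m + n)"
proof -
  obtain t where t: "uniformizer X Y t" using assms(1) by (auto simp: has_order_def)
  obtain u where u: "u \<in> local_units X Y" "eventually (\<lambda>P. g P = u P * t P powi m) (generic X)"
    using assms(1) has_order_iff[OF t] by blast
  obtain w where w: "w \<in> local_units X Y" "eventually (\<lambda>P. h P = w P * t P powi n) (generic X)"
    using assms(2) has_order_iff[OF t] by blast
  have "eventually (\<lambda>P. g P * h P = (u P * w P) * t P powi (m + n)) (generic X)"
    using u(2) w(2) self.local_units_nonzero[OF uniformizer_nonzero[OF t]]
    by eventually_elim (simp add: power_int_add)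
  then show ?thesis by (rule has_orderI[OF t local_units_mult[OF u(1) w(1)]])
qed

lemma has_order_inverse:
  assumes "has_order X Y g m"
  shows "has_order X Y (\<lambda>P. inverse (g P)) (- m)"
proof -
  obtain t where t: "uniformizer X Y t" using assms(1) by (auto simp: has_order_def)
  obtain u where u: "u \<in> local_units X Y" "eventually (\<lambda>P. g P = u P * t P powi m) (generic X)"
    using assms(1) has_order_iff[OF t] by blast
  have "eventually (\<lambda>P. inverse (g P) = inverse (u P) * t P powi (- m)) (generic X)"
    using u(2) by eventually_elim (simp add: power_int_minus)
  then show ?thesis by (rule has_orderI[OF t local_units_inverse[OF u(1)]])
qed

lemma has_order_unit:
  assumes "uniformizer X Y t" "u \<in> local_units X Y"
  shows "has_order X Y u 0"
  by (rule has_orderI[OF assms]) simp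

end

locale regular_variety = variety X for X :: "('f::field ^ 'n::finite) set set" +
  assumes regular: "regular_in_codim_one X"
begin

lemma has_order_along:
  assumes Y: "prime_divisor X Y" and g: "g \<in> local_units X X"
  shows "has_order X Y g (order_along X Y g)"
proof -
  interpret prime_div X Y
    using Y by unfold_locales (auto simp: prime_divisor_def)
  obtain n where n: "has_order X Y g n"
    using regular Y g[unfolded local_units_self_iff] unfolding regular_in_codim_one_def by metis
  then show ?thesis by (simp add: order_along_eq[OF n])
qed

text \<open>Regularity gives the constant function 1 an order, and a witness of
  \<open>has_order\<close> contains a uniformizer.\<close>

lemma exists_uniformizer: "prime_divisor X Y \<Longrightarrow> \<exists>t. uniformizer X Y t"
  using has_order_along[OF _ self.one_in_local_units] unfolding has_order_def by metis

end

section \<open>Morphisms\<close>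

lemma pt_scale:
  assumes "r \<noteq> 0"
  shows "pt (r *s v) = pt v"
proof (rule pt_cong)
  show "r *s v \<in> pt v" using assms by (auto simp: pt_def)
qed

lemma morphism_UNIV:
  assumes "morphism S X Z h" "Z \<subseteq> W"
  shows "morphism UNIV X W h"
  unfolding morphism_def
proof (intro conjI ballI)
  show "h ` X \<subseteq> W" using assms by (auto simp: morphism_def)
  fix P assume "P \<in> X"
  then obtain d G where *: "\<And>j. (\<lambda>v. G v $ j) \<in> forms S d" "\<exists>v\<in>P. G v \<noteq> 0"
    "\<forall>R\<in>X. \<forall>v\<in>R. G v \<noteq> 0 \<longrightarrow> h R = pt (G v)"
    using assms(1) unfolding morphism_def by metis
  have "(\<lambda>v. G v $ j) \<in> forms UNIV d" for j
    using *(1) forms_mono[of S UNIV d] by blast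
  with * show "\<exists>d G. (\<forall>j. (\<lambda>v. G v $ j) \<in> forms UNIV d) \<and> (\<exists>v\<in>P. G v \<noteq> 0) \<and>
      (\<forall>R\<in>X. \<forall>v\<in>R. G v \<noteq> 0 \<longrightarrow> h R = pt (G v))"
    by (intro exI[of _ d] exI[of _ G]) simp
qed

lemma morphism_cong:
  assumes "morphism S X Z h" "\<And>P. P \<in> X \<Longrightarrow> h P = k P"
  shows "morphism S X Z k"
  using assms unfolding morphism_def by (auto simp: image_subset_iff)

text \<open>The auxiliary form \<open>M\<close> is a coordinate of \<open>G\<close>. Multiplying by it kills the points where \<open>G\<close>
  vanishes, at which a form of degree 0 composed with \<open>G\<close> need not vanish.\<close>

lemma morphism_local:
  fixes X :: "('f::field ^ 'n::finite) set set" and Z :: "('f ^ 'm::finite) set set"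
  assumes h: "morphism S X Z h" and X: "X \<subseteq> proj_space" and P: "P \<in> X"
  obtains G :: "'f ^ 'n \<Rightarrow> 'f ^ 'm" and d M e where
    "\<forall>j. (\<lambda>v. G v $ j) \<in> forms UNIV d" "M \<in> forms UNIV e" "\<forall>v\<in>P. M v \<noteq> 0"
    "\<forall>R\<in>X. \<forall>v\<in>R. M v \<noteq> 0 \<longrightarrow> G v \<in> h R \<and> G v \<noteq> 0 \<and> h R = pt (G v)"
proof -
  have "morphism UNIV X Z h" using morphism_UNIV[OF h] by simp
  then obtain d G where *: "\<And>j. (\<lambda>v. G v $ j) \<in> forms UNIV d" "\<exists>v\<in>P. G v \<noteq> 0"
    "\<forall>R\<in>X. \<forall>v\<in>R. G v \<noteq> 0 \<longrightarrow> h R = pt (G v)"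
    using P unfolding morphism_def by metis
  obtain v j where v: "v \<in> P" "G v $ j \<noteq> 0"
    using *(2) by (auto simp: Finite_Cartesian_Product.vec_eq_iff)
  have "P \<in> proj_space" using P X by blast
  have nz: "G w \<noteq> 0" if "G w $ j \<noteq> 0" for w using that by auto
  have a: "\<forall>w\<in>P. G w $ j \<noteq> 0"
  proof
    fix w assume "w \<in> P"
    then show "G w $ j \<noteq> 0"
      using form_zero_iff[OF *(1)[of j] \<open>P \<in> proj_space\<close> v(1)] v(2) by simp
  qed
  have b: "\<forall>R\<in>X. \<forall>v\<in>R. G v $ j \<noteq> 0 \<longrightarrow> G v \<in> h R \<and> G v \<noteq> 0 \<and> h R = pt (G v)"
  proof (intro ballI impI)
    fix R v assume "R \<in> X" "v \<in> R" "G v $ j \<noteq> 0"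
    then have "G v \<noteq> 0" "h R = pt (G v)" using nz *(3) by blast+
    then show "G v \<in> h R \<and> G v \<noteq> 0 \<and> h R = pt (G v)" using pt_self[of "G v"] by simp
  qed
  have "\<forall>j. (\<lambda>v. G v $ j) \<in> forms UNIV d" using *(1) by (rule allI)
  from that[OF this *(1)[of j] a b] show ?thesis .
qed

lemma forms_pullback:
  assumes "\<And>j. (\<lambda>v. G v $ j) \<in> forms UNIV d" "M \<in> forms UNIV e" "A \<in> forms UNIV a"
  shows "(\<lambda>v. A (G v) * M v) \<in> forms UNIV (a * d + e)"
  by (rule forms_mult[OF forms_compose[OF assms(3,1)] assms(2)])

lemma morphism_comp:
  fixes X :: "('f::field ^ 'n::finite) set set" and Z :: "('f ^ 'm::finite) set set"
    and W :: "('f ^ 'l::finite) set set"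
  assumes h: "morphism S X Z h" and k: "morphism T Z W k"
    and X: "X \<subseteq> proj_space" and Z: "Z \<subseteq> proj_space"
  shows "morphism UNIV X W (\<lambda>P. k (h P))"
  unfolding morphism_def
proof (intro conjI ballI)
  have hX: "h P \<in> Z" if "P \<in> X" for P using h that by (auto simp: morphism_def)
  then show "(\<lambda>P. k (h P)) ` X \<subseteq> W" using k by (auto simp: morphism_def)
  fix P assume P: "P \<in> X"
  obtain d e and G :: "'f ^ 'n \<Rightarrow> 'f ^ 'm" and M where
    G: "\<forall>j. (\<lambda>v. G v $ j) \<in> forms UNIV d" and M: "M \<in> forms UNIV e" "\<forall>v\<in>P. M v \<noteq> 0"
    and GM: "\<forall>R\<in>X. \<forall>v\<in>R. M v \<noteq> 0 \<longrightarrow> G v \<in> h R \<and> G v \<noteq> 0 \<and> h R = pt (G v)"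
    by (rule morphism_local[OF h X P])
  obtain d' e' and K :: "'f ^ 'm \<Rightarrow> 'f ^ 'l" and L where
    K: "\<forall>j. (\<lambda>v. K v $ j) \<in> forms UNIV d'" and L: "L \<in> forms UNIV e'" "\<forall>v\<in>h P. L v \<noteq> 0"
    and KL: "\<forall>R\<in>Z. \<forall>v\<in>R. L v \<noteq> 0 \<longrightarrow> K v \<in> k R \<and> K v \<noteq> 0 \<and> k R = pt (K v)"
    by (rule morphism_local[OF k Z hX[OF P]])
  \<comment> \<open>\<open>N\<close> vanishes wherever \<open>G\<close> is not known to represent
    \<open>h\<close> (\<open>M v = 0\<close>) or \<open>K\<close> is not known to represent
    \<open>k\<close> at \<open>G v\<close> (\<open>L (G v) = 0\<close>). Scaling by \<open>N\<close>
    therefore lets \<open>H v \<noteq> 0\<close> alone certify that \<open>H\<close> represents the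
    composite.\<close>
  define N where "N v = (L (G v) * M v) * M v" for v
  define H where "H v = N v *s K (G v)" for v
  have N: "N \<in> forms UNIV ((e' * d + e) + e)"
    unfolding N_def[abs_def] by (rule forms_mult[OF forms_pullback[OF G[rule_format] M(1) L(1)] M(1)])
  have H: "k (h R) = pt (H v)" if "R \<in> X" "v \<in> R" "H v \<noteq> 0" for R v
  proof -
    have nz: "L (G v) \<noteq> 0" "M v \<noteq> 0" "N v \<noteq> 0"
      using that(3) by (auto simp: H_def N_def)
    have "G v \<in> h R" using GM that(1,2) nz(2) by blast
    then have "k (h R) = pt (K (G v))"
      using KL hX[OF that(1)] nz(1) by blast
    also have "\<dots> = pt (H v)" by (simp add: H_def pt_scale[OF nz(3)])
    finally show ?thesis .
  qed
  have Hf: "(\<lambda>v. H v $ j) \<in> forms UNIV (((e' * d + e) + e) + d' * d)" for j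
    using forms_mult[OF N forms_compose[OF K[rule_format, of j] G[rule_format]]] by (simp add: H_def)
  obtain v where v: "v \<in> P" using P X proj_space_nonempty by blast
  have Gv: "G v \<in> h P" using GM P v M(2) by blast
  have "H v \<noteq> 0"
    using KL hX[OF P] Gv L(2) M(2) v by (simp add: H_def N_def)
  show "\<exists>d G. (\<forall>j. (\<lambda>v. G v $ j) \<in> forms UNIV d) \<and> (\<exists>v\<in>P. G v \<noteq> 0) \<and>
      (\<forall>R\<in>X. \<forall>v\<in>R. G v \<noteq> 0 \<longrightarrow> k (h R) = pt (G v))"
  proof (intro exI conjI allI ballI impI)
    show "\<exists>v\<in>P. H v \<noteq> 0" using v \<open>H v \<noteq> 0\<close> ..
  qed (rule Hf, rule H)
qed

text \<open>Turns the group law into translations. The fixed point \<open>Q\<close> need not be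
  rational over \<open>S\<close>, so the result is a morphism over \<open>UNIV\<close> only.\<close>

lemma morphism2_fix_right:
  fixes X :: "('f::field ^ 'n::finite) set set" and Y :: "('f ^ 'm::finite) set set"
  assumes "morphism2 S X Y Z h" "Q \<in> Y"
  shows "morphism UNIV X Z (\<lambda>P. h P Q)"
  unfolding morphism_def
proof (intro conjI ballI)
  have "\<forall>P\<in>X. \<forall>Q\<in>Y. h P Q \<in> Z"
    using assms(1) unfolding morphism2_def by (rule conjunct1)
  then show "(\<lambda>P. h P Q) ` X \<subseteq> Z" using assms(2) by blast
  fix P assume P: "P \<in> X"
  obtain d e G where *: "\<forall>j. (\<lambda>v w. G v w $ j) \<in> biforms S d e" "\<exists>v\<in>P. \<exists>w\<in>Q. G v w \<noteq> 0"
    "\<forall>R\<in>X. \<forall>T\<in>Y. \<forall>v\<in>R. \<forall>w\<in>T. G v w \<noteq> 0 \<longrightarrow> h R T = pt (G v w)"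
    using assms(1)[unfolded morphism2_def, THEN conjunct2, THEN bspec, OF P, THEN bspec, OF assms(2)]
    by (elim exE conjE)
  obtain w where w: "w \<in> Q" "\<exists>v\<in>P. G v w \<noteq> 0" using *(2) by blast
  have forms: "(\<lambda>v. G v w $ j) \<in> forms UNIV d" for j
    using biforms_fix_right[OF *(1)[rule_format]] .
  have hR: "h R Q = pt (G v w)" if "R \<in> X" "v \<in> R" "G v w \<noteq> 0" for R v
    using *(3) assms(2) w(1) that by blast
  show "\<exists>d G. (\<forall>j. (\<lambda>v. G v $ j) \<in> forms UNIV d) \<and> (\<exists>v\<in>P. G v \<noteq> 0) \<and>
      (\<forall>R\<in>X. \<forall>v\<in>R. G v \<noteq> 0 \<longrightarrow> h R Q = pt (G v))"
  proof (intro exI conjI allI ballI impI)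
    show "\<exists>v\<in>P. G v w \<noteq> 0" by (rule w(2))
  qed (rule forms, rule hR)
qed

section \<open>Pullback of fractions, local rings and closed sets along a morphism\<close>

lemma quotient_homogeneous:
  assumes "A \<in> forms UNIV d" "B \<in> forms UNIV d" "v \<in> pt u"
  shows "A v / B v = A u / B u"
proof -
  obtain r where "r \<noteq> 0" "v = r *s u" using assms(3) unfolding pt_def by blast
  then show ?thesis
    by (simp add: forms_homogeneous[OF assms(1)] forms_homogeneous[OF assms(2)])
qed

lemma form_zero_iff_pt:
  assumes "A \<in> forms UNIV d" "v \<in> pt u"
  shows "A v = 0 \<longleftrightarrow> A u = 0"
proof -
  obtain r where "r \<noteq> 0" "v = r *s u" using assms(2) unfolding pt_def by blast
  then show ?thesis
    by (simp add: forms_homogeneous[OF assms(1)])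
qed

text \<open>Substitutes into \<open>A\<close> and \<open>B\<close> a representative of
  \<open>h\<close> near a point of \<open>Y\<close> where \<open>B\<close> is nonzero on the image.
  Multiplying both by \<open>M\<close> makes \<open>B' v \<noteq> 0\<close> certify that the
  representative is valid. The conditional clause on \<open>A\<close> lets one statement serve both
  the local ring and its maximal ideal.\<close>

lemma (in subvariety) pullback_fraction:
  fixes Z :: "('f ^ 'm::finite) set set"
  assumes h: "morphism S X Z h"
    and A: "A \<in> forms UNIV d" and B: "B \<in> forms UNIV d" and "\<not> vanishes_on B (h ` Y)"
  obtains e A' B' where "A' \<in> forms UNIV e" "B' \<in> forms UNIV e" "\<not> vanishes_on B' Y"
    "vanishes_on A (h ` Y) \<longrightarrow> vanishes_on A' Y"
    "eventually (\<lambda>P. \<forall>v\<in>P. \<forall>w\<in>h P. B w \<noteq> 0 \<and> A w / B w = A' v / B' v) (generic X)"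
proof -
  obtain P w where P: "P \<in> Y" "w \<in> h P" "B w \<noteq> 0"
    using assms(4) unfolding vanishes_on_def by blast
  have "P \<in> X" using P(1) subset by blast
  obtain G :: "'f ^ 'n \<Rightarrow> 'f ^ 'm" and d' M e where
    G: "\<forall>j. (\<lambda>v. G v $ j) \<in> forms UNIV d'" and M: "M \<in> forms UNIV e" "\<forall>v\<in>P. M v \<noteq> 0"
    and GM: "\<forall>R\<in>X. \<forall>v\<in>R. M v \<noteq> 0 \<longrightarrow> G v \<in> h R \<and> G v \<noteq> 0 \<and> h R = pt (G v)"
    by (rule morphism_local[OF h subset_proj_space \<open>P \<in> X\<close>])
  define A' where "A' v = A (G v) * M v" for v
  define B' where "B' v = B (G v) * M v" for v
  have A': "A' \<in> forms UNIV (d * d' + e)" and B': "B' \<in> forms UNIV (d * d' + e)"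
    unfolding A'_def[abs_def] B'_def[abs_def]
    by (rule forms_pullback[OF G[rule_format] M(1) A] forms_pullback[OF G[rule_format] M(1) B])+
  have B'Y: "\<not> vanishes_on B' Y"
  proof -
    obtain v where v: "v \<in> P" using point_in_proj_space[OF \<open>P \<in> X\<close>] proj_space_nonempty by blast
    then have "M v \<noteq> 0" using M(2) by blast
    moreover have "w \<in> pt (G v)" using GM v \<open>P \<in> X\<close> \<open>M v \<noteq> 0\<close> P(2) by blast
    then have "B (G v) \<noteq> 0" using form_zero_iff_pt[OF B] P(3) by blast
    ultimately have "B' v \<noteq> 0" by (simp add: B'_def)
    then show ?thesis using v P(1) unfolding vanishes_on_def by blast
  qed
  have A'Y: "vanishes_on A (h ` Y) \<longrightarrow> vanishes_on A' Y"
  proof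
    assume *: "vanishes_on A (h ` Y)"
    show "vanishes_on A' Y"
      unfolding vanishes_on_def
    proof (intro ballI)
      fix R v assume R: "R \<in> Y" "v \<in> R"
      show "A' v = 0"
      proof (cases "M v = 0")
        case False
        then have "G v \<in> h R" using GM R subset by blast
        then have "A (G v) = 0" using * R(1) unfolding vanishes_on_def by blast
        then show ?thesis by (simp add: A'_def)
      qed (simp add: A'_def)
    qed
  qed
  have "eventually (\<lambda>P. \<forall>v\<in>P. \<forall>w\<in>h P. B w \<noteq> 0 \<and> A w / B w = A' v / B' v) (generic X)"
    using eventually_nonzero[OF B' not_vanishes_on_superset[OF B'Y]]
  proof eventually_elim
    case (elim R)
    show ?case
    proof (intro ballI)
      fix v w assume v: "v \<in> R" and w: "w \<in> h R"
      have "B' v \<noteq> 0" using elim v by blast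
      then have nz: "M v \<noteq> 0" "B (G v) \<noteq> 0" by (auto simp: B'_def)
      then have w': "w \<in> pt (G v)" using GM elim v w by blast
      then have "B w \<noteq> 0" using form_zero_iff_pt[OF B] nz by blast
      moreover have "A w / B w = A' v / B' v"
        using quotient_homogeneous[OF A B w'] nz by (simp add: A'_def B'_def)
      ultimately show "B w \<noteq> 0 \<and> A w / B w = A' v / B' v" ..
    qed
  qed
  from that[OF A' B' B'Y A'Y this] show ?thesis .
qed

lemma (in variety) morphism_image_in_proj_space:
  fixes Z :: "('f ^ 'm::finite) set set"
  assumes h: "morphism S X Z h" and "Z \<subseteq> proj_space" and "P \<in> X"
  shows "h P \<in> proj_space"
  using assms unfolding morphism_def by blast

lemma (in subvariety) pullback_eq:
  fixes Z :: "('f ^ 'm::finite) set set"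
  assumes h: "morphism S X Z h" and Z: "Z \<subseteq> proj_space"
    and A: "A \<in> forms UNIV d" and B: "B \<in> forms UNIV d"
    and *: "eventually (\<lambda>P. \<forall>v\<in>P. \<forall>w\<in>h P. B w \<noteq> 0 \<and> A w / B w = A' v / B' v) (generic X)"
  shows "eventually (\<lambda>P. \<forall>v\<in>P. quotient_fun A B (h P) = A' v / B' v) (generic X)"
  using * eventually_in
proof eventually_elim
  case (elim P)
  then have "h P \<in> proj_space" using morphism_image_in_proj_space[OF h Z] by blast
  moreover from this obtain w where "w \<in> h P" using proj_space_nonempty by blast
  ultimately show ?case using elim quotient_fun_eq[OF A B] by simp
qed

lemma (in subvariety) local_ring_pullback:
  fixes Z :: "('f ^ 'm::finite) set set"
  assumes h: "morphism S X Z h" and Z: "Z \<subseteq> proj_space"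
    and A: "A \<in> forms UNIV d" and B: "B \<in> forms UNIV d" and nz: "\<not> vanishes_on B (h ` Y)"
  shows "(\<lambda>P. quotient_fun A B (h P)) \<in> local_ring X Y"
proof -
  obtain e A' B' where *: "A' \<in> forms UNIV e" "B' \<in> forms UNIV e" "\<not> vanishes_on B' Y"
    "eventually (\<lambda>P. \<forall>v\<in>P. \<forall>w\<in>h P. B w \<noteq> 0 \<and> A w / B w = A' v / B' v) (generic X)"
    using pullback_fraction[OF h A B nz] by blast
  from local_ringI[OF *(1-3) pullback_eq[OF h Z A B *(4)]] show ?thesis .
qed

lemma (in subvariety) local_max_ideal_pullback:
  fixes Z :: "('f ^ 'm::finite) set set"
  assumes h: "morphism S X Z h" and Z: "Z \<subseteq> proj_space"
    and A: "A \<in> forms UNIV d" and B: "B \<in> forms UNIV d" and nz: "\<not> vanishes_on B (h ` Y)"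
    and v: "vanishes_on A (h ` Y)"
  shows "(\<lambda>P. quotient_fun A B (h P)) \<in> local_max_ideal X Y"
proof -
  obtain e A' B' where *: "A' \<in> forms UNIV e" "B' \<in> forms UNIV e" "vanishes_on A' Y"
    "\<not> vanishes_on B' Y"
    "eventually (\<lambda>P. \<forall>v\<in>P. \<forall>w\<in>h P. B w \<noteq> 0 \<and> A w / B w = A' v / B' v) (generic X)"
    using pullback_fraction[OF h A B nz] v by blast
  from local_max_idealI[OF *(1-4) pullback_eq[OF h Z A B *(5)]] show ?thesis .
qed

lemma (in subvariety) eventually_pullback_nonzero:
  fixes Z :: "('f ^ 'm::finite) set set"
  assumes h: "morphism S X Z h"
    and B: "B \<in> forms UNIV d" and nz: "\<not> vanishes_on B (h ` Y)"
  shows "eventually (\<lambda>P. P \<in> X \<and> (\<forall>w\<in>h P. B w \<noteq> 0)) (generic X)"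
proof -
  obtain e A' B' where
    "eventually (\<lambda>P. \<forall>v\<in>P. \<forall>w\<in>h P. B w \<noteq> 0 \<and> B w / B w = A' v / B' v) (generic X)"
    \<comment> \<open>Only the clause \<open>B w \<noteq> 0\<close> is wanted, so \<open>B\<close>
      also serves as numerator.\<close>
    using pullback_fraction[OF h B B nz] by blast
  with eventually_in show ?thesis
  proof eventually_elim
    case (elim P)
    then show ?case using proj_space_nonempty[OF point_in_proj_space] by blast
  qed
qed

lemma (in subvariety) local_units_pullback:
  fixes Z :: "('f ^ 'm::finite) set set"
  assumes h: "morphism S X Z h" and Z: "Z \<subseteq> proj_space"
    and A: "A \<in> forms UNIV d" and B: "B \<in> forms UNIV d"
    and nz: "\<not> vanishes_on A (h ` Y)" "\<not> vanishes_on B (h ` Y)"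
  shows "(\<lambda>P. quotient_fun A B (h P)) \<in> local_units X Y"
proof (rule local_unitsI_inverse[OF local_ring_pullback[OF h Z A B nz(2)] local_ring_pullback[OF h Z B A nz(1)]])
  show "eventually (\<lambda>P. quotient_fun B A (h P) * quotient_fun A B (h P) = 1) (generic X)"
    using eventually_pullback_nonzero[OF h A nz(1)] eventually_pullback_nonzero[OF h B nz(2)]
  proof eventually_elim
    case (elim P)
    then have hP: "h P \<in> proj_space" using morphism_image_in_proj_space[OF h Z] by blast
    then obtain w where "w \<in> h P" using proj_space_nonempty by blast
    with elim show ?case using quotient_fun_eq[OF A B hP] quotient_fun_eq[OF B A hP] by simp
  qed
qed

text \<open>The set of all forms vanishing on \<open>W\<close> serves as the set of
  equations.\<close>

lemma zariski_closedI:
  fixes W :: "('f::field ^ 'n::finite) set set"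
  assumes "W \<subseteq> proj_space"
    and "\<And>P. P \<in> proj_space \<Longrightarrow> P \<notin> W \<Longrightarrow>
      \<exists>d. \<exists>F\<in>forms UNIV d. vanishes_on F W \<and> \<not> vanishes_on F {P}"
  shows "zariski_closed UNIV W"
proof -
  let ?A = "{F :: 'f ^ 'n \<Rightarrow> 'f. (\<exists>d. F \<in> forms UNIV d) \<and> vanishes_on F W}"
  have "W = {P \<in> proj_space. \<forall>F\<in>?A. vanishes_on F {P}}" (is "_ = ?R")
  proof
    show "W \<subseteq> ?R" using assms(1) by (auto simp: vanishes_on_def)
    show "?R \<subseteq> W"
    proof
      fix P assume "P \<in> ?R"
      then show "P \<in> W" using assms(2)[of P] by blast
    qed
  qed
  moreover have "?A \<subseteq> (\<Union>d. forms UNIV d)" by blast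
  ultimately show ?thesis unfolding zariski_closed_def by blast
qed

text \<open>A form \<open>F\<close> separating \<open>h P\<close> from \<open>C\<close> pulls back
  to \<open>F (G v) * M v\<close>. Where \<open>M\<close> is nonzero, \<open>G\<close> represents
  \<open>h\<close>; where \<open>M\<close> is zero, the product vanishes anyway. So the product
  vanishes on the whole preimage but not at \<open>P\<close>.\<close>

lemma (in variety) zariski_closed_vimage:
  fixes Z :: "('f ^ 'm::finite) set set"
  assumes h: "morphism S X Z h" and Z: "Z \<subseteq> proj_space" and C: "zariski_closed T C"
  shows "zariski_closed UNIV {P \<in> X. h P \<in> C}"
proof (rule zariski_closedI)
  show "{P \<in> X. h P \<in> C} \<subseteq> proj_space" using subset_proj_space by blast
  fix P :: "('f ^ 'n) set" assume P: "P \<in> proj_space" "P \<notin> {P \<in> X. h P \<in> C}"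
  show "\<exists>d. \<exists>F\<in>forms UNIV d. vanishes_on F {P \<in> X. h P \<in> C} \<and> \<not> vanishes_on F {P}"
  proof (cases "P \<in> X")
    case False
    obtain d F where "F \<in> forms UNIV d" "vanishes_on F X" "\<not> vanishes_on F {P}"
      by (rule zariski_closedE[OF closed P(1) False])
    then show ?thesis unfolding vanishes_on_def by blast
  next
    case True
    then have hP: "h P \<in> proj_space" "h P \<notin> C"
      using morphism_image_in_proj_space[OF h Z] P by auto
    obtain a F where F: "F \<in> forms UNIV a" "vanishes_on F C" "\<not> vanishes_on F {h P}"
      by (rule zariski_closedE[OF C hP])
    obtain G :: "'f ^ 'n \<Rightarrow> 'f ^ 'm" and d' M e where
      G: "\<forall>j. (\<lambda>v. G v $ j) \<in> forms UNIV d'" and M: "M \<in> forms UNIV e" "\<forall>v\<in>P. M v \<noteq> 0"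
      and GM: "\<forall>R\<in>X. \<forall>v\<in>R. M v \<noteq> 0 \<longrightarrow> G v \<in> h R \<and> G v \<noteq> 0 \<and> h R = pt (G v)"
      by (rule morphism_local[OF h subset_proj_space True])
    define H where "H v = F (G v) * M v" for v
    have H: "H \<in> forms UNIV (a * d' + e)"
      unfolding H_def[abs_def] by (rule forms_pullback[OF G[rule_format] M(1) F(1)])
    have "vanishes_on H {P \<in> X. h P \<in> C}"
      unfolding vanishes_on_def
    proof (intro ballI)
      fix R v assume R: "R \<in> {P \<in> X. h P \<in> C}" "v \<in> R"
      show "H v = 0"
      proof (cases "M v = 0")
        case False
        then have "G v \<in> h R" using GM R by blast
        then have "F (G v) = 0" using F(2) R(1) unfolding vanishes_on_def by blast
        then show ?thesis by (simp add: H_def)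
      qed (simp add: H_def)
    qed
    moreover obtain v where v: "v \<in> P" using proj_space_nonempty[OF P(1)] by blast
    then have "G v \<in> h P" using GM M(2) True by blast
    then have "H v \<noteq> 0" using vanishes_at_iff[OF F(1) hP(1)] F(3) M(2) v by (simp add: H_def)
    then have "\<not> vanishes_on H {P}" using v unfolding vanishes_on_def by blast
    ultimately show ?thesis using H by blast
  qed
qed

section \<open>Transport along isomorphisms\<close>

text \<open>The inverse \<open>k\<close> is carried as data with a morphism property of its own, so
  that the situation is symmetric: every result also applies to \<open>k\<close> through
  \<open>inverse\<close>.\<close>

locale variety_iso = X: variety X + Z: variety Z
  for X :: "('f::field ^ 'n::finite) set set" and Z :: "('f ^ 'm::finite) set set" +
  fixes h :: "('f ^ 'n) set \<Rightarrow> ('f ^ 'm) set" and k :: "('f ^ 'm) set \<Rightarrow> ('f ^ 'n) set"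
  assumes h: "morphism UNIV X Z h" and k: "morphism UNIV Z X k"
    and kh: "\<And>P. P \<in> X \<Longrightarrow> k (h P) = P" and hk: "\<And>R. R \<in> Z \<Longrightarrow> h (k R) = R"
begin

lemma inverse: "variety_iso Z X k h"
  by unfold_locales (simp_all add: h k kh hk)

lemma h_in: "P \<in> X \<Longrightarrow> h P \<in> Z"
  using h unfolding morphism_def by blast

lemma k_in: "R \<in> Z \<Longrightarrow> k R \<in> X"
  using k unfolding morphism_def by blast

lemma image_X: "h ` X = Z"
proof
  show "h ` X \<subseteq> Z" using h_in by blast
  show "Z \<subseteq> h ` X"
  proof
    fix R assume "R \<in> Z"
    then show "R \<in> h ` X" using hk k_in by (intro image_eqI[of _ _ "k R"]) simp_all
  qed
qed

text \<open>Images under \<open>h\<close> are preimages under \<open>k\<close>, and preimages are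
  the sets already known to be closed.\<close>

lemma image_eq_vimage: "Y \<subseteq> X \<Longrightarrow> h ` Y = {R \<in> Z. k R \<in> Y}"
proof (intro equalityI subsetI)
  fix R assume "Y \<subseteq> X" "R \<in> h ` Y"
  then obtain P where "P \<in> Y" "P \<in> X" "R = h P" by blast
  then show "R \<in> {R \<in> Z. k R \<in> Y}" using kh h_in by simp
next
  fix R assume "R \<in> {R \<in> Z. k R \<in> Y}"
  then show "R \<in> h ` Y" using hk by (intro image_eqI[of _ _ "k R"]) simp_all
qed

lemma image_h_image_k: "Y \<subseteq> X \<Longrightarrow> k ` h ` Y = Y"
  using kh by (force simp: subset_iff image_iff)

lemma proj_variety_image:
  assumes Y: "proj_variety UNIV Y" "Y \<subseteq> X"
  shows "proj_variety UNIV (h ` Y)"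
proof -
  have closed: "zariski_closed UNIV (h ` Y)"
    unfolding image_eq_vimage[OF Y(2)]
    by (rule Z.zariski_closed_vimage[OF k X.subset_proj_space, where T = UNIV])
       (use Y(1) in \<open>simp add: proj_variety_def\<close>)
  have irr: "irreducible_set Y" using Y(1) by (simp add: proj_variety_def)
  have "irreducible_set (h ` Y)"
    unfolding irreducible_set_def
  proof (intro conjI allI impI)
    show "h ` Y \<noteq> {}" using irr by (simp add: irreducible_set_def)
    fix A B :: "('f ^ 'm) set set"
    assume A: "zariski_closed UNIV A" and B: "zariski_closed UNIV B" and sub: "h ` Y \<subseteq> A \<union> B"
    have "Y \<subseteq> {P \<in> X. h P \<in> A} \<or> Y \<subseteq> {P \<in> X. h P \<in> B}"
    proof (rule irreducible_setD[OF irr])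
      show "zariski_closed UNIV {P \<in> X. h P \<in> A}" "zariski_closed UNIV {P \<in> X. h P \<in> B}"
        by (rule X.zariski_closed_vimage[OF h Z.subset_proj_space], fact)+
      show "Y \<subseteq> {P \<in> X. h P \<in> A} \<union> {P \<in> X. h P \<in> B}"
        using sub Y(2) by blast
    qed
    then show "h ` Y \<subseteq> A \<or> h ` Y \<subseteq> B" by blast
  qed
  with closed show ?thesis by (simp add: proj_variety_def)
qed

lemma image_strict:
  assumes "Y \<subset> X"
  shows "h ` Y \<subset> Z"
proof -
  obtain P where P: "P \<in> X" "P \<notin> Y" using assms by blast
  have "h P \<notin> h ` Y"
    using P assms kh by (metis image_iff psubsetD)
  then show ?thesis using P h_in assms by blast
qed

end

lemma (in variety_iso) prime_divisor_image:
  assumes Y: "prime_divisor X Y"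
  shows "prime_divisor Z (h ` Y)"
  unfolding prime_divisor_def
proof (intro conjI allI impI)
  interpret inv: variety_iso Z X k h by (rule inverse)
  have Y': "proj_variety UNIV Y" "Y \<subset> X" using Y by (auto simp: prime_divisor_def)
  then show "proj_variety UNIV (h ` Y)" "h ` Y \<subset> Z"
    using proj_variety_image image_strict by auto
  fix W assume W: "proj_variety UNIV W" "h ` Y \<subseteq> W" "W \<subset> Z"
  have "Y \<subseteq> k ` W" using image_h_image_k[of Y] W(2) Y'(2) by blast
  moreover have "proj_variety UNIV (k ` W)" "k ` W \<subset> X"
    using inv.proj_variety_image inv.image_strict W by auto
  ultimately have "k ` W = Y" using Y unfolding prime_divisor_def by blast
  then show "W = h ` Y" using inv.image_h_image_k[of W] W(3) by blast
qed

locale prime_div_iso = variety_iso X Z h k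
  for X :: "('f::field ^ 'n::finite) set set" and Z :: "('f ^ 'm::finite) set set" and h k +
  fixes Y :: "('f ^ 'n) set set"
  assumes Y: "prime_divisor X Y"
begin

sublocale Y: prime_div X Y
  using Y by unfold_locales (auto simp: prime_divisor_def)

sublocale hY: prime_div Z "h ` Y"
  using prime_divisor_image[OF Y] by unfold_locales (auto simp: prime_divisor_def)

text \<open>The preimage of a nonempty open set is open, and it is nonempty because \<open>h\<close>
  is surjective.\<close>

lemma eventually_pullback:
  assumes "eventually p (generic Z)"
  shows "eventually (\<lambda>P. p (h P)) (generic X)"
proof -
  obtain d B where B: "B \<in> forms UNIV d" "\<not> vanishes_on B Z" "\<forall>P\<in>Z. \<not> vanishes_on B {P} \<longrightarrow> p P"
    using assms unfolding Z.eventually_generic_iff by blast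
  have "eventually (\<lambda>P. P \<in> X \<and> (\<forall>w\<in>h P. B w \<noteq> 0)) (generic X)"
    using X.self.eventually_pullback_nonzero[OF h B(1)] B(2) image_X by simp
  then show ?thesis
  proof eventually_elim
    case (elim P)
    then have "h P \<in> Z" using h_in by blast
    moreover from this obtain w where "w \<in> h P"
      using Z.point_in_proj_space proj_space_nonempty by blast
    then have "\<not> vanishes_on B {h P}" using elim unfolding vanishes_on_def by blast
    ultimately show ?case using B(3) by blast
  qed
qed

lemma local_ring_transport:
  assumes "g \<in> local_ring Z (h ` Y)"
  shows "(\<lambda>P. g (h P)) \<in> local_ring X Y"
proof -
  obtain d A B where *: "A \<in> forms UNIV d" "B \<in> forms UNIV d" "\<not> vanishes_on B (h ` Y)"
    "generically_eq Z g (quotient_fun A B)"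
    using assms unfolding local_ring_def by blast
  obtain e A' B' where **: "A' \<in> forms UNIV e" "B' \<in> forms UNIV e" "\<not> vanishes_on B' Y"
    "generically_eq X (\<lambda>P. quotient_fun A B (h P)) (quotient_fun A' B')"
    using Y.local_ring_pullback[OF h Z.subset_proj_space *(1-3)] unfolding local_ring_def by blast
  have "eventually (\<lambda>P. g (h P) = quotient_fun A' B' P) (generic X)"
    using eventually_pullback[OF *(4)[unfolded Z.generically_eq_iff]] **(4)[unfolded X.generically_eq_iff]
    by eventually_elim simp
  with ** show ?thesis unfolding local_ring_def X.generically_eq_iff by blast
qed

lemma local_max_ideal_transport:
  assumes "g \<in> local_max_ideal Z (h ` Y)"
  shows "(\<lambda>P. g (h P)) \<in> local_max_ideal X Y"
proof -
  obtain d A B where *: "A \<in> forms UNIV d" "B \<in> forms UNIV d" "\<not> vanishes_on B (h ` Y)"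
    "vanishes_on A (h ` Y)" "generically_eq Z g (quotient_fun A B)"
    using assms unfolding local_max_ideal_def by blast
  have "eventually (\<lambda>P. quotient_fun A B (h P) = g (h P)) (generic X)"
    using eventually_pullback[OF *(5)[unfolded Z.generically_eq_iff]]
    by eventually_elim simp
  then show ?thesis
    by (rule Y.local_max_ideal_cong)
       (rule Y.local_max_ideal_pullback[OF h Z.subset_proj_space *(1-4)])
qed

lemma local_units_transport:
  assumes "g \<in> local_units Z (h ` Y)"
  shows "(\<lambda>P. g (h P)) \<in> local_units X Y"
proof (rule Y.local_unitsI_inverse)
  show "(\<lambda>P. g (h P)) \<in> local_ring X Y"
    using assms hY.local_units_subset_local_ring by (intro local_ring_transport) blast
  show "(\<lambda>P. inverse (g (h P))) \<in> local_ring X Y"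
    using hY.local_units_inverse[OF assms] hY.local_units_subset_local_ring
    by (intro local_ring_transport[of "\<lambda>R. inverse (g R)"]) blast
  show "eventually (\<lambda>P. inverse (g (h P)) * g (h P) = 1) (generic X)"
    using eventually_pullback[OF hY.local_units_nonzero[OF assms]] by eventually_elim simp
qed

lemma inverse_prime_div: "prime_div_iso Z X k h (h ` Y)"
  using inverse prime_divisor_image[OF Y] by (simp add: prime_div_iso_def prime_div_iso_axioms_def)

text \<open>To divide \<open>s\<close> by the pulled back uniformizer, move \<open>s\<close> to
  \<open>Z\<close> by \<open>k\<close>, divide there, and return by \<open>h\<close>.\<close>

lemma uniformizer_transport:
  assumes t: "uniformizer Z (h ` Y) t"
  shows "uniformizer X Y (\<lambda>P. t (h P))"
  unfolding uniformizer_def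
proof (intro conjI ballI)
  interpret inv: prime_div_iso Z X k h "h ` Y" by (rule inverse_prime_div)
  have kY: "k ` h ` Y = Y" using image_h_image_k Y.subset by blast
  show "(\<lambda>P. t (h P)) \<in> local_max_ideal X Y"
    using t by (intro local_max_ideal_transport) (simp add: uniformizer_def)
  fix s assume "s \<in> local_max_ideal X Y"
  then have "(\<lambda>R. s (k R)) \<in> local_max_ideal Z (h ` Y)"
    using inv.local_max_ideal_transport[of s] by (simp add: kY)
  then obtain r where r: "r \<in> local_ring Z (h ` Y)"
    "generically_eq Z (\<lambda>R. s (k R)) (\<lambda>R. r R * t R)"
    using t unfolding uniformizer_def by blast
  have "eventually (\<lambda>P. s (k (h P)) = r (h P) * t (h P)) (generic X)"
    using eventually_pullback[OF r(2)[unfolded Z.generically_eq_iff]] .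
  with X.eventually_in have "eventually (\<lambda>P. s P = r (h P) * t (h P)) (generic X)"
    by eventually_elim (simp add: kh)
  then show "\<exists>r\<in>local_ring X Y. generically_eq X s (\<lambda>P. r P * t (h P))"
    unfolding X.generically_eq_iff
    by (intro bexI[of _ "\<lambda>P. r (h P)"] local_ring_transport r(1))
qed

lemma has_order_transport:
  assumes "has_order Z (h ` Y) g n"
  shows "has_order X Y (\<lambda>P. g (h P)) n"
proof -
  obtain t where t: "uniformizer Z (h ` Y) t"
    using assms by (auto simp: has_order_def)
  obtain u where u: "u \<in> local_units Z (h ` Y)" "eventually (\<lambda>P. g P = u P * t P powi n) (generic Z)"
    using assms hY.has_order_iff[OF t] by blast
  show ?thesis
    by (rule Y.has_orderI[OF uniformizer_transport[OF t] local_units_transport[OF u(1)]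
          eventually_pullback[OF u(2)]])
qed

end

text \<open>Regularity is a clause of \<open>abelian_variety\<close> but not of
  \<open>two_covering\<close>; the coverings obtain it from the Jacobian through this lemma.\<close>

lemma (in variety_iso) regular_transport:
  assumes reg: "regular_in_codim_one Z"
  shows "regular_in_codim_one X"
  unfolding regular_in_codim_one_def
proof (intro allI impI)
  fix Y g
  assume Y: "prime_divisor X Y" and g: "g \<in> rational_functions X" "\<not> generically_eq X g (\<lambda>P. 0)"
  interpret Y: prime_div_iso X Z h k Y by unfold_locales (rule Y)
  interpret inv: prime_div_iso Z X k h "h ` Y" by (rule Y.inverse_prime_div)
  obtain d A B where *: "A \<in> forms UNIV d" "B \<in> forms UNIV d" "\<not> vanishes_on B X"
    "generically_eq X g (quotient_fun A B)"
    using g(1) unfolding rational_functions_def by blast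
  have kZ: "k ` Z = X" using inv.image_X .
  have pull: "eventually (\<lambda>R. g (k R) = quotient_fun A B (k R)) (generic Z)"
    using inv.eventually_pullback[OF *(4)[unfolded X.generically_eq_iff]] .
  \<comment> \<open>A rational function on \<open>Z\<close> is an element of its local ring along
    \<open>Z\<close> itself, so pullback of local rings applies.\<close>
  have "(\<lambda>R. quotient_fun A B (k R)) \<in> local_ring Z Z"
    by (rule Z.self.local_ring_pullback[OF k X.subset_proj_space *(1,2)]) (simp add: kZ *(3))
  then obtain e A' B' where **: "A' \<in> forms UNIV e" "B' \<in> forms UNIV e" "\<not> vanishes_on B' Z"
    "eventually (\<lambda>R. quotient_fun A B (k R) = quotient_fun A' B' R) (generic Z)"
    unfolding local_ring_def Z.generically_eq_iff by blast
  have "eventually (\<lambda>R. g (k R) = quotient_fun A' B' R) (generic Z)"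
    using pull **(4) by eventually_elim simp
  then have "(\<lambda>R. g (k R)) \<in> rational_functions Z"
    using ** unfolding rational_functions_def Z.generically_eq_iff by blast
  moreover have "\<not> generically_eq Z (\<lambda>R. g (k R)) (\<lambda>R. 0)"
  proof
    assume "generically_eq Z (\<lambda>R. g (k R)) (\<lambda>R. 0)"
    then have "eventually (\<lambda>P. g (k (h P)) = 0) (generic X)"
      using Y.eventually_pullback unfolding Z.generically_eq_iff by blast
    with X.eventually_in have "eventually (\<lambda>P. g P = 0) (generic X)"
      by eventually_elim (simp add: kh)
    with g(2) show False unfolding X.generically_eq_iff by simp
  qed
  ultimately obtain n where "has_order Z (h ` Y) (\<lambda>R. g (k R)) n"
    using reg prime_divisor_image[OF Y] unfolding regular_in_codim_one_def by blast
  then have *: "has_order X Y (\<lambda>P. g (k (h P))) n"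
    by (rule Y.has_order_transport)
  have "eventually (\<lambda>P. g (k (h P)) = g P) (generic X)"
    using X.eventually_in by eventually_elim (simp add: kh)
  from Y.Y.has_order_cong[OF this *] show "\<exists>n. has_order X Y g n" ..
qed

section \<open>Pullbacks of hyperplane sections\<close>

definition hyperplane_quotient ::
  "'f::field ^ 'm::finite \<Rightarrow> 'f ^ 'm \<Rightarrow> (('f ^ 'n) set \<Rightarrow> ('f ^ 'm) set) \<Rightarrow> ('f ^ 'n) set \<Rightarrow> 'f" where
  "hyperplane_quotient c m h = (\<lambda>P. quotient_fun (linear_form c) (linear_form m) (h P))"

lemma linear_form_axis: "linear_form (axis i 1) v = v $ i"
  by (simp add: linear_form_def axis_def if_distrib[of "\<lambda>x. x * _"] cong: if_cong)

text \<open>Take coordinates nonzero at \<open>v\<close> and at \<open>w\<close> respectively. If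
  neither is nonzero at both vectors, their sum is.\<close>

lemma exists_linear_form_nonzero2:
  fixes v w :: "'f::field ^ 'm::finite"
  assumes "v \<noteq> 0" "w \<noteq> 0"
  shows "\<exists>m. linear_form m v \<noteq> 0 \<and> linear_form m w \<noteq> 0"
proof -
  have add: "linear_form (a + b) u = linear_form a u + linear_form b u" for a b u :: "'f ^ 'm"
    by (simp add: linear_form_def sum.distrib distrib_right)
  obtain i j where "v $ i \<noteq> 0" "w $ j \<noteq> 0"
    using assms by (auto simp: Finite_Cartesian_Product.vec_eq_iff)
  then have "(linear_form (axis i 1) v \<noteq> 0 \<and> linear_form (axis i 1) w \<noteq> 0) \<or>
    (linear_form (axis j 1) v \<noteq> 0 \<and> linear_form (axis j 1) w \<noteq> 0) \<or>
    (linear_form (axis i 1 + axis j 1) v \<noteq> 0 \<and> linear_form (axis i 1 + axis j 1) w \<noteq> 0)"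
    by (auto simp: linear_form_axis add)
  then show ?thesis by blast
qed

lemma (in variety) morphism_point:
  fixes h :: "('f ^ 'n) set \<Rightarrow> ('f ^ 'm::finite) set"
  assumes "morphism S X proj_space h" "P \<in> X"
  obtains v where "v \<in> h P" "v \<noteq> 0" "h P = pt v" "h P \<in> proj_space"
proof -
  have hP: "h P \<in> proj_space" using assms unfolding morphism_def by blast
  then obtain v where v: "v \<in> h P" using proj_space_nonempty by blast
  show ?thesis by (rule that[OF v proj_spaceE(2)[OF hP v] proj_spaceE(1)[OF hP v] hP])
qed

lemma (in subvariety) hyperplane_quotient_unit:
  fixes h :: "('f ^ 'n) set \<Rightarrow> ('f ^ 'm::finite) set"
  assumes "morphism S X proj_space h"
    and "\<not> vanishes_on (linear_form c) (h ` Y)" "\<not> vanishes_on (linear_form m) (h ` Y)"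
  shows "hyperplane_quotient c m h \<in> local_units X Y"
  unfolding hyperplane_quotient_def
  by (rule local_units_pullback[OF assms(1) _ linear_form_in_forms linear_form_in_forms assms(2,3)]) simp

text \<open>Resolves the definite description in \<open>hyperplane_pullback\<close>. The assumption
  on \<open>c\<close> makes \<open>c / m\<close> a nonzero rational function, so that it has an
  order.\<close>

lemma (in regular_variety) hyperplane_pullback_order:
  fixes h :: "('f ^ 'n) set \<Rightarrow> ('f ^ 'm::finite) set"
  assumes h: "morphism S X proj_space h" and Y: "prime_divisor X Y"
    and c: "\<not> vanishes_on (linear_form c) (h ` X)"
    and m: "\<not> vanishes_on (linear_form m) (h ` Y)"
  shows "has_order X Y (hyperplane_quotient c m h) (hyperplane_pullback X h c Y)"
proof -
  interpret prime_div X Y using Y by unfold_locales (auto simp: prime_divisor_def)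
  have ord: "has_order X Y (hyperplane_quotient c m h) (order_along X Y (hyperplane_quotient c m h))"
    if "\<not> vanishes_on (linear_form m) (h ` Y)" for m
  proof (rule has_order_along[OF Y], rule self.hyperplane_quotient_unit[OF h c])
    show "\<not> vanishes_on (linear_form m) (h ` X)"
      using that subset unfolding vanishes_on_def by blast
  qed
  obtain t where t: "uniformizer X Y t" using exists_uniformizer[OF Y] by blast
  (* c/m' = (c/m) (m/m'), and m/m' is a unit along Y. *)
  have indep: "order_along X Y (hyperplane_quotient c m' h) = order_along X Y (hyperplane_quotient c m h)"
    if m': "\<not> vanishes_on (linear_form m') (h ` Y)" for m'
  proof -
    have "has_order X Y (hyperplane_quotient m m' h) 0"
      by (rule has_order_unit[OF t hyperplane_quotient_unit[OF h m m']])
    from has_order_mult[OF ord[OF m] this]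
    have *: "has_order X Y (\<lambda>P. hyperplane_quotient c m h P * hyperplane_quotient m m' h P)
      (order_along X Y (hyperplane_quotient c m h))" by simp
    have "eventually (\<lambda>P. hyperplane_quotient c m h P * hyperplane_quotient m m' h P
        = hyperplane_quotient c m' h P) (generic X)"
      using eventually_pullback_nonzero[OF h linear_form_in_forms m]
    proof eventually_elim
      case (elim P)
      then obtain v where v: "v \<in> h P" "h P \<in> proj_space" using morphism_point[OF h] by blast
      with elim show ?case
        by (simp add: hyperplane_quotient_def quotient_fun_eq[OF linear_form_in_forms linear_form_in_forms v(2,1)])
    qed
    from order_along_eq[OF has_order_cong[OF this *]] show ?thesis .
  qed
  have "hyperplane_pullback X h c Y = order_along X Y (hyperplane_quotient c m h)"
    unfolding hyperplane_pullback_def if_P[OF Y]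
  proof (rule the_equality)
    show "\<forall>m'. \<not> vanishes_on (linear_form m') (h ` Y) \<longrightarrow>
        order_along X Y (hyperplane_quotient c m h) =
        order_along X Y (\<lambda>P. quotient_fun (linear_form c) (linear_form m') (h P))"
      using indep unfolding hyperplane_quotient_def by simp
  qed (use m in \<open>simp add: hyperplane_quotient_def\<close>)
  with ord[OF m] show ?thesis by simp
qed

text \<open>Both sides are orders along \<open>Y\<close> of one function, the local equation
  \<open>c / m\<close> composed with \<open>l\<close> and \<open>h\<close>, so uniqueness of orders
  applies.\<close>

lemma (in variety_iso) hyperplane_pullback_transport:
  fixes l :: "('f ^ 'm) set \<Rightarrow> ('f ^ 'p::finite) set"
  assumes reg: "regular_in_codim_one Z" and l: "morphism S Z proj_space l"
    and Y: "prime_divisor X Y" and c: "\<not> vanishes_on (linear_form c) (l ` Z)"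
  shows "hyperplane_pullback Z l c (h ` Y) = hyperplane_pullback X (\<lambda>P. l (h P)) c Y"
proof -
  interpret Y: prime_div_iso X Z h k Y by unfold_locales (rule Y)
  interpret rZ: regular_variety Z by unfold_locales (rule reg)
  interpret rX: regular_variety X by unfold_locales (rule regular_transport[OF reg])
  have lh: "morphism UNIV X proj_space (\<lambda>P. l (h P))"
    by (rule morphism_comp[OF h l X.subset_proj_space Z.subset_proj_space])
  obtain P where P: "P \<in> Y" using Y.Y.Y.irreducible by (auto simp: irreducible_set_def)
  then have "h P \<in> Z" using h_in Y.Y.subset by blast
  then obtain v where v: "v \<in> l (h P)" "v \<noteq> 0" by (rule Z.morphism_point[OF l])
  then obtain m where "linear_form m v \<noteq> 0" using exists_linear_form_nonzero2 by blast
  then have m: "\<not> vanishes_on (linear_form m) (l ` h ` Y)"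
    using v(1) P unfolding vanishes_on_def by blast
  have "has_order X Y (\<lambda>P. hyperplane_quotient c m l (h P)) (hyperplane_pullback Z l c (h ` Y))"
    by (rule Y.has_order_transport[OF
          rZ.hyperplane_pullback_order[OF l prime_divisor_image[OF Y] c m]])
  moreover have "has_order X Y (hyperplane_quotient c m (\<lambda>P. l (h P)))
      (hyperplane_pullback X (\<lambda>P. l (h P)) c Y)"
  proof (rule rX.hyperplane_pullback_order[OF lh Y])
    have "(\<lambda>P. l (h P)) ` X = l ` Z" unfolding image_X[symmetric] image_image ..
    with c show "\<not> vanishes_on (linear_form c) ((\<lambda>P. l (h P)) ` X)" by simp
    show "\<not> vanishes_on (linear_form m) ((\<lambda>P. l (h P)) ` Y)"
      using m by (simp add: image_image)
  qed
  ultimately show ?thesis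
    unfolding hyperplane_quotient_def by (rule Y.Y.has_order_unique)
qed

section \<open>The Kummer surface is not contained in a plane\<close>

lemma pt_eqD:
  assumes "pt u = pt v"
  obtains r where "r \<noteq> 0" "u = r *s v"
  using assms pt_self[of u] unfolding pt_def by blast

lemma vector_5_nth:
  fixes a b c d e :: "'f::field"
  shows "(vector [a, b, c, d, e] :: 'f ^ 5) $ 1 = a" "(vector [a, b, c, d, e] :: 'f ^ 5) $ 2 = b"
    "(vector [a, b, c, d, e] :: 'f ^ 5) $ 4 = d" "(vector [a, b, c, d, e] :: 'f ^ 5) $ 5 = e"
  unfolding vector_def by simp_all

lemma vector_4_nth:
  fixes a b c d :: "'f::field"
  shows "(vector [a, b, c, d] :: 'f ^ 4) $ 1 = a" "(vector [a, b, c, d] :: 'f ^ 4) $ 2 = b"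
    "(vector [a, b, c, d] :: 'f ^ 4) $ 3 = c" "(vector [a, b, c, d] :: 'f ^ 4) $ 4 = d"
  unfolding vector_def by simp_all

lemma affine_point_inject:
  assumes "affine_point x y = affine_point x' y'"
  shows "x = x'"
proof -
  obtain r where "vector [1, x, x^2, x^3, y] = r *s (vector [1, x', x'^2, x'^3, y'] :: 'a ^ 5)"
    using assms unfolding affine_point_def by (rule pt_eqD)
  then have "(vector [1, x, x^2, x^3, y] :: 'a ^ 5) $ i = r * (vector [1, x', x'^2, x'^3, y'] :: 'a ^ 5) $ i"
    for i by simp
  from this[of 1] this[of 2] show ?thesis by (simp add: vector_5_nth)
qed

lemma affine_point_not_at_infinity: "affine_point x y \<notin> points_at_infinity f"
proof
  assume "affine_point x y \<in> points_at_infinity f"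
  then obtain s where "affine_point x y = pt (vector [0, 0, 0, 1, s] :: 'a ^ 5)"
    unfolding points_at_infinity_def by blast
  then obtain r where "vector [1, x, x^2, x^3, y] = r *s (vector [0, 0, 0, 1, s] :: 'a ^ 5)"
    unfolding affine_point_def by (rule pt_eqD)
  then have "(vector [1, x, x^2, x^3, y] :: 'a ^ 5) $ 1 = r * (vector [0, 0, 0, 1, s] :: 'a ^ 5) $ 1"
    by simp
  then show False by (simp add: vector_5_nth)
qed

text \<open>The two square roots of the leading coefficient differ in characteristic 0. This gives
  the canonical divisor degree 2.\<close>

lemma points_at_infinity_eq:
  fixes f :: "'f::{alg_closed_field, field_char_0} poly"
  assumes "coeff f 6 \<noteq> 0"
  obtains I I' where "points_at_infinity f = {I, I'}" "I \<noteq> I'"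
proof -
  obtain s where s: "s ^ 2 = coeff f 6" using nth_root_exists[of 2 "coeff f 6"] by auto
  then have "s \<noteq> 0" using assms by auto
  let ?I = "\<lambda>s. pt (vector [0, 0, 0, 1, s] :: 'f ^ 5)"
  have "?I s \<noteq> ?I (- s)"
  proof
    assume "?I s = ?I (- s)"
    then obtain r where "vector [0, 0, 0, 1, s] = r *s (vector [0, 0, 0, 1, - s] :: 'f ^ 5)"
      by (rule pt_eqD)
    then have "(vector [0, 0, 0, 1, s] :: 'f ^ 5) $ i = r * (vector [0, 0, 0, 1, - s] :: 'f ^ 5) $ i" for i
      by simp
    from this[of 4] this[of 5] have "s = - s" by (simp add: vector_5_nth)
    then have "2 * s = 0" by (simp add: eq_neg_iff_add_eq_0)
    with \<open>s \<noteq> 0\<close> show False by simp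
  qed
  moreover have "points_at_infinity f = {?I s, ?I (- s)}"
  proof -
    have "z = s \<or> z = - s" if "z ^ 2 = coeff f 6" for z
      using that s power2_eq_iff[of z s] by simp
    then show ?thesis using s unfolding points_at_infinity_def by auto
  qed
  ultimately show ?thesis using that by blast
qed

text \<open>As \<open>x \<noteq> x'\<close>, the four points in the support are distinct and the
  degree is 1 + 1 - 2. This places the divisors in the formula of \<open>kummer_map\<close> in the
  domain on which \<open>cl\<close> lands in the Jacobian.\<close>

lemma effective_minus_canonical_in_Div0:
  fixes f :: "'f::{alg_closed_field, field_char_0} poly"
  assumes "coeff f 6 \<noteq> 0" "y ^ 2 = poly f x" "y' ^ 2 = poly f x'" "x \<noteq> x'"
  shows "(\<lambda>T. of_bool (T = affine_point x y) + of_bool (T = affine_point x' y')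
    - canonical_divisor f T) \<in> carrier (Div0 f)"
proof -
  obtain I I' where I: "points_at_infinity f = {I, I'}" "I \<noteq> I'"
    using points_at_infinity_eq[OF assms(1)] .
  let ?A = "affine_point x y" and ?B = "affine_point x' y'"
  let ?D = "\<lambda>T. of_bool (T = ?A) + of_bool (T = ?B) - canonical_divisor f T :: int"
  have ne: "?A \<noteq> ?B" "?A \<noteq> I" "?A \<noteq> I'" "?B \<noteq> I" "?B \<noteq> I'"
    using affine_point_inject[of x y x' y'] assms(4) affine_point_not_at_infinity[of x y f]
      affine_point_not_at_infinity[of x' y' f] unfolding I(1) by auto
  have supp: "{T. ?D T \<noteq> 0} = {?A, ?B, I, I'}"
    using ne I by (auto simp: canonical_divisor_def)
  have "(\<Sum>T | ?D T \<noteq> 0. ?D T) = 0"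
    unfolding supp using ne I by (simp add: canonical_divisor_def)
  moreover have "{T. ?D T \<noteq> 0} \<subseteq> curve f"
    using I(1) assms(2,3) unfolding supp curve_def by blast
  moreover have "finite {T. ?D T \<noteq> 0}"
    unfolding supp by simp
  ultimately show ?thesis
    unfolding Div0_def partial_object.select_convs mem_Collect_eq by (intro conjI)
qed

text \<open>The explicit formula turns a plane through the image into a relation valid for all pairs
  of affine points with \<open>x \<noteq> x'\<close>. Changing the sign of \<open>y\<close> isolates
  \<open>a $ 4\<close>; varying \<open>x\<close> and \<open>x'\<close> then kills the other
  coefficients.\<close>

lemma kummer_image_not_in_plane:
  fixes f :: "'f::{alg_closed_field, field_char_0} poly"
  assumes J: "is_jacobian k f J cl" and \<rho>: "kummer_map k f J cl \<rho>" and f: "degree f = 6"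
    and a: "a \<noteq> 0"
  shows "\<exists>P\<in>carrier J. \<exists>w\<in>\<rho> P. linear_form a w \<noteq> 0"
proof (rule ccontr)
  assume contra: "\<not> (\<exists>P\<in>carrier J. \<exists>w\<in>\<rho> P. linear_form a w \<noteq> 0)"
  then have zero: "linear_form a w = 0" if "P \<in> carrier J" "w \<in> \<rho> P" for P w
    using that by blast
  have "f \<noteq> 0" using f by auto
  then have f6: "coeff f 6 \<noteq> 0" using f leading_coeff_0_iff[of f] by simp
  have lin: "a $ 1 + a $ 2 * (x + x') + a $ 3 * (x * x') +
      a $ 4 * ((P3 f (vector [1, x + x', x * x', 0]) / 2 - 2 * y * y') / (x - x')^2) = 0"
    if y: "y ^ 2 = poly f x" "y' ^ 2 = poly f x'" "x \<noteq> x'" for x y x' y'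
  proof -
    let ?D = "\<lambda>T. of_bool (T = affine_point x y) + of_bool (T = affine_point x' y') - canonical_divisor f T"
    let ?w = "vector [1, x + x', x * x',
      (P3 f (vector [1, x + x', x * x', 0]) / 2 - 2 * y * y') / (x - x')^2] :: 'f ^ 4"
    have "divisor_class f ?D \<in> carrier (Pic0 f)"
      using effective_minus_canonical_in_Div0[OF f6 y]
      by (auto simp: Pic0_def divisor_class_def FactGroup_def RCOSETS_def)
    then have "cl (divisor_class f ?D) \<in> carrier J"
      using J by (auto simp: is_jacobian_def iso_def hom_def)
    moreover have "?w \<in> \<rho> (cl (divisor_class f ?D))"
      using \<rho>[unfolded kummer_map_def, THEN conjunct2, THEN conjunct2, THEN conjunct2,
          rule_format, OF y] pt_self[of ?w] by simp
    ultimately have "linear_form a ?w = 0" by (rule zero)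
    then show ?thesis by (simp add: linear_form_def sum_4 vector_4_nth add_ac)
  qed
  have root: "\<exists>y. y ^ 2 = poly f x" for x
    using nth_root_exists[of 2 "poly f x"] by auto
  \<comment> \<open>The field is infinite, so \<open>f\<close> has two distinct non-roots; over them
    \<open>y\<close> and \<open>y'\<close> are nonzero and can be cancelled.\<close>
  have inf: "infinite (UNIV - {x. poly f x = 0})"
    by (intro Diff_infinite_finite poly_roots_finite \<open>f \<noteq> 0\<close> infinite_UNIV_char_0)
  from infinite_imp_nonempty[OF this] obtain x where x: "poly f x \<noteq> 0" by auto
  have "infinite (UNIV - {z. poly f z = 0} - {x})"
    by (rule Diff_infinite_finite[OF _ inf]) simp
  from infinite_imp_nonempty[OF this] obtain x' where x': "poly f x' \<noteq> 0" "x \<noteq> x'" by auto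
  obtain y y' where y: "y ^ 2 = poly f x" "y' ^ 2 = poly f x'" using root by blast
  (* Replacing y by - y changes only the fourth coordinate, by a multiple of y y'. *)
  have a4: "a $ 4 = 0"
  proof -
    have "(- y) ^ 2 = poly f x" using y by simp
    from add_left_imp_eq[OF trans[OF lin[OF y x'(2)] lin[OF this y(2) x'(2), symmetric]]]
    have "a $ 4 * ((P3 f (vector [1, x + x', x * x', 0]) / 2 - 2 * y * y') / (x - x')^2) =
      a $ 4 * ((P3 f (vector [1, x + x', x * x', 0]) / 2 + 2 * y * y') / (x - x')^2)"
      by simp
    then have "a $ 4 * (P3 f (vector [1, x + x', x * x', 0]) / 2 - 2 * y * y') =
      a $ 4 * (P3 f (vector [1, x + x', x * x', 0]) / 2 + 2 * y * y')"
      using x'(2) by simp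
    then have "a $ 4 * (4 * y * y') = 0"
      by (simp only: distrib_left right_diff_distrib) (simp add: algebra_simps)
    moreover have "y \<noteq> 0" "y' \<noteq> 0" using y x x'(1) by auto
    ultimately show ?thesis by simp
  qed
  have lin': "a $ 1 + a $ 2 * (x + x') + a $ 3 * (x * x') = 0" if "x \<noteq> x'" for x x'
  proof -
    obtain y y' where "y ^ 2 = poly f x" "y' ^ 2 = poly f x'" using root by blast
    from lin[OF this that] show ?thesis by (simp add: a4)
  qed
  \<comment> \<open>With \<open>x = 0\<close> the product \<open>x * x'\<close> drops out, and the
    values 1 and 2 of \<open>x'\<close> separate the first two coefficients. The pair (1, 2) then
    gives the third. In characteristic 0 the points 0, 1, 2 are distinct.\<close>
  have e1: "a $ 1 + a $ 2 = 0" using lin'[of 0 1] by simp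
  have e2: "a $ 1 + a $ 2 * 2 = 0" using lin'[of 0 2] by simp
  have a2: "a $ 2 = 0"
  proof -
    have "a $ 2 = (a $ 1 + a $ 2 * 2) - (a $ 1 + a $ 2)" by simp
    then show ?thesis using e1 e2 by simp
  qed
  with e1 have a1: "a $ 1 = 0" by simp
  have "a $ 3 = 0" using lin'[of 1 2] a1 a2 by simp
  with a1 a2 a4 have "a = 0" by (simp add: Finite_Cartesian_Product.vec_eq_iff forall_4)
  with a show False ..
qed

section \<open>The divisor of a twisted (2,2,2)-form\<close>

lemma linear_form_transpose: "linear_form (transpose M *v c) v = linear_form c (M *v v)"
proof -
  have "linear_form (transpose M *v c) v = (\<Sum>i\<in>UNIV. \<Sum>j\<in>UNIV. M $ j $ i * c $ j * v $ i)"
    by (simp add: linear_form_def matrix_vector_mult_def transpose_def sum_distrib_right)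
  also have "\<dots> = (\<Sum>j\<in>UNIV. \<Sum>i\<in>UNIV. M $ j $ i * c $ j * v $ i)"
    by (rule sum.swap)
  also have "\<dots> = linear_form c (M *v v)"
    by (simp add: linear_form_def matrix_vector_mult_def sum_distrib_left mult_ac)
  finally show ?thesis .
qed

text \<open>The two summands of the symmetrization contribute the same product of linear forms,
  hence the factor 2.\<close>

lemma form222_of_symmetrized_product:
  assumes "\<forall>i j. \<Phi> i j x y = r * (s $ i * d $ j + d $ i * s $ j)"
  shows "form222 \<Phi> x y z = 2 * r * linear_form z s * linear_form z d"
proof -
  have "form222 \<Phi> x y z = (\<Sum>i\<in>UNIV. \<Sum>j\<in>UNIV. r * ((z $ i * s $ i) * (z $ j * d $ j)))
      + (\<Sum>i\<in>UNIV. \<Sum>j\<in>UNIV. r * ((z $ i * d $ i) * (z $ j * s $ j)))"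
    unfolding form222_def assms[rule_format] sum.distrib[symmetric] by (intro sum.cong refl) (simp add: algebra_simps)
  also have "\<dots> = r * (linear_form z s * linear_form z d) + r * (linear_form z d * linear_form z s)"
    unfolding linear_form_def sum_product by (simp add: sum_distrib_left)
  also have "\<dots> = 2 * r * linear_form z s * linear_form z d"
    by (simp add: algebra_simps)
  finally show ?thesis .
qed

section \<open>Isomorphisms from the coverings and the group law\<close>

lemma isomorphism_variety_iso:
  assumes "variety X" "variety Z" "isomorphism UNIV X Z h"
  shows "variety_iso X Z h (inv_into X h)"
proof -
  have bij: "bij_betw h X Z" and h: "morphism UNIV X Z h" "morphism UNIV Z X (inv_into X h)"
    using assms(3) by (auto simp: isomorphism_def)
  have "inv_into X h (h P) = P" if "P \<in> X" for P
    using bij that by (simp add: bij_betw_def)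
  moreover have "h (inv_into X h R) = R" if "R \<in> Z" for R
    using bij that by (rule bij_betw_inv_into_right)
  ultimately show ?thesis
    using assms(1,2) h by (simp add: variety_iso_def variety_iso_axioms_def)
qed

lemma proj_variety_UNIV: "proj_variety S X \<Longrightarrow> proj_variety UNIV X"
  using zariski_closed_UNIV by (auto simp: proj_variety_def)

lemma variety_iso_comp:
  assumes "variety_iso X Z h k" "variety_iso Z W h' k'"
  shows "variety_iso X W (\<lambda>P. h' (h P)) (\<lambda>R. k (k' R))"
proof -
  interpret a: variety_iso X Z h k by fact
  interpret b: variety_iso Z W h' k' by fact
  show ?thesis
  proof unfold_locales
    show "morphism UNIV X W (\<lambda>P. h' (h P))"
      by (rule morphism_comp[OF a.h b.h a.X.subset_proj_space a.Z.subset_proj_space])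
    show "morphism UNIV W X (\<lambda>R. k (k' R))"
      by (rule morphism_comp[OF b.k a.k b.Z.subset_proj_space a.Z.subset_proj_space])
    show "k (k' (h' (h P))) = P" if "P \<in> X" for P
      using that a.kh b.kh a.h_in by simp
    show "h' (h (k (k' R))) = R" if "R \<in> W" for R
      using that a.hk b.hk b.k_in by simp
  qed
qed

text \<open>Allows a map such as \<mu>(-, Q) to be recognized as a composite of isomorphisms
  although the two agree only on \<open>X\<close>.\<close>

lemma variety_iso_cong:
  assumes "variety_iso X Z h k" "\<And>P. P \<in> X \<Longrightarrow> h P = h' P"
  shows "variety_iso X Z h' k"
proof -
  interpret a: variety_iso X Z h k by fact
  show ?thesis
  proof unfold_locales
    show "morphism UNIV X Z h'" using a.h assms(2) by (rule morphism_cong)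
    show "k (h' P) = P" if "P \<in> X" for P using a.kh[OF that] assms(2)[OF that] by simp
    show "h' (k R) = R" if "R \<in> Z" for R using a.hk[OF that] assms(2)[OF a.k_in[OF that]] by simp
  qed (rule a.k)
qed

lemma translation_variety_iso:
  assumes J: "abelian_variety k J" and a: "a \<in> carrier J"
  shows "variety_iso (carrier J) (carrier J) (\<lambda>P. P \<otimes>\<^bsub>J\<^esub> a) (\<lambda>P. P \<otimes>\<^bsub>J\<^esub> inv\<^bsub>J\<^esub> a)"
proof -
  interpret comm_group J using J by (simp add: abelian_variety_def)
  have mu: "morphism2 k (carrier J) (carrier J) (carrier J) (\<lambda>P Q. P \<otimes>\<^bsub>J\<^esub> Q)"
    and var: "proj_variety k (carrier J)"
    using J by (simp_all add: abelian_variety_def)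
  show ?thesis
  proof unfold_locales
    show "proj_variety UNIV (carrier J)" using var by (rule proj_variety_UNIV)
    show "morphism UNIV (carrier J) (carrier J) (\<lambda>P. P \<otimes>\<^bsub>J\<^esub> a)"
      by (rule morphism2_fix_right[OF mu a])
    show "morphism UNIV (carrier J) (carrier J) (\<lambda>P. P \<otimes>\<^bsub>J\<^esub> inv\<^bsub>J\<^esub> a)"
      by (rule morphism2_fix_right[OF mu inv_closed[OF a]])
  qed (use a in \<open>simp_all add: m_assoc\<close>)
qed

lemma negation_variety_iso:
  assumes J: "abelian_variety k J"
  shows "variety_iso (carrier J) (carrier J) (\<lambda>P. inv\<^bsub>J\<^esub> P) (\<lambda>P. inv\<^bsub>J\<^esub> P)"
proof -
  interpret comm_group J using J by (simp add: abelian_variety_def)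
  have inv: "morphism k (carrier J) (carrier J) (\<lambda>P. inv\<^bsub>J\<^esub> P)"
    and var: "proj_variety k (carrier J)"
    using J by (simp_all add: abelian_variety_def)
  show ?thesis
  proof unfold_locales
    show "proj_variety UNIV (carrier J)" using var by (rule proj_variety_UNIV)
    show "morphism UNIV (carrier J) (carrier J) (\<lambda>P. inv\<^bsub>J\<^esub> P)"
      by (rule morphism_UNIV[OF inv order_refl])
  qed simp_all
qed

lemma matrix_inv_mult:
  fixes A :: "'f::field ^ 'n::finite ^ 'n"
  assumes "invertible A"
  shows "matrix_inv A ** A = Finite_Cartesian_Product.mat 1"
  using assms unfolding invertible_def matrix_inv_def by (metis (mono_tags, lifting) someI_ex)

text \<open>The inverse transpose acting on coefficients undoes the matrix acting on points, which
  is the reason for it in the twisted (2,2,2)-form.\<close>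

lemma linear_form_contragredient:
  fixes A :: "'f::field ^ 'n::finite ^ 'n"
  assumes "invertible A"
  shows "linear_form (transpose (matrix_inv A) *v c) (A *v v) = linear_form c v"
  unfolding linear_form_transpose matrix_vector_mul_assoc matrix_inv_mult[OF assms]
    matrix_vector_mul_lid ..

lemma two_covering_variety_iso:
  assumes "abelian_variety k J" "two_covering k J cl E X \<pi> \<phi>"
  shows "variety_iso X (carrier J) \<phi> (inv_into X \<phi>)"
proof (rule isomorphism_variety_iso)
  show "variety X"
    using assms(2) by unfold_locales (auto simp: two_covering_def intro: proj_variety_UNIV)
  show "variety (carrier J)"
    using assms(1) by unfold_locales (auto simp: abelian_variety_def intro: proj_variety_UNIV)
  show "isomorphism UNIV X (carrier J) \<phi>"
    using assms(2) by (simp add: two_covering_def)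
qed

text \<open>The matrix \<psi> carries a plane containing the twisted surface to a plane containing
  the untwisted one, because \<open>\<phi>\<close> reaches every point of the Jacobian.\<close>

lemma twisted_kummer_not_in_plane:
  fixes f :: "'f::{alg_closed_field, field_char_0} poly"
    and \<phi> :: "('f ^ 'm::finite) set \<Rightarrow> ('f ^ 'n::finite) set"
  assumes J: "is_jacobian k f J cl" and \<rho>: "kummer_map k f J cl \<rho>" and f: "degree f = 6"
    and X: "X \<subseteq> proj_space" "\<phi> ` X = carrier J"
    and h: "twisted_kummer_map k \<rho> X \<phi> h \<psi>" and c: "c \<noteq> 0"
  shows "\<not> vanishes_on (linear_form c) (h ` X)"
proof
  assume van: "vanishes_on (linear_form c) (h ` X)"
  have inv: "invertible \<psi>" and \<psi>: "\<And>P v. P \<in> X \<Longrightarrow> v \<in> h P \<Longrightarrow> \<psi> *v v \<in> \<rho> (\<phi> P)"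
    and hm: "morphism k X proj_space h"
    using h by (auto simp: twisted_kummer_map_def)
  define a where "a = transpose (matrix_inv \<psi>) *v c"
  have ac: "linear_form a (\<psi> *v v) = linear_form c v" for v
    unfolding a_def by (rule linear_form_contragredient[OF inv])
  have "a \<noteq> 0"
  proof
    assume "a = 0"
    then have "linear_form c v = 0" for v
      using ac[of v] by (simp add: linear_form_def)
    from this[of "axis i 1" for i] have "c $ i = 0" for i
      by (simp add: linear_form_def axis_def if_distrib[of "\<lambda>x. _ * x"] cong: if_cong)
    with c show False by (simp add: Finite_Cartesian_Product.vec_eq_iff)
  qed
  then obtain R w where R: "R \<in> carrier J" "w \<in> \<rho> R" "linear_form a w \<noteq> 0"
    using kummer_image_not_in_plane[OF J \<rho> f] by blast
  have "R \<in> \<phi> ` X" using R(1) X(2) by simp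
  then obtain P where P: "P \<in> X" "R = \<phi> P" by blast
  have "h P \<in> proj_space" using hm P(1) unfolding morphism_def by blast
  then obtain v where v: "v \<in> h P" using proj_space_nonempty by blast
  have "\<rho> ` carrier J = kummer_surface f"
    using \<rho> unfolding kummer_map_def by (elim conjE)
  then have "\<rho> R \<in> kummer_surface f" using R(1) by blast
  then have "\<rho> R \<in> proj_space" unfolding kummer_surface_def by blast
  moreover have "\<psi> *v v \<in> \<rho> R" using \<psi>[OF P(1) v] by (simp add: P(2))
  \<comment> \<open>\<open>w\<close> and \<open>\<psi> *v v\<close> represent the same projective
    point \<open>\<rho> R\<close>, so a form is nonzero at both or at neither.\<close>
  ultimately have "linear_form a (\<psi> *v v) \<noteq> 0"
    using form_zero_iff[OF linear_form_in_forms _ R(2), of "\<psi> *v v" a] R(3) by simp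
  then have "linear_form c v \<noteq> 0" by (simp add: ac)
  with van v P(1) show False unfolding vanishes_on_def by blast
qed

text \<open>\<open>D c / b\<^sup>2\<close> is the product of \<open>D c / D m\<close>, \<open>D m / l\<^sup>2\<close> and \<open>(l / b)\<^sup>2\<close>. The factor \<open>r\<close> in \<open>key\<close> depends on
  the point in an uncontrolled way, but it cancels in \<open>D c / D m\<close>, so that this is the product of the
  local equations \<open>c / m\<close> of the two pullbacks.\<close>

lemma (in variety) product_form_factorization:
  fixes h h1 h2 :: "('f ^ 'n) set \<Rightarrow> ('f ^ 'm::finite) set"
    and D :: "'f ^ 'm \<Rightarrow> 'f ^ 'm \<Rightarrow> 'f" and c :: "'f ^ 'm"
  assumes h: "morphism S X proj_space h" and h1: "morphism S1 X proj_space h1"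
    and h2: "morphism S2 X proj_space h2"
    and D: "\<And>m. D m \<in> forms UNIV 2"
    and key: "\<forall>P\<in>X. \<forall>v\<in>h P. \<forall>s\<in>h1 P. \<forall>d\<in>h2 P.
      \<exists>r. r \<noteq> 0 \<and> (\<forall>m. D m v = r * linear_form m s * linear_form m d)"
    and b: "\<not> vanishes_on (linear_form b) (h ` X)"
    and Y: "proj_variety UNIV Y" "Y \<subseteq> X"
  defines "g \<equiv> \<lambda>P. quotient_fun (D c) (\<lambda>x. linear_form b x ^ 2) (h P)"
  shows "\<exists>l m u. \<not> vanishes_on (linear_form l) (h ` Y) \<and> \<not> vanishes_on (linear_form m) (h1 ` Y)
      \<and> \<not> vanishes_on (linear_form m) (h2 ` Y) \<and> u \<in> local_units X Y \<and>
      eventually (\<lambda>P. ((hyperplane_quotient c m h1 P * hyperplane_quotient c m h2 P) * u P) *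
        (inverse (hyperplane_quotient b l h P) * inverse (hyperplane_quotient b l h P)) = g P) (generic X)"
proof -
  interpret subvariety X Y by unfold_locales (rule Y)+
  \<comment> \<open>All auxiliary linear forms are chosen at this one point of \<open>Y\<close>:
    being nonzero there already prevents them from vanishing identically along
    \<open>Y\<close>.\<close>
  obtain P where PY: "P \<in> Y" using Y.irreducible by (auto simp: irreducible_set_def)
  then have P: "P \<in> X" using subset by blast
  obtain v where v: "v \<in> h P" "v \<noteq> 0" by (rule morphism_point[OF h P])
  obtain s where s: "s \<in> h1 P" "s \<noteq> 0" by (rule morphism_point[OF h1 P])
  obtain d where d: "d \<in> h2 P" "d \<noteq> 0" by (rule morphism_point[OF h2 P])
  obtain m where m: "linear_form m s \<noteq> 0" "linear_form m d \<noteq> 0"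
    using exists_linear_form_nonzero2[OF s(2) d(2)] by blast
  obtain l where l: "linear_form l v \<noteq> 0"
    using exists_linear_form_nonzero2[OF v(2) v(2)] by blast
  have lY: "\<not> vanishes_on (linear_form l) (h ` Y)"
    using PY v(1) l unfolding vanishes_on_def by blast
  have m1: "\<not> vanishes_on (linear_form m) (h1 ` Y)"
    using PY s(1) m(1) unfolding vanishes_on_def by blast
  have m2: "\<not> vanishes_on (linear_form m) (h2 ` Y)"
    using PY d(1) m(2) unfolding vanishes_on_def by blast
  obtain r where r: "r \<noteq> 0" "\<forall>m. D m v = r * linear_form m s * linear_form m d"
    using key P v(1) s(1) d(1) by blast
  have DY: "\<not> vanishes_on (D m) (h ` Y)"
  proof -
    have "D m v \<noteq> 0" using r m by simp
    then show ?thesis using PY v(1) unfolding vanishes_on_def by blast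
  qed
  have sq: "(\<lambda>x. linear_form e x ^ 2) \<in> forms UNIV 2" for e :: "'f ^ 'm"
    using forms_power[OF linear_form_in_forms, of e 2] by simp
  have lY2: "\<not> vanishes_on (\<lambda>x. linear_form l x ^ 2) (h ` Y)"
    using lY unfolding vanishes_on_def by simp
  define u where "u P = quotient_fun (D m) (\<lambda>x. linear_form l x ^ 2) (h P)" for P
  have u: "u \<in> local_units X Y"
    unfolding u_def[abs_def] by (rule local_units_pullback[OF h order_refl D sq DY lY2])
  have "eventually (\<lambda>P. ((hyperplane_quotient c m h1 P * hyperplane_quotient c m h2 P) * u P) *
      (inverse (hyperplane_quotient b l h P) * inverse (hyperplane_quotient b l h P)) = g P) (generic X)"
    using eventually_pullback_nonzero[OF h D DY] eventually_pullback_nonzero[OF h linear_form_in_forms lY]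
      self.eventually_pullback_nonzero[OF h linear_form_in_forms b]
  proof eventually_elim
    case (elim R)
    then have R: "R \<in> X" by blast
    obtain v where v: "v \<in> h R" "h R \<in> proj_space" by (rule morphism_point[OF h R])
    obtain s where s: "s \<in> h1 R" "h1 R \<in> proj_space" by (rule morphism_point[OF h1 R])
    obtain d where d: "d \<in> h2 R" "h2 R \<in> proj_space" by (rule morphism_point[OF h2 R])
    obtain r where r: "r \<noteq> 0" "\<forall>m. D m v = r * linear_form m s * linear_form m d"
      using key R v(1) s(1) d(1) by blast
    have nz: "D m v \<noteq> 0" "linear_form l v \<noteq> 0" "linear_form b v \<noteq> 0" using elim v(1) by blast+
    then have nz': "linear_form m s \<noteq> 0" "linear_form m d \<noteq> 0" using r(2) by auto
    have q: "hyperplane_quotient c m h1 R = linear_form c s / linear_form m s"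
      "hyperplane_quotient c m h2 R = linear_form c d / linear_form m d"
      "hyperplane_quotient b l h R = linear_form b v / linear_form l v"
      "u R = r * linear_form m s * linear_form m d / linear_form l v ^ 2"
      "g R = r * linear_form c s * linear_form c d / linear_form b v ^ 2"
      using r(2) quotient_fun_eq[OF linear_form_in_forms linear_form_in_forms s(2,1)]
        quotient_fun_eq[OF linear_form_in_forms linear_form_in_forms d(2,1)]
        quotient_fun_eq[OF linear_form_in_forms linear_form_in_forms v(2,1)]
        quotient_fun_eq[OF D sq v(2,1)]
      by (simp_all add: hyperplane_quotient_def u_def g_def)
    show ?case unfolding q using nz nz' by (simp add: field_simps power2_eq_square)
  qed
  with lY m1 m2 u show ?thesis by blast
qed

text \<open>The arithmetic of the Jacobian enters only through \<open>key\<close>. The factorization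
  is used twice: along \<open>X\<close> itself it shows that \<open>g\<close> is a nonzero rational
  function, and along a prime divisor it gives the order.\<close>

lemma (in regular_variety) divisor_of_product_form:
  fixes h h1 h2 :: "('f ^ 'n) set \<Rightarrow> ('f ^ 'm::finite) set"
    and D :: "'f ^ 'm \<Rightarrow> 'f ^ 'm \<Rightarrow> 'f"
  assumes h: "morphism S X proj_space h" and h1: "morphism S1 X proj_space h1"
    and h2: "morphism S2 X proj_space h2"
    and D: "\<And>m. D m \<in> forms UNIV 2"
    and key: "\<forall>P\<in>X. \<forall>v\<in>h P. \<forall>s\<in>h1 P. \<forall>d\<in>h2 P.
      \<exists>r. r \<noteq> 0 \<and> (\<forall>m. D m v = r * linear_form m s * linear_form m d)"
    and b: "\<not> vanishes_on (linear_form b) (h ` X)"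
    and c1: "\<not> vanishes_on (linear_form c) (h1 ` X)" and c2: "\<not> vanishes_on (linear_form c) (h2 ` X)"
  defines "g \<equiv> \<lambda>P. quotient_fun (D c) (\<lambda>x. linear_form b x ^ 2) (h P)"
  shows "g \<in> local_units X X"
    and "prime_divisor X Y \<Longrightarrow> order_along X Y g =
      hyperplane_pullback X h1 c Y + hyperplane_pullback X h2 c Y - 2 * hyperplane_pullback X h b Y"
proof -
  have g: "quotient_fun (D c) (\<lambda>x. linear_form b x ^ 2) (h P) = g P" for P
    by (simp add: g_def)
  note factor = product_form_factorization[where c = c, OF h h1 h2 D key b, unfolded g]
  obtain l m u where *: "\<not> vanishes_on (linear_form l) (h ` X)" "\<not> vanishes_on (linear_form m) (h1 ` X)"
    "\<not> vanishes_on (linear_form m) (h2 ` X)" "u \<in> local_units X X"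
    and ev: "eventually (\<lambda>P. ((hyperplane_quotient c m h1 P * hyperplane_quotient c m h2 P) * u P) *
        (inverse (hyperplane_quotient b l h P) * inverse (hyperplane_quotient b l h P)) = g P) (generic X)"
    using factor[OF variety order_refl] by (elim exE conjE)
  show "g \<in> local_units X X"
    by (rule self.local_units_cong[OF ev])
      (intro self.local_units_mult self.local_units_inverse *(4)
        self.hyperplane_quotient_unit[OF h1 c1 *(2)] self.hyperplane_quotient_unit[OF h2 c2 *(3)]
        self.hyperplane_quotient_unit[OF h b *(1)])
  show "order_along X Y g =
      hyperplane_pullback X h1 c Y + hyperplane_pullback X h2 c Y - 2 * hyperplane_pullback X h b Y"
    if Y: "prime_divisor X Y"
  proof -
    interpret prime_div X Y using Y by unfold_locales (auto simp: prime_divisor_def)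
    obtain t where t: "uniformizer X Y t" using exists_uniformizer[OF Y] by blast
    obtain l m u where *: "\<not> vanishes_on (linear_form l) (h ` Y)" "\<not> vanishes_on (linear_form m) (h1 ` Y)"
      "\<not> vanishes_on (linear_form m) (h2 ` Y)" "u \<in> local_units X Y"
      and ev: "eventually (\<lambda>P. ((hyperplane_quotient c m h1 P * hyperplane_quotient c m h2 P) * u P) *
          (inverse (hyperplane_quotient b l h P) * inverse (hyperplane_quotient b l h P)) = g P) (generic X)"
      using factor[OF subvariety subset] by (elim exE conjE)
    \<comment> \<open>The factor \<open>inverse (b / l)\<close> occurs twice, which gives the
      coefficient -2; the unit \<open>u\<close> contributes 0.\<close>
    note inv = has_order_inverse[OF hyperplane_pullback_order[OF h Y b *(1)]]
    note ord = has_order_mult[OF has_order_mult[OF has_order_mult[OF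
            hyperplane_pullback_order[OF h1 Y c1 *(2)] hyperplane_pullback_order[OF h2 Y c2 *(3)]]
            has_order_unit[OF t *(4)]] has_order_mult[OF inv inv]]
    from order_along_eq[OF has_order_cong[OF ev ord]] show ?thesis by simp
  qed
qed

theorem theorem3p9:
  fixes k :: "'f::{alg_closed_field, field_char_0} set"
    and f :: "'f poly"
    and J :: "('f ^ 'n::finite) set monoid"
    and cl :: "'f cdivisor set \<Rightarrow> ('f ^ 'n) set"
    and \<rho> :: "('f ^ 'n) set \<Rightarrow> ('f ^ 4) set"
    and \<epsilon> \<eta> :: "(('f \<Rightarrow> 'f) \<Rightarrow> 'f cdivisor set) set"
    and J\<^sub>\<epsilon> :: "('f ^ 'm1::finite) set set"
    and J\<^sub>\<eta> :: "('f ^ 'm2::finite) set set"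
    and J\<^sub>\<epsilon>\<^sub>\<eta> :: "('f ^ 'm3::finite) set set"
    and \<pi>\<^sub>\<epsilon> \<phi>\<^sub>\<epsilon> :: "('f ^ 'm1) set \<Rightarrow> ('f ^ 'n) set"
    and \<pi>\<^sub>\<eta> \<phi>\<^sub>\<eta> :: "('f ^ 'm2) set \<Rightarrow> ('f ^ 'n) set"
    and \<pi>\<^sub>\<epsilon>\<^sub>\<eta> \<phi>\<^sub>\<epsilon>\<^sub>\<eta> :: "('f ^ 'm3) set \<Rightarrow> ('f ^ 'n) set"
    and h\<^sub>\<epsilon> :: "('f ^ 'm1) set \<Rightarrow> ('f ^ 4) set"
    and h\<^sub>\<eta> :: "('f ^ 'm2) set \<Rightarrow> ('f ^ 4) set"
    and h\<^sub>\<epsilon>\<^sub>\<eta> :: "('f ^ 'm3) set \<Rightarrow> ('f ^ 4) set"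
    and \<psi>\<^sub>\<epsilon> \<psi>\<^sub>\<eta> \<psi>\<^sub>\<epsilon>\<^sub>\<eta> :: "'f ^ 4 ^ 4"
    and \<mu> :: "('f ^ 'm1) set \<Rightarrow> ('f ^ 'm2) set \<Rightarrow> ('f ^ 'm3) set"
    and \<Phi> :: "4 \<Rightarrow> 4 \<Rightarrow> 'f ^ 4 \<Rightarrow> 'f ^ 4 \<Rightarrow> 'f"
    and \<Phi>\<^sub>\<epsilon>\<^sub>\<eta> :: "'f ^ 4 \<Rightarrow> 'f ^ 4 \<Rightarrow> 'f ^ 4 \<Rightarrow> 'f"
    and Q :: "('f ^ 'm2) set" and xQ c :: "'f ^ 4"
    and \<phi> :: "('f ^ 'm1) set \<Rightarrow> ('f ^ 'm3) set"
    and \<iota>\<^sub>\<epsilon> :: "('f ^ 'm1) set \<Rightarrow> ('f ^ 'm1) set"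
    and H\<^sub>\<epsilon> :: "('f ^ 'm1) set set \<Rightarrow> int"
    and H\<^sub>\<epsilon>\<^sub>\<eta> :: "('f ^ 'm3) set set \<Rightarrow> int"
    and g :: "('f ^ 'm1) set \<Rightarrow> 'f"
  assumes "number_field k" and "algebraic_closure_of k TYPE('f)"
    and "\<forall>i. coeff f i \<in> k" and "degree f = 6" and "squarefree f"
    and "is_jacobian k f J cl" and "kummer_map k f J cl \<rho>"
    and "\<epsilon> \<in> Selmer2 k f" and "\<eta> \<in> Selmer2 k f"
    and "two_covering k J cl \<epsilon> J\<^sub>\<epsilon> \<pi>\<^sub>\<epsilon> \<phi>\<^sub>\<epsilon>"
    and "two_covering k J cl \<eta> J\<^sub>\<eta> \<pi>\<^sub>\<eta> \<phi>\<^sub>\<eta>"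
    and "two_covering k J cl (\<epsilon> \<otimes>\<^bsub>H1_J2 k f\<^esub> \<eta>) J\<^sub>\<epsilon>\<^sub>\<eta> \<pi>\<^sub>\<epsilon>\<^sub>\<eta> \<phi>\<^sub>\<epsilon>\<^sub>\<eta>"
    and "twisted_kummer_map k \<rho> J\<^sub>\<epsilon> \<phi>\<^sub>\<epsilon> h\<^sub>\<epsilon> \<psi>\<^sub>\<epsilon>"
    and "twisted_kummer_map k \<rho> J\<^sub>\<eta> \<phi>\<^sub>\<eta> h\<^sub>\<eta> \<psi>\<^sub>\<eta>"
    and "twisted_kummer_map k \<rho> J\<^sub>\<epsilon>\<^sub>\<eta> \<phi>\<^sub>\<epsilon>\<^sub>\<eta> h\<^sub>\<epsilon>\<^sub>\<eta> \<psi>\<^sub>\<epsilon>\<^sub>\<eta>"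
    and "twisted_group_law k J J\<^sub>\<epsilon> \<phi>\<^sub>\<epsilon> J\<^sub>\<eta> \<phi>\<^sub>\<eta> J\<^sub>\<epsilon>\<^sub>\<eta> \<phi>\<^sub>\<epsilon>\<^sub>\<eta> \<mu>"
    and "flynn_forms f J \<rho> \<Phi>"
    and "twisted_form222 k \<Phi> \<psi>\<^sub>\<epsilon> \<psi>\<^sub>\<eta> \<psi>\<^sub>\<epsilon>\<^sub>\<eta> \<Phi>\<^sub>\<epsilon>\<^sub>\<eta>"
    and "Q \<in> J\<^sub>\<eta>" and "xQ \<in> h\<^sub>\<eta> Q" and "c \<noteq> 0"
    and "\<phi> = (\<lambda>P. \<mu> P Q)"
    and "\<iota>\<^sub>\<epsilon> = twisted_neg J J\<^sub>\<epsilon> \<phi>\<^sub>\<epsilon>"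
    and "H\<^sub>\<epsilon> = hyperplane_pullback J\<^sub>\<epsilon> h\<^sub>\<epsilon> (axis 1 1)"
    and "H\<^sub>\<epsilon>\<^sub>\<eta> = hyperplane_pullback J\<^sub>\<epsilon>\<^sub>\<eta> h\<^sub>\<epsilon>\<^sub>\<eta> c"
    and "g = (\<lambda>P. quotient_fun (\<lambda>x. \<Phi>\<^sub>\<epsilon>\<^sub>\<eta> x xQ c) (\<lambda>x. (x $ 1)^2) (h\<^sub>\<epsilon> P))"
  shows "g \<in> rational_functions J\<^sub>\<epsilon> \<and> \<not> generically_eq J\<^sub>\<epsilon> g (\<lambda>P. 0) \<and>
    div_of J\<^sub>\<epsilon> g = (\<lambda>Y. iso_pullback J\<^sub>\<epsilon> \<phi> H\<^sub>\<epsilon>\<^sub>\<eta> Y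
        + iso_pullback J\<^sub>\<epsilon> \<iota>\<^sub>\<epsilon> (iso_pullback J\<^sub>\<epsilon> \<phi> H\<^sub>\<epsilon>\<^sub>\<eta>) Y - 2 * H\<^sub>\<epsilon> Y)"
proof -
  let ?K = "carrier J" and ?\<phi>\<^sub>\<epsilon>' = "inv_into J\<^sub>\<epsilon> \<phi>\<^sub>\<epsilon>" and ?\<phi>\<^sub>\<epsilon>\<^sub>\<eta>' = "inv_into J\<^sub>\<epsilon>\<^sub>\<eta> \<phi>\<^sub>\<epsilon>\<^sub>\<eta>"
  let ?q = "\<phi>\<^sub>\<eta> Q"
  note jac = \<open>is_jacobian k f J cl\<close> and kum = \<open>kummer_map k f J cl \<rho>\<close>
  note tk\<^sub>\<epsilon> = \<open>twisted_kummer_map k \<rho> J\<^sub>\<epsilon> \<phi>\<^sub>\<epsilon> h\<^sub>\<epsilon> \<psi>\<^sub>\<epsilon>\<close>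
    and tk\<^sub>\<eta> = \<open>twisted_kummer_map k \<rho> J\<^sub>\<eta> \<phi>\<^sub>\<eta> h\<^sub>\<eta> \<psi>\<^sub>\<eta>\<close>
    and tk\<^sub>\<epsilon>\<^sub>\<eta> = \<open>twisted_kummer_map k \<rho> J\<^sub>\<epsilon>\<^sub>\<eta> \<phi>\<^sub>\<epsilon>\<^sub>\<eta> h\<^sub>\<epsilon>\<^sub>\<eta> \<psi>\<^sub>\<epsilon>\<^sub>\<eta>\<close>
  have J: "abelian_variety k J" using jac by (simp add: is_jacobian_def)
  have reg: "regular_in_codim_one ?K" using J by (simp add: abelian_variety_def)
  interpret J: comm_group J using J by (simp add: abelian_variety_def)
  interpret \<epsilon>: variety_iso J\<^sub>\<epsilon> ?K \<phi>\<^sub>\<epsilon> ?\<phi>\<^sub>\<epsilon>'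
    by (rule two_covering_variety_iso[OF J \<open>two_covering k J cl \<epsilon> J\<^sub>\<epsilon> \<pi>\<^sub>\<epsilon> \<phi>\<^sub>\<epsilon>\<close>])
  interpret \<eta>: variety_iso J\<^sub>\<eta> ?K \<phi>\<^sub>\<eta> "inv_into J\<^sub>\<eta> \<phi>\<^sub>\<eta>"
    by (rule two_covering_variety_iso[OF J \<open>two_covering k J cl \<eta> J\<^sub>\<eta> \<pi>\<^sub>\<eta> \<phi>\<^sub>\<eta>\<close>])
  interpret \<epsilon>\<eta>: variety_iso J\<^sub>\<epsilon>\<^sub>\<eta> ?K \<phi>\<^sub>\<epsilon>\<^sub>\<eta> ?\<phi>\<^sub>\<epsilon>\<^sub>\<eta>'
    by (rule two_covering_variety_iso[OF J
          \<open>two_covering k J cl (\<epsilon> \<otimes>\<^bsub>H1_J2 k f\<^esub> \<eta>) J\<^sub>\<epsilon>\<^sub>\<eta> \<pi>\<^sub>\<epsilon>\<^sub>\<eta> \<phi>\<^sub>\<epsilon>\<^sub>\<eta>\<close>])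
  interpret reg: regular_variety J\<^sub>\<epsilon>
    by unfold_locales (rule \<epsilon>.regular_transport[OF reg])
  have reg\<^sub>\<epsilon>\<^sub>\<eta>: "regular_in_codim_one J\<^sub>\<epsilon>\<^sub>\<eta>" by (rule \<epsilon>\<eta>.regular_transport[OF reg])
  have q: "?q \<in> ?K" by (rule \<eta>.h_in[OF \<open>Q \<in> J\<^sub>\<eta>\<close>])
  have \<mu>: "\<mu> P Q \<in> J\<^sub>\<epsilon>\<^sub>\<eta>" "\<phi>\<^sub>\<epsilon>\<^sub>\<eta> (\<mu> P Q) = \<phi>\<^sub>\<epsilon> P \<otimes>\<^bsub>J\<^esub> ?q" if "P \<in> J\<^sub>\<epsilon>" for P
    using \<open>twisted_group_law k J J\<^sub>\<epsilon> \<phi>\<^sub>\<epsilon> J\<^sub>\<eta> \<phi>\<^sub>\<eta> J\<^sub>\<epsilon>\<^sub>\<eta> \<phi>\<^sub>\<epsilon>\<^sub>\<eta> \<mu>\<close> that \<open>Q \<in> J\<^sub>\<eta>\<close>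
    by (simp_all add: twisted_group_law_def morphism2_def)
  \<comment> \<open>On the Jacobian the map becomes translation by \<open>?q\<close>. The stated
    inverse is translation by its negative, read back through the two coverings.\<close>
  interpret \<phi>: variety_iso J\<^sub>\<epsilon> J\<^sub>\<epsilon>\<^sub>\<eta> \<phi> "\<lambda>R. ?\<phi>\<^sub>\<epsilon>' (\<phi>\<^sub>\<epsilon>\<^sub>\<eta> R \<otimes>\<^bsub>J\<^esub> inv\<^bsub>J\<^esub> ?q)"
  proof (rule variety_iso_cong)
    show "variety_iso J\<^sub>\<epsilon> J\<^sub>\<epsilon>\<^sub>\<eta> (\<lambda>P. ?\<phi>\<^sub>\<epsilon>\<^sub>\<eta>' (\<phi>\<^sub>\<epsilon> P \<otimes>\<^bsub>J\<^esub> ?q))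
        (\<lambda>R. ?\<phi>\<^sub>\<epsilon>' (\<phi>\<^sub>\<epsilon>\<^sub>\<eta> R \<otimes>\<^bsub>J\<^esub> inv\<^bsub>J\<^esub> ?q))"
      by (rule variety_iso_comp[OF variety_iso_comp[OF \<epsilon>.variety_iso_axioms
            translation_variety_iso[OF J q]] \<epsilon>\<eta>.inverse])
    show "?\<phi>\<^sub>\<epsilon>\<^sub>\<eta>' (\<phi>\<^sub>\<epsilon> P \<otimes>\<^bsub>J\<^esub> ?q) = \<phi> P" if "P \<in> J\<^sub>\<epsilon>" for P
      using \<mu>[OF that] \<epsilon>\<eta>.kh[of "\<mu> P Q"] by (simp add: \<open>\<phi> = (\<lambda>P. \<mu> P Q)\<close>)
  qed
  have \<iota>_eq: "\<iota>\<^sub>\<epsilon> = (\<lambda>P. ?\<phi>\<^sub>\<epsilon>' (inv\<^bsub>J\<^esub> (\<phi>\<^sub>\<epsilon> P)))"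
    using \<open>\<iota>\<^sub>\<epsilon> = twisted_neg J J\<^sub>\<epsilon> \<phi>\<^sub>\<epsilon>\<close> by (simp add: fun_eq_iff twisted_neg_def)
  \<comment> \<open>An involution, so the same formula serves as its inverse.\<close>
  interpret \<iota>: variety_iso J\<^sub>\<epsilon> J\<^sub>\<epsilon> \<iota>\<^sub>\<epsilon> "\<lambda>P. ?\<phi>\<^sub>\<epsilon>' (inv\<^bsub>J\<^esub> (\<phi>\<^sub>\<epsilon> P))"
    unfolding \<iota>_eq
    by (rule variety_iso_comp[OF variety_iso_comp[OF \<epsilon>.variety_iso_axioms
            negation_variety_iso[OF J]] \<epsilon>.inverse])
  let ?h1 = "\<lambda>P. h\<^sub>\<epsilon>\<^sub>\<eta> (\<phi> P)" and ?h2 = "\<lambda>P. h\<^sub>\<epsilon>\<^sub>\<eta> (\<phi> (\<iota>\<^sub>\<epsilon> P))"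
  have h\<^sub>\<epsilon>: "morphism k J\<^sub>\<epsilon> proj_space h\<^sub>\<epsilon>" using tk\<^sub>\<epsilon> by (simp add: twisted_kummer_map_def)
  have h\<^sub>\<epsilon>\<^sub>\<eta>: "morphism k J\<^sub>\<epsilon>\<^sub>\<eta> proj_space h\<^sub>\<epsilon>\<^sub>\<eta>"
    using tk\<^sub>\<epsilon>\<^sub>\<eta> by (simp add: twisted_kummer_map_def)
  have h1: "morphism UNIV J\<^sub>\<epsilon> proj_space ?h1"
    by (rule morphism_comp[OF \<phi>.h h\<^sub>\<epsilon>\<^sub>\<eta> \<epsilon>.X.subset_proj_space \<epsilon>\<eta>.X.subset_proj_space])
  have h2: "morphism UNIV J\<^sub>\<epsilon> proj_space ?h2"
    by (rule morphism_comp[OF \<iota>.h h1 \<epsilon>.X.subset_proj_space \<epsilon>.X.subset_proj_space])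
  have nz\<^sub>\<epsilon>\<^sub>\<eta>: "\<not> vanishes_on (linear_form c) (h\<^sub>\<epsilon>\<^sub>\<eta> ` J\<^sub>\<epsilon>\<^sub>\<eta>)"
    by (rule twisted_kummer_not_in_plane[OF jac kum \<open>degree f = 6\<close> \<epsilon>\<eta>.X.subset_proj_space
          \<epsilon>\<eta>.image_X tk\<^sub>\<epsilon>\<^sub>\<eta> \<open>c \<noteq> 0\<close>])
  have nz1: "\<not> vanishes_on (linear_form c) (?h1 ` J\<^sub>\<epsilon>)"
    using nz\<^sub>\<epsilon>\<^sub>\<eta> unfolding \<phi>.image_X[symmetric] image_image .
  have nz2: "\<not> vanishes_on (linear_form c) (?h2 ` J\<^sub>\<epsilon>)"
  proof -
    \<comment> \<open>The involution permutes the points of \<open>J\<^sub>\<epsilon>\<close>, so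
      both maps have the same image.\<close>
    have "?h2 ` J\<^sub>\<epsilon> = ?h1 ` \<iota>\<^sub>\<epsilon> ` J\<^sub>\<epsilon>" by (simp only: image_image)
    then show ?thesis using nz1 unfolding \<iota>.image_X by simp
  qed
  have nz: "\<not> vanishes_on (linear_form (axis 1 1)) (h\<^sub>\<epsilon> ` J\<^sub>\<epsilon>)"
    by (rule twisted_kummer_not_in_plane[OF jac kum \<open>degree f = 6\<close> \<epsilon>.X.subset_proj_space
          \<epsilon>.image_X tk\<^sub>\<epsilon>]) (simp add: axis_eq_0_iff)
  \<comment> \<open>With \<open>xQ\<close> frozen, this is a family of quadratic forms in the point,
    indexed by the coefficient vector \<open>m\<close>.\<close>
  define D where "D m v = \<Phi>\<^sub>\<epsilon>\<^sub>\<eta> v xQ m" for m v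
  obtain C where C: "C \<noteq> 0" "\<And>x y z. \<Phi>\<^sub>\<epsilon>\<^sub>\<eta> x y z =
      C * form222 \<Phi> (\<psi>\<^sub>\<epsilon> *v x) (\<psi>\<^sub>\<eta> *v y) (transpose (matrix_inv \<psi>\<^sub>\<epsilon>\<^sub>\<eta>) *v z)"
    using \<open>twisted_form222 k \<Phi> \<psi>\<^sub>\<epsilon> \<psi>\<^sub>\<eta> \<psi>\<^sub>\<epsilon>\<^sub>\<eta> \<Phi>\<^sub>\<epsilon>\<^sub>\<eta>\<close>
    unfolding twisted_form222_def by blast
  have D: "D m \<in> forms UNIV 2" for m
    using \<open>twisted_form222 k \<Phi> \<psi>\<^sub>\<epsilon> \<psi>\<^sub>\<eta> \<psi>\<^sub>\<epsilon>\<^sub>\<eta> \<Phi>\<^sub>\<epsilon>\<^sub>\<eta>\<close>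
    unfolding D_def[abs_def] twisted_form222_def by (intro triforms_fix_right) (rule conjunct1)
  have inv_\<psi>: "linear_form (transpose (matrix_inv \<psi>\<^sub>\<epsilon>\<^sub>\<eta>) *v m) (\<psi>\<^sub>\<epsilon>\<^sub>\<eta> *v s) = linear_form m s" for m s
    using tk\<^sub>\<epsilon>\<^sub>\<eta> by (intro linear_form_contragredient) (simp add: twisted_kummer_map_def)
  have key: "\<forall>P\<in>J\<^sub>\<epsilon>. \<forall>v\<in>h\<^sub>\<epsilon> P. \<forall>s\<in>?h1 P. \<forall>d\<in>?h2 P.
      \<exists>r. r \<noteq> 0 \<and> (\<forall>m. D m v = r * linear_form m s * linear_form m d)"
  proof (intro ballI)
    fix P v s d
    assume P: "P \<in> J\<^sub>\<epsilon>" and v: "v \<in> h\<^sub>\<epsilon> P" and s: "s \<in> ?h1 P" and d: "d \<in> ?h2 P"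
    let ?p = "\<phi>\<^sub>\<epsilon> P"
    have p: "?p \<in> ?K" by (rule \<epsilon>.h_in[OF P])
    have \<iota>P: "\<iota>\<^sub>\<epsilon> P \<in> J\<^sub>\<epsilon>" by (rule \<iota>.h_in[OF P])
    have \<phi>\<iota>: "\<phi>\<^sub>\<epsilon> (\<iota>\<^sub>\<epsilon> P) = inv\<^bsub>J\<^esub> ?p"
      unfolding \<iota>_eq by (rule \<epsilon>.hk[OF J.inv_closed[OF p]])
    (* \<mu>(\<iota> P, Q) lies over - P + Q = - (P - Q), and \<rho> does not see the sign. *)
    have sym: "\<rho> (inv\<^bsub>J\<^esub> ?p \<otimes>\<^bsub>J\<^esub> ?q) = \<rho> (?p \<otimes>\<^bsub>J\<^esub> inv\<^bsub>J\<^esub> ?q)"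
    proof -
      have "inv\<^bsub>J\<^esub> (?p \<otimes>\<^bsub>J\<^esub> inv\<^bsub>J\<^esub> ?q) = inv\<^bsub>J\<^esub> ?p \<otimes>\<^bsub>J\<^esub> ?q"
        using p q by (simp add: J.inv_mult)
      moreover have "?p \<otimes>\<^bsub>J\<^esub> inv\<^bsub>J\<^esub> ?q \<in> ?K" "inv\<^bsub>J\<^esub> ?p \<otimes>\<^bsub>J\<^esub> ?q \<in> ?K" using p q by simp_all
      ultimately show ?thesis using kum unfolding kummer_map_def by metis
    qed
    have x: "\<psi>\<^sub>\<epsilon> *v v \<in> \<rho> ?p" using tk\<^sub>\<epsilon> P v by (simp add: twisted_kummer_map_def)
    have y: "\<psi>\<^sub>\<eta> *v xQ \<in> \<rho> ?q"
      using tk\<^sub>\<eta> \<open>Q \<in> J\<^sub>\<eta>\<close> \<open>xQ \<in> h\<^sub>\<eta> Q\<close> by (simp add: twisted_kummer_map_def)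
    have "\<psi>\<^sub>\<epsilon>\<^sub>\<eta> *v s \<in> \<rho> (\<phi>\<^sub>\<epsilon>\<^sub>\<eta> (\<mu> P Q))"
      using tk\<^sub>\<epsilon>\<^sub>\<eta> \<mu>(1)[OF P] s by (simp add: twisted_kummer_map_def \<open>\<phi> = (\<lambda>P. \<mu> P Q)\<close>)
    then have s': "\<psi>\<^sub>\<epsilon>\<^sub>\<eta> *v s \<in> \<rho> (?p \<otimes>\<^bsub>J\<^esub> ?q)" by (simp add: \<mu>(2)[OF P])
    have "\<psi>\<^sub>\<epsilon>\<^sub>\<eta> *v d \<in> \<rho> (\<phi>\<^sub>\<epsilon>\<^sub>\<eta> (\<mu> (\<iota>\<^sub>\<epsilon> P) Q))"
      using tk\<^sub>\<epsilon>\<^sub>\<eta> \<mu>(1)[OF \<iota>P] d by (simp add: twisted_kummer_map_def \<open>\<phi> = (\<lambda>P. \<mu> P Q)\<close>)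
    then have d': "\<psi>\<^sub>\<epsilon>\<^sub>\<eta> *v d \<in> \<rho> (?p \<otimes>\<^bsub>J\<^esub> inv\<^bsub>J\<^esub> ?q)" by (simp add: \<mu>(2)[OF \<iota>P] \<phi>\<iota> sym)
    have "\<forall>P\<in>?K. \<forall>Q\<in>?K. \<forall>x\<in>\<rho> P. \<forall>y\<in>\<rho> Q.
        \<forall>s\<in>\<rho> (P \<otimes>\<^bsub>J\<^esub> Q). \<forall>d\<in>\<rho> (P \<otimes>\<^bsub>J\<^esub> inv\<^bsub>J\<^esub> Q).
        \<exists>c. c \<noteq> 0 \<and> (\<forall>i j. \<Phi> i j x y = c * (s $ i * d $ j + d $ i * s $ j))"
      using \<open>flynn_forms f J \<rho> \<Phi>\<close> unfolding flynn_forms_def by (rule conjunct2)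
    then obtain r where r: "r \<noteq> 0" "\<forall>i j. \<Phi> i j (\<psi>\<^sub>\<epsilon> *v v) (\<psi>\<^sub>\<eta> *v xQ) = r * ((\<psi>\<^sub>\<epsilon>\<^sub>\<eta> *v s) $ i * (\<psi>\<^sub>\<epsilon>\<^sub>\<eta> *v d) $ j
        + (\<psi>\<^sub>\<epsilon>\<^sub>\<eta> *v d) $ i * (\<psi>\<^sub>\<epsilon>\<^sub>\<eta> *v s) $ j)"
      using p q x y s' d' by blast
    \<comment> \<open>\<open>C\<close> comes from the normalization of the twisted form, 2 from the
      symmetrization and \<open>r\<close> from Flynn's relation. None of them depends on
      \<open>m\<close>.\<close>
    have "D m v = (C * (2 * r)) * linear_form m s * linear_form m d" for m
      unfolding D_def C(2) inv_\<psi>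
        form222_of_symmetrized_product[of \<Phi> _ _ r "\<psi>\<^sub>\<epsilon>\<^sub>\<eta> *v s" "\<psi>\<^sub>\<epsilon>\<^sub>\<eta> *v d", OF r(2)]
      by (simp add: mult_ac)
    moreover have "C * (2 * r) \<noteq> 0" using C(1) r(1) by simp
    ultimately show "\<exists>r. r \<noteq> 0 \<and> (\<forall>m. D m v = r * linear_form m s * linear_form m d)" by blast
  qed
  have g: "g = (\<lambda>P. quotient_fun (D c) (\<lambda>x. linear_form (axis 1 1) x ^ 2) (h\<^sub>\<epsilon> P))"
    unfolding D_def[abs_def] linear_form_axis by (rule \<open>g = _\<close>)
  note main = reg.divisor_of_product_form[OF h\<^sub>\<epsilon> h1 h2 D key nz nz1 nz2, folded g]
  have pull: "hyperplane_pullback J\<^sub>\<epsilon>\<^sub>\<eta> h\<^sub>\<epsilon>\<^sub>\<eta> c (\<phi> ` Y) = hyperplane_pullback J\<^sub>\<epsilon> ?h1 c Y"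
    if "prime_divisor J\<^sub>\<epsilon> Y" for Y
    by (rule \<phi>.hyperplane_pullback_transport[OF reg\<^sub>\<epsilon>\<^sub>\<eta> h\<^sub>\<epsilon>\<^sub>\<eta> that nz\<^sub>\<epsilon>\<^sub>\<eta>])
  have "div_of J\<^sub>\<epsilon> g Y = iso_pullback J\<^sub>\<epsilon> \<phi> H\<^sub>\<epsilon>\<^sub>\<eta> Y
        + iso_pullback J\<^sub>\<epsilon> \<iota>\<^sub>\<epsilon> (iso_pullback J\<^sub>\<epsilon> \<phi> H\<^sub>\<epsilon>\<^sub>\<eta>) Y - 2 * H\<^sub>\<epsilon> Y" for Y
  proof (cases "prime_divisor J\<^sub>\<epsilon> Y")
    case True
    have \<iota>Y: "prime_divisor J\<^sub>\<epsilon> (\<iota>\<^sub>\<epsilon> ` Y)" by (rule \<iota>.prime_divisor_image[OF True])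
    have "iso_pullback J\<^sub>\<epsilon> \<phi> H\<^sub>\<epsilon>\<^sub>\<eta> Y = hyperplane_pullback J\<^sub>\<epsilon> ?h1 c Y"
      using True pull[OF True] by (simp add: iso_pullback_def \<open>H\<^sub>\<epsilon>\<^sub>\<eta> = _\<close>)
    moreover have "iso_pullback J\<^sub>\<epsilon> \<iota>\<^sub>\<epsilon> (iso_pullback J\<^sub>\<epsilon> \<phi> H\<^sub>\<epsilon>\<^sub>\<eta>) Y = hyperplane_pullback J\<^sub>\<epsilon> ?h2 c Y"
      using True \<iota>Y pull[OF \<iota>Y] \<iota>.hyperplane_pullback_transport[OF reg.regular h1 True nz1]
      by (simp add: iso_pullback_def \<open>H\<^sub>\<epsilon>\<^sub>\<eta> = _\<close>)
    moreover have "div_of J\<^sub>\<epsilon> g Y = order_along J\<^sub>\<epsilon> Y g" using True by (simp add: div_of_def)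
    ultimately show ?thesis
      using main(2)[OF True] by (simp add: \<open>H\<^sub>\<epsilon> = _\<close>)
  next
    \<comment> \<open>Away from prime divisors every divisor is 0 by convention.\<close>
    case False
    then show ?thesis
      by (simp add: div_of_def iso_pullback_def \<open>H\<^sub>\<epsilon> = _\<close> hyperplane_pullback_def)
  qed
  with main(1) show ?thesis
    unfolding \<epsilon>.X.local_units_self_iff by blast
qed

end
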